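(* Let $G$ be a finite group with presentation determined by $F/R$, that is, $F$ is a free group, $R$ is a normal subgroup of $F$, and $G=F/R$. Let $N=S/R$ be a normal subgroup of $G$, where $S$ is a normal subgroup of $F$ containing $R$. (i) The map $\mathrm{inf}:\mathrm{B}_0(G/N)\to\mathrm{B}_0(G)$ is an epimorphism if and only if $$R\cap\langle K(F)\cap S\rangle=\langle K(F)\cap R\rangle.$$ (ii) The map $\mathrm{inf}:\mathrm{B}_0(G/N)\to\mathrm{B}_0(G)$ is the zero map if and only if $$R\cap\langle K(F)\cap S\rangle=F'\cap R.$$
   Context: For a group $X$, $[x,y]=x^{-1}y^{-1}xy$, $X'$ is the commutator subgroup, and $K(X)=\{[x,y]\mid x,y\in X\}$ is the set of commutators; $\langle T\rangle$ denotes the subgroup generated by a set $T$. $\mathbb{Q}/\mathbb{Z}$ is regarded as a trivial module. For a finite group $G$, the Bogomolov multiplier is $$\mathrm{B}_0(G)=\bigcap_{A\le G,\ A\text{ abelian}}\ker\big(\mathrm{res}^G_A: \mathrm{H}^2(G,\mathbb{Q}/\mathbb{Z})\to \mathrm{H}^2(A,\mathbb{Q}/\mathbb{Z})\big).$$ The inflation map $\mathrm{inf}:\mathrm{B}_0(G/N)\to\mathrm{B}_0(G)$ sends the class of a 2-cocycle $\alpha$ to the class of $\beta(x,y)=\alpha(xN,yN)$. *)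

theory Defs
  imports Complex_Main "HOL-Algebra.Elementary_Groups"
begin

text \<open>
  The set \<open>K(X)\<close> of commutators, for the convention \<open>[x,y] = x\<^sup>-\<^sup>1y\<^sup>-\<^sup>1xy\<close>. The commutator subgroup
  \<open>X'\<close> is \<^term>\<open>derived X (carrier X)\<close> from the library, which is generated by the elements
  \<open>xyx\<^sup>-\<^sup>1y\<^sup>-\<^sup>1\<close>; the two sets of commutators coincide (replace \<open>x, y\<close> by their inverses).
\<close>

definition commutators :: "('a, 'b) monoid_scheme \<Rightarrow> 'a set" where
  "commutators X = {inv\<^bsub>X\<^esub> x \<otimes>\<^bsub>X\<^esub> inv\<^bsub>X\<^esub> y \<otimes>\<^bsub>X\<^esub> x \<otimes>\<^bsub>X\<^esub> y | x y. x \<in> carrier X \<and> y \<in> carrier X}"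

text \<open>
  A word over \<open>B \<union> B\<^sup>-\<^sup>1\<close> is a list of pairs: \<open>(x, True)\<close> stands for \<open>x\<close> and \<open>(x, False)\<close>
  for \<open>x\<^sup>-\<^sup>1\<close>. A group is free on \<open>B\<close> if \<open>B\<close> generates it and no nonempty reduced word in
  \<open>B \<union> B\<^sup>-\<^sup>1\<close> represents the identity. The basis may be infinite or empty.
\<close>

fun word_value :: "('a, 'b) monoid_scheme \<Rightarrow> ('a \<times> bool) list \<Rightarrow> 'a" where
  "word_value G [] = \<one>\<^bsub>G\<^esub>"
| "word_value G ((x, e) # w) = (if e then x else inv\<^bsub>G\<^esub> x) \<otimes>\<^bsub>G\<^esub> word_value G w"

definition reduced_word :: "('a \<times> bool) list \<Rightarrow> bool" where
  "reduced_word w \<longleftrightarrow> successively (\<lambda>(x, d) (y, e). \<not> (x = y \<and> d \<noteq> e)) w"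

definition free_on :: "('a, 'b) monoid_scheme \<Rightarrow> 'a set \<Rightarrow> bool" where
  "free_on G B \<longleftrightarrow> B \<subseteq> carrier G \<and> generate G B = carrier G \<and>
     (\<forall>w. w \<noteq> [] \<and> fst ` set w \<subseteq> B \<and> reduced_word w \<longrightarrow> word_value G w \<noteq> \<one>\<^bsub>G\<^esub>)"

definition free_group :: "('a, 'b) monoid_scheme \<Rightarrow> bool" where
  "free_group G \<longleftrightarrow> group G \<and> (\<exists>B. free_on G B)"

text \<open>
  Here \<open>G\<close> is a group and \<open>A\<close> an abelian group, written multiplicatively, with trivial
  \<open>G\<close>-action. Cochains are extensional functions on \<^term>\<open>carrier G \<times> carrier G\<close>, so that equal
  cochains are equal as functions. No normalisation is imposed.
\<close>

definition cocycles2 ::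
    "('g, 'u) monoid_scheme \<Rightarrow> ('c, 'v) monoid_scheme \<Rightarrow> ('g \<times> 'g \<Rightarrow> 'c) monoid" where
  "cocycles2 G A =
     \<lparr>carrier = {f \<in> carrier G \<times> carrier G \<rightarrow>\<^sub>E carrier A.
        \<forall>x\<in>carrier G. \<forall>y\<in>carrier G. \<forall>z\<in>carrier G.
          f (x, y) \<otimes>\<^bsub>A\<^esub> f (x \<otimes>\<^bsub>G\<^esub> y, z) = f (y, z) \<otimes>\<^bsub>A\<^esub> f (x, y \<otimes>\<^bsub>G\<^esub> z)},
      mult = (\<lambda>f g. \<lambda>p\<in>carrier G \<times> carrier G. f p \<otimes>\<^bsub>A\<^esub> g p),
      one = (\<lambda>p\<in>carrier G \<times> carrier G. \<one>\<^bsub>A\<^esub>)\<rparr>"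

definition coboundary2 ::
    "('g, 'u) monoid_scheme \<Rightarrow> ('c, 'v) monoid_scheme \<Rightarrow> ('g \<Rightarrow> 'c) \<Rightarrow> ('g \<times> 'g \<Rightarrow> 'c)" where
  "coboundary2 G A h =
     (\<lambda>(x, y)\<in>carrier G \<times> carrier G. h x \<otimes>\<^bsub>A\<^esub> h y \<otimes>\<^bsub>A\<^esub> inv\<^bsub>A\<^esub> h (x \<otimes>\<^bsub>G\<^esub> y))"

definition coboundaries2 ::
    "('g, 'u) monoid_scheme \<Rightarrow> ('c, 'v) monoid_scheme \<Rightarrow> ('g \<times> 'g \<Rightarrow> 'c) set" where
  "coboundaries2 G A = coboundary2 G A ` (carrier G \<rightarrow> carrier A)"

definition H2 ::
    "('g, 'u) monoid_scheme \<Rightarrow> ('c, 'v) monoid_scheme \<Rightarrow> ('g \<times> 'g \<Rightarrow> 'c) set monoid" where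
  "H2 G A = cocycles2 G A Mod coboundaries2 G A"

text \<open>
  The map \<open>H\<^sup>2(G, A) \<rightarrow> H\<^sup>2(H, A)\<close> induced by a homomorphism \<open>\<phi>\<close> from \<open>H\<close> to \<open>G\<close>: the class of
  \<open>\<alpha>\<close> goes to the class of \<open>(x, y) \<mapsto> \<alpha>(\<phi>(x), \<phi>(y))\<close>. The use of \<^const>\<open>the_elem\<close> is the library's
  idiom for maps out of a quotient: all representatives of a class give the same value.
\<close>

definition pullback2 ::
    "('h, 'u) monoid_scheme \<Rightarrow> ('h \<Rightarrow> 'g) \<Rightarrow> ('g \<times> 'g \<Rightarrow> 'c) \<Rightarrow> ('h \<times> 'h \<Rightarrow> 'c)" where
  "pullback2 H \<phi> \<alpha> = (\<lambda>(x, y)\<in>carrier H \<times> carrier H. \<alpha> (\<phi> x, \<phi> y))"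

definition H2_map ::
    "('h, 'u) monoid_scheme \<Rightarrow> ('c, 'v) monoid_scheme \<Rightarrow> ('h \<Rightarrow> 'g) \<Rightarrow>
     ('g \<times> 'g \<Rightarrow> 'c) set \<Rightarrow> ('h \<times> 'h \<Rightarrow> 'c) set" where
  "H2_map H A \<phi> c =
     the_elem ((\<lambda>\<alpha>. coboundaries2 H A #>\<^bsub>cocycles2 H A\<^esub> pullback2 H \<phi> \<alpha>) ` c)"

definition res2 ::
    "('g, 'u) monoid_scheme \<Rightarrow> ('c, 'v) monoid_scheme \<Rightarrow> 'g set \<Rightarrow>
     ('g \<times> 'g \<Rightarrow> 'c) set \<Rightarrow> ('g \<times> 'g \<Rightarrow> 'c) set" where
  "res2 G M A = H2_map (G\<lparr>carrier := A\<rparr>) M (\<lambda>x. x)"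

definition rat_group :: "rat monoid" where
  "rat_group = \<lparr>carrier = UNIV, mult = (+), one = 0\<rparr>"

definition QmodZ :: "rat set monoid" where
  "QmodZ = rat_group Mod \<int>"

definition B0 :: "('g, 'u) monoid_scheme \<Rightarrow> ('g \<times> 'g \<Rightarrow> rat set) set monoid" where
  "B0 G = (H2 G QmodZ)\<lparr>carrier :=
     (\<Inter>A\<in>{A. subgroup A G \<and> comm_group (G\<lparr>carrier := A\<rparr>)}.
        kernel (H2 G QmodZ) (H2 (G\<lparr>carrier := A\<rparr>) QmodZ) (res2 G QmodZ A))\<rparr>"

text \<open>
  Inflation is the map on \<open>H\<^sup>2\<close> induced by the projection \<open>x \<mapsto> xN\<close> onto \<^term>\<open>G Mod N\<close>; it is only
  used on \<^term>\<open>carrier (B0 (G Mod N))\<close>. The right coset equals \<open>xN\<close> since \<open>N\<close> is normal.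
\<close>

definition inf_B0 ::
    "('g, 'u) monoid_scheme \<Rightarrow> 'g set \<Rightarrow>
     ('g set \<times> 'g set \<Rightarrow> rat set) set \<Rightarrow> ('g \<times> 'g \<Rightarrow> rat set) set" where
  "inf_B0 G N = H2_map G QmodZ (\<lambda>x. N #>\<^bsub>G\<^esub> x)"

end

theory Submission
  imports Defs
begin

text \<open>
  Let \<open>\<pi> : F \<rightarrow> P\<close> be a surjection with kernel \<open>M\<close>, where \<open>F\<close> is free, and let \<open>D = \<rat>/\<int>\<close>. The pullback to
  \<open>F\<close> of a cocycle \<open>\<alpha>\<close> on \<open>P\<close> is the coboundary of some \<open>h : F \<rightarrow> D\<close>, and \<open>\<mu> = h|\<^sub>M / h(1)\<close> is a
  homomorphism \<open>M \<rightarrow> D\<close> invariant under conjugation by \<open>F\<close>. Every such homomorphism arises in this way;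
  the class of \<open>\<alpha>\<close> is trivial iff \<open>\<mu>\<close> vanishes on \<open>M \<inter> F'\<close>, and it lies in the Bogomolov multiplier
  iff \<open>\<mu>\<close> vanishes on \<open>\<langle>K(F) \<inter> M\<rangle>\<close>. Since \<open>h\<close> also lifts the inflated cocycle, inflation restricts \<open>\<mu>\<close>
  from \<open>S\<close> to \<open>R\<close>. Both criteria then follow because \<open>D\<close> is an injective cogenerator of abelian groups.
\<close>

subsection \<open>Free groups are projective\<close>

text \<open>Why K(F), and not F', governs the Bogomolov multiplier: a commutator [x, y] of
  \<open>F\<close> lies in \<open>M\<close> iff the images of \<open>x\<close> and \<open>y\<close>
  commute in \<open>P\<close>, and then \<mu>([x, y]) is the quotient \<alpha>(y, x)/\<alpha>(x, y)
  taken at these images. Abelian subgroups of \<open>P\<close> see exactly this lack of symmetry.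
  For the class itself only \<mu> on M \<inter> F' counts, because two functions on \<open>F\<close>
  with the same coboundary differ by a homomorphism from \<open>F\<close> to the abelian group
  \<open>D\<close>. So both criteria compare the characters of \<open>S\<close> trivial on
  \<langle>K(F) \<inter> S\<rangle> with those of \<open>R\<close> trivial on \<langle>K(F) \<inter>
  R\<rangle>, on the common ground R \<inter> F'.

  The obstacle is that \<open>R\<close>, \<open>S\<close> and \<open>F\<close> are not abelian,
  whereas injectivity of \<open>D\<close> concerns abelian groups. Instead of passing to quotients,
  homomorphisms are extended inside the nonabelian group, keeping them trivial on a normal subgroup
  that contains all commutators. The abelian quotients behind this may have elements of infinite
  order, so separating points by characters has to cover those too.\<close>

lemma word_value_closed:
  assumes "group G" "fst ` set w \<subseteq> carrier G"
  shows "word_value G w \<in> carrier G"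
  using assms(2)
proof (induction w)
  case Nil
  then show ?case using assms(1) by (simp add: group.is_monoid)
next
  case (Cons a w)
  interpret group G by fact
  show ?case using Cons by (cases a) auto
qed

lemma word_value_append:
  assumes "group G" "fst ` set v \<subseteq> carrier G" "fst ` set w \<subseteq> carrier G"
  shows "word_value G (v @ w) = word_value G v \<otimes>\<^bsub>G\<^esub> word_value G w"
  using assms(2)
proof (induction v)
  case Nil
  then show ?case using assms word_value_closed[of G w] by (simp add: group.is_monoid)
next
  case (Cons a v)
  interpret group G by fact
  show ?case using Cons assms word_value_closed[of G w] word_value_closed[of G v]
    by (cases a) (auto simp: m_assoc)
qed

lemma word_value_hom:
  assumes "group_hom G H f" "fst ` set w \<subseteq> carrier G"
  shows "f (word_value G w) = word_value H (map (apfst f) w)"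
  using assms(2)
proof (induction w)
  case Nil
  interpret group_hom G H f by fact
  show ?case by simp
next
  case (Cons a w)
  interpret group_hom G H f by fact
  show ?case using Cons word_value_closed[of G w] by (cases a) auto
qed

text \<open>Letters are prepended to a word that is already reduced, so a cancellation can occur
  only at the front, and removing that one pair leaves the tail of a reduced word.\<close>

lemma word_value_reduce:
  assumes "group G" "fst ` set w \<subseteq> T" "T \<subseteq> carrier G"
  shows "\<exists>v. fst ` set v \<subseteq> T \<and> reduced_word v \<and> word_value G v = word_value G w"
  using assms(2)
proof (induction w)
  case Nil
  show ?case by (rule exI[of _ "[]"]) (simp add: reduced_word_def)
next
  case (Cons a w)
  interpret group G by fact
  obtain x e where a: "a = (x, e)" by (cases a)
  have x: "x \<in> T" "x \<in> carrier G" using Cons.prems a assms by auto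
  obtain v where v: "fst ` set v \<subseteq> T" "reduced_word v" "word_value G v = word_value G w"
    using Cons by auto
  show ?case
  proof (cases "\<exists>u. v = (x, \<not> e) # u")
    case True
    then obtain u where u: "v = (x, \<not> e) # u" by blast
    have "word_value G u \<in> carrier G" using word_value_closed[of G u] v u assms by auto
    then have "word_value G u = word_value G (a # w)"
      using x v(3)[symmetric] by (cases e) (simp_all add: a u m_assoc[symmetric])
    moreover have "reduced_word u"
      using v(2) u by (cases u) (auto simp: reduced_word_def)
    ultimately show ?thesis using v u by auto
  next
    case False
    then have "reduced_word (a # v)"
      using v(2) a by (cases v) (auto simp: reduced_word_def)
    then show ?thesis using v x a by (intro exI[of _ "a # v"]) auto
  qed
qed

lemma generate_word_value:
  assumes "group G" "T \<subseteq> carrier G" "x \<in> generate G T"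
  shows "\<exists>w. fst ` set w \<subseteq> T \<and> word_value G w = x"
  using assms(3)
proof (induction rule: generate.induct)
  case one
  then show ?case by (intro exI[of _ "[]"]) simp
next
  case (incl h)
  interpret group G by fact
  show ?case using incl assms by (intro exI[of _ "[(h, True)]"]) auto
next
  case (inv h)
  interpret group G by fact
  show ?case using inv assms by (intro exI[of _ "[(h, False)]"]) auto
next
  case (eng h1 h2)
  then obtain v w where "fst ` set v \<subseteq> T" "word_value G v = h1" "fst ` set w \<subseteq> T" "word_value G w = h2"
    by blast
  then show ?case
    using assms word_value_append[of G v w] by (intro exI[of _ "v @ w"]) auto
qed

text \<open>Injectivity prevents the map from turning two different letters into a cancelling pair.
  It will hold for a surjection restricted to chosen preimages of a basis.\<close>

lemma reduced_word_map:
  assumes "reduced_word w" "inj_on f (fst ` set w)"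
  shows "reduced_word (map (apfst f) w)"
  unfolding reduced_word_def successively_map
proof (rule successively_mono)
  show "successively (\<lambda>(x, d) (y, e). \<not> (x = y \<and> d \<noteq> e)) w"
    using assms by (simp add: reduced_word_def)
qed (use assms(2) in \<open>force dest: inj_onD\<close>)

text \<open>
  The subgroup of \<open>E\<close> generated by preimages of the basis maps isomorphically onto \<open>F\<close>: an element
  of it is the value of a reduced word, whose image is trivial only if the word is empty.
\<close>

lemma free_group_section:
  assumes F: "free_group F" and E: "group E" and p: "p \<in> epi E F"
  shows "\<exists>s \<in> hom F E. \<forall>x \<in> carrier F. p (s x) = x"
proof -
  obtain B where B: "free_on F B" and gF: "group F" using F by (auto simp: free_group_def)
  have BF: "B \<subseteq> carrier F" "generate F B = carrier F" using B by (auto simp: free_on_def)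
  interpret E: group E by fact
  interpret p: group_hom E F p
    using p E gF by (simp add: epi_def group_hom_def group_hom_axioms_def)
  define t where "t = (\<lambda>b. SOME x. x \<in> carrier E \<and> p x = b)"
  have t: "t b \<in> carrier E" "p (t b) = b" if "b \<in> B" for b
  proof -
    have "\<exists>x. x \<in> carrier E \<and> p x = b" using p BF that unfolding epi_def by (metis (mono_tags, lifting) imageE mem_Collect_eq subsetD)
    then have "t b \<in> carrier E \<and> p (t b) = b" unfolding t_def by (rule someI_ex)
    then show "t b \<in> carrier E" "p (t b) = b" by auto
  qed
  define K where "K = generate E (t ` B)"
  have K: "subgroup K E" unfolding K_def by (rule E.generate_is_subgroup) (use t in auto)
  have Kc: "K \<subseteq> carrier E" using K by (rule subgroup.subset)
  have "p ` K = generate F (p ` t ` B)"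
    unfolding K_def by (rule p.generate_img[symmetric]) (use t in auto)
  also have "p ` t ` B = B" using t by (force simp: image_image)
  finally have onto: "p ` K = carrier F" using BF by simp
  have triv: "x = \<one>\<^bsub>E\<^esub>" if x: "x \<in> K" "p x = \<one>\<^bsub>F\<^esub>" for x
  proof -
    have tB: "t ` B \<subseteq> carrier E" using t by auto
    obtain w0 where "fst ` set w0 \<subseteq> t ` B" "word_value E w0 = x"
      using generate_word_value[OF E tB] x(1) unfolding K_def by blast
    then obtain w where w: "fst ` set w \<subseteq> t ` B" "reduced_word w" "word_value E w = x"
      using word_value_reduce[OF E _ tB] by metis
    have inj: "inj_on p (t ` B)" using t by (auto simp: inj_on_def)
    have "reduced_word (map (apfst p) w)"
      using w inj by (blast intro: reduced_word_map inj_on_subset)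
    moreover have "word_value F (map (apfst p) w) = \<one>\<^bsub>F\<^esub>"
      using word_value_hom[OF p.group_hom_axioms, of w] w tB x by auto
    moreover have "fst ` set (map (apfst p) w) \<subseteq> B"
      using w t by (auto simp: image_subset_iff)
    ultimately have "w = []" using B unfolding free_on_def by blast
    then show ?thesis using w by simp
  qed
  have inj: "x = y" if "x \<in> K" "y \<in> K" "p x = p y" for x y
  proof -
    have c: "x \<in> carrier E" "y \<in> carrier E" using that Kc by auto
    have "x \<otimes>\<^bsub>E\<^esub> inv\<^bsub>E\<^esub> y \<in> K" using that K by (simp add: subgroup.m_closed subgroup.m_inv_closed)
    moreover have "p (x \<otimes>\<^bsub>E\<^esub> inv\<^bsub>E\<^esub> y) = \<one>\<^bsub>F\<^esub>" using that c by simp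
    ultimately have "x \<otimes>\<^bsub>E\<^esub> inv\<^bsub>E\<^esub> y = \<one>\<^bsub>E\<^esub>" by (rule triv)
    then show ?thesis using c by (metis E.inv_equality E.inv_closed E.inv_inv)
  qed
  define s where "s = (\<lambda>x. SOME y. y \<in> K \<and> p y = x)"
  have s: "s x \<in> K" "p (s x) = x" if "x \<in> carrier F" for x
  proof -
    have "\<exists>y. y \<in> K \<and> p y = x" using onto that by (metis imageE)
    then have "s x \<in> K \<and> p (s x) = x" unfolding s_def by (rule someI_ex)
    then show "s x \<in> K" "p (s x) = x" by auto
  qed
  have "s \<in> hom F E"
  proof (rule homI)
    show "s x \<in> carrier E" if "x \<in> carrier F" for x using s that Kc by auto
    \<comment> \<open>Both sides lie in \<open>K\<close>, on which \<open>p\<close> is injective, so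
      comparing images suffices.\<close>
    show "s (x \<otimes>\<^bsub>F\<^esub> y) = s x \<otimes>\<^bsub>E\<^esub> s y" if "x \<in> carrier F" "y \<in> carrier F" for x y
    proof (rule inj)
      show "s (x \<otimes>\<^bsub>F\<^esub> y) \<in> K" using s that by simp
      show "s x \<otimes>\<^bsub>E\<^esub> s y \<in> K" using s that K by (simp add: subgroup.m_closed)
      have "s x \<in> carrier E" "s y \<in> carrier E" using s that Kc by auto
      then show "p (s (x \<otimes>\<^bsub>F\<^esub> y)) = p (s x \<otimes>\<^bsub>E\<^esub> s y)" using s that by simp
    qed
  qed
  then show ?thesis using s by blast
qed

subsection \<open>Extending homomorphisms to a divisible group\<close>

definition divisible :: "('c, 'v) monoid_scheme \<Rightarrow> bool" where
  "divisible D \<longleftrightarrow> (\<forall>a\<in>carrier D. \<forall>n>0. \<exists>b\<in>carrier D. b [^]\<^bsub>D\<^esub> (n::nat) = a)"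

lemma int_subgroup_generator:
  fixes I :: "int set"
  assumes zero: "0 \<in> I" and diff: "\<And>a b. a \<in> I \<Longrightarrow> b \<in> I \<Longrightarrow> a - b \<in> I"
  shows "\<exists>n::nat. int n \<in> I \<and> (\<forall>k\<in>I. int n dvd k)"
proof (cases "I \<subseteq> {0}")
  case True
  then show ?thesis using zero by (intro exI[of _ 0]) auto
next
  case False
  then obtain a where a: "a \<in> I" "a \<noteq> 0" by blast
  have neg: "- b \<in> I" if "b \<in> I" for b using diff[OF zero that] by simp
  then have "int (nat \<bar>a\<bar>) \<in> I" using a by (simp add: abs_if)
  then have ex: "\<exists>n::nat. n > 0 \<and> int n \<in> I" using a by (intro exI[of _ "nat \<bar>a\<bar>"]) simp
  define n where "n = (LEAST n::nat. n > 0 \<and> int n \<in> I)"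
  have n: "n > 0" "int n \<in> I" using LeastI_ex[OF ex] by (simp_all add: n_def)
  have mult: "int m * int n \<in> I" for m :: nat
    by (induction m) (use zero n diff[OF _ neg] in \<open>auto simp: algebra_simps\<close>)
  have mult': "q * int n \<in> I" for q :: int
    using mult[of "nat q"] neg[OF mult[of "nat (- q)"]] by (cases "q \<ge> 0") auto
  have "int n dvd k" if "k \<in> I" for k
  proof -
    have "k mod int n \<in> I" using diff[OF that mult'[of "k div int n"]] by (simp add: minus_div_mult_eq_mod)
    then have "int (nat (k mod int n)) \<in> I" using n by simp
    moreover have "nat (k mod int n) < n" using n by (simp add: nat_less_iff)
    ultimately have "nat (k mod int n) = 0" 
      using not_less_Least[of "nat (k mod int n)" "\<lambda>n. n > 0 \<and> int n \<in> I"]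
      unfolding n_def[symmetric] by (metis neq0_conv)
    then have "k mod int n = 0" using n pos_mod_sign[of "int n" k] by linarith
    then show ?thesis by auto
  qed
  then show ?thesis using n by blast
qed

text \<open>
  A homomorphism from a subgroup of \<open>X\<close> to \<open>D\<close> is represented by its graph \<open>W\<close>. The graph is assumed
  to contain \<open>(c, \<one>)\<close> for all commutators \<open>c\<close>, so that its domain is a normal subgroup.
\<close>

locale partial_hom = X: group X + D: comm_group D
  for X :: "('a, 'b) monoid_scheme" and D :: "('c, 'v) monoid_scheme" and W :: "('a \<times> 'c) set" +
  assumes W: "subgroup W (X \<times>\<times> D)"
    and functional: "\<And>d. (\<one>\<^bsub>X\<^esub>, d) \<in> W \<Longrightarrow> d = \<one>\<^bsub>D\<^esub>"
    and commutator: "\<And>c. c \<in> commutators X \<Longrightarrow> (c, \<one>\<^bsub>D\<^esub>) \<in> W"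
begin

lemma closed: "(x, d) \<in> W \<Longrightarrow> x \<in> carrier X" "(x, d) \<in> W \<Longrightarrow> d \<in> carrier D"
  using subgroup.subset[OF W] by auto

lemma one: "(\<one>\<^bsub>X\<^esub>, \<one>\<^bsub>D\<^esub>) \<in> W"
  using subgroup.one_closed[OF W] by simp

lemma mult: "(x, d) \<in> W \<Longrightarrow> (y, e) \<in> W \<Longrightarrow> (x \<otimes>\<^bsub>X\<^esub> y, d \<otimes>\<^bsub>D\<^esub> e) \<in> W"
  using subgroup.m_closed[OF W, of "(x, d)" "(y, e)"] by simp

lemma minv: "(x, d) \<in> W \<Longrightarrow> (inv\<^bsub>X\<^esub> x, inv\<^bsub>D\<^esub> d) \<in> W"
  using subgroup.m_inv_closed[OF W, of "(x, d)"] closed[of x d]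
  by (simp add: inv_DirProd X.is_group D.is_group)

lemma npow: "(x, d) \<in> W \<Longrightarrow> (x [^]\<^bsub>X\<^esub> (n::nat), d [^]\<^bsub>D\<^esub> n) \<in> W"
  by (induction n) (auto simp: one mult)

lemma ipow: "(x, d) \<in> W \<Longrightarrow> (x [^]\<^bsub>X\<^esub> (n::int), d [^]\<^bsub>D\<^esub> n) \<in> W"
  using npow[of x d] minv[OF npow[of x d]] closed[of x d]
  by (cases n rule: int_cases2) (simp_all add: X.int_pow_neg D.int_pow_neg int_pow_int)

lemma unique:
  assumes "(x, d) \<in> W" "(x, e) \<in> W"
  shows "d = e"
proof -
  have c: "x \<in> carrier X" "d \<in> carrier D" "e \<in> carrier D" using assms closed by auto
  have "d \<otimes>\<^bsub>D\<^esub> inv\<^bsub>D\<^esub> e = \<one>\<^bsub>D\<^esub>"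
    using functional[of "d \<otimes>\<^bsub>D\<^esub> inv\<^bsub>D\<^esub> e"] mult[OF assms(1) minv[OF assms(2)]] c by simp
  then show ?thesis using c D.inv_equality[of d "inv\<^bsub>D\<^esub> e"] by simp
qed

text \<open>\<open>x [x, y] = y^-1 x y\<close>, and the graph contains the commutator with value
  one. This is how the assumption on commutators makes the domain normal and the partial
  homomorphism invariant under conjugation.\<close>

lemma conj:
  assumes "(x, d) \<in> W" "y \<in> carrier X"
  shows "(inv\<^bsub>X\<^esub> y \<otimes>\<^bsub>X\<^esub> x \<otimes>\<^bsub>X\<^esub> y, d) \<in> W"
proof -
  have c: "x \<in> carrier X" "d \<in> carrier D" using assms closed by auto
  have "(inv\<^bsub>X\<^esub> x \<otimes>\<^bsub>X\<^esub> inv\<^bsub>X\<^esub> y \<otimes>\<^bsub>X\<^esub> x \<otimes>\<^bsub>X\<^esub> y, \<one>\<^bsub>D\<^esub>) \<in> W"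
    using c assms by (intro commutator) (auto simp: commutators_def)
  moreover have "x \<otimes>\<^bsub>X\<^esub> (inv\<^bsub>X\<^esub> x \<otimes>\<^bsub>X\<^esub> inv\<^bsub>X\<^esub> y \<otimes>\<^bsub>X\<^esub> x \<otimes>\<^bsub>X\<^esub> y) = inv\<^bsub>X\<^esub> y \<otimes>\<^bsub>X\<^esub> x \<otimes>\<^bsub>X\<^esub> y"
    using c assms by (simp add: X.m_assoc[symmetric])
  ultimately show ?thesis using mult[OF assms(1)] c by fastforce
qed

text \<open>The candidate extension to the subgroup generated by the domain and \<open>y\<close>,
  with \<open>y\<close> sent to \<open>d\<close>. Since the domain is normal, products of a power of
  \<open>y\<close> with an element of the domain already form that subgroup.\<close>

definition adjoin :: "'a \<Rightarrow> 'c \<Rightarrow> ('a \<times> 'c) set" where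
  "adjoin y d = {(y [^]\<^bsub>X\<^esub> k \<otimes>\<^bsub>X\<^esub> x, d [^]\<^bsub>D\<^esub> k \<otimes>\<^bsub>D\<^esub> e) | (k::int) x e. (x, e) \<in> W}"

text \<open>The only obstruction to sending \<open>y\<close> to \<open>d\<close> lies in the powers
  of \<open>y\<close> that already belong to the domain, and \<open>compat\<close> says that
  \<open>d\<close> has the right powers there.\<close>

lemma partial_hom_adjoin:
  assumes y: "y \<in> carrier X" and d: "d \<in> carrier D"
    and compat: "\<And>(k::int) e. (y [^]\<^bsub>X\<^esub> k, e) \<in> W \<Longrightarrow> e = d [^]\<^bsub>D\<^esub> k"
  shows "partial_hom X D (adjoin y d)" "W \<subseteq> adjoin y d" "(y, d) \<in> adjoin y d"
proof -
  have memI: "(u, v) \<in> adjoin y d"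
    if "(x, e) \<in> W" "u = y [^]\<^bsub>X\<^esub> k \<otimes>\<^bsub>X\<^esub> x" "v = d [^]\<^bsub>D\<^esub> k \<otimes>\<^bsub>D\<^esub> e" for u v x e and k :: int
    using that unfolding adjoin_def by blast
  show sub: "W \<subseteq> adjoin y d"
  proof safe
    fix x e assume "(x, e) \<in> W"
    then show "(x, e) \<in> adjoin y d" using closed[of x e] memI[of x e x 0 e] by simp
  qed
  show "(y, d) \<in> adjoin y d" using y d by (intro memI[OF one, of _ 1]) auto
  have "subgroup (adjoin y d) (X \<times>\<times> D)"
  proof (rule group.subgroupI)
    show "group (X \<times>\<times> D)" by (simp add: DirProd_group X.is_group D.is_group)
    show "adjoin y d \<subseteq> carrier (X \<times>\<times> D)" using y d closed by (auto simp: adjoin_def)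
    show "adjoin y d \<noteq> {}" using one sub by auto
    show "inv\<^bsub>X \<times>\<times> D\<^esub> a \<in> adjoin y d" if "a \<in> adjoin y d" for a
    proof -
      obtain k x e where a: "a = (y [^]\<^bsub>X\<^esub> (k::int) \<otimes>\<^bsub>X\<^esub> x, d [^]\<^bsub>D\<^esub> k \<otimes>\<^bsub>D\<^esub> e)" "(x, e) \<in> W"
        using \<open>a \<in> adjoin y d\<close> unfolding adjoin_def by blast
      define u where "u = y [^]\<^bsub>X\<^esub> k"
      define v where "v = d [^]\<^bsub>D\<^esub> k"
      have c: "x \<in> carrier X" "e \<in> carrier D" "u \<in> carrier X" "v \<in> carrier D"
        using a closed y d by (auto simp: u_def v_def)
      \<comment> \<open>To bring the inverse of \<open>u x\<close> back to the form power of
        \<open>y\<close> times element of the domain, \<open>x^-1\<close> is conjugated past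
        \<open>u\<close>; its value does not change.\<close>
      have w: "(u \<otimes>\<^bsub>X\<^esub> inv\<^bsub>X\<^esub> x \<otimes>\<^bsub>X\<^esub> inv\<^bsub>X\<^esub> u, inv\<^bsub>D\<^esub> e) \<in> W"
        using conj[OF minv[OF a(2)], of "inv\<^bsub>X\<^esub> u"] c by simp
      have pow: "y [^]\<^bsub>X\<^esub> - k = inv\<^bsub>X\<^esub> u" "d [^]\<^bsub>D\<^esub> - k = inv\<^bsub>D\<^esub> v"
        using y d by (simp_all add: u_def v_def X.int_pow_neg D.int_pow_neg)
      have "inv\<^bsub>X\<^esub> (u \<otimes>\<^bsub>X\<^esub> x) = inv\<^bsub>X\<^esub> u \<otimes>\<^bsub>X\<^esub> (u \<otimes>\<^bsub>X\<^esub> inv\<^bsub>X\<^esub> x \<otimes>\<^bsub>X\<^esub> inv\<^bsub>X\<^esub> u)"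
        using c by (simp add: X.inv_mult_group X.m_assoc[symmetric])
      moreover have "inv\<^bsub>D\<^esub> (v \<otimes>\<^bsub>D\<^esub> e) = inv\<^bsub>D\<^esub> v \<otimes>\<^bsub>D\<^esub> inv\<^bsub>D\<^esub> e" using c by (simp add: D.inv_mult)
      moreover have "inv\<^bsub>X \<times>\<times> D\<^esub> a = (inv\<^bsub>X\<^esub> (u \<otimes>\<^bsub>X\<^esub> x), inv\<^bsub>D\<^esub> (v \<otimes>\<^bsub>D\<^esub> e))"
        using c inv_DirProd[OF X.is_group D.is_group, of "u \<otimes>\<^bsub>X\<^esub> x" "v \<otimes>\<^bsub>D\<^esub> e"]
        by (simp add: a(1) u_def v_def)
      ultimately show ?thesis using memI[OF w, of _ "- k"] pow by simp
    qed
    show "a \<otimes>\<^bsub>X \<times>\<times> D\<^esub> b \<in> adjoin y d" if ab: "a \<in> adjoin y d" "b \<in> adjoin y d" for a b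
    proof -
      obtain k x e where a: "a = (y [^]\<^bsub>X\<^esub> (k::int) \<otimes>\<^bsub>X\<^esub> x, d [^]\<^bsub>D\<^esub> k \<otimes>\<^bsub>D\<^esub> e)" "(x, e) \<in> W"
        using ab unfolding adjoin_def by blast
      obtain l x' e' where b: "b = (y [^]\<^bsub>X\<^esub> (l::int) \<otimes>\<^bsub>X\<^esub> x', d [^]\<^bsub>D\<^esub> l \<otimes>\<^bsub>D\<^esub> e')" "(x', e') \<in> W"
        using ab unfolding adjoin_def by blast
      define u where "u = y [^]\<^bsub>X\<^esub> k"
      define v where "v = d [^]\<^bsub>D\<^esub> k"
      define s where "s = y [^]\<^bsub>X\<^esub> l"
      define t where "t = d [^]\<^bsub>D\<^esub> l"
      have c: "x \<in> carrier X" "e \<in> carrier D" "x' \<in> carrier X" "e' \<in> carrier D"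
        "u \<in> carrier X" "v \<in> carrier D" "s \<in> carrier X" "t \<in> carrier D"
        using a b closed y d by (auto simp: u_def v_def s_def t_def)
      have w: "(inv\<^bsub>X\<^esub> s \<otimes>\<^bsub>X\<^esub> x \<otimes>\<^bsub>X\<^esub> s \<otimes>\<^bsub>X\<^esub> x', e \<otimes>\<^bsub>D\<^esub> e') \<in> W"
        using mult[OF conj[OF a(2)] b(2)] c by simp
      have pow: "y [^]\<^bsub>X\<^esub> (k + l) = u \<otimes>\<^bsub>X\<^esub> s" "d [^]\<^bsub>D\<^esub> (k + l) = v \<otimes>\<^bsub>D\<^esub> t"
        using y d by (simp_all add: u_def v_def s_def t_def X.int_pow_mult D.int_pow_mult)
      have "s \<otimes>\<^bsub>X\<^esub> (inv\<^bsub>X\<^esub> s \<otimes>\<^bsub>X\<^esub> x \<otimes>\<^bsub>X\<^esub> s \<otimes>\<^bsub>X\<^esub> x') = x \<otimes>\<^bsub>X\<^esub> s \<otimes>\<^bsub>X\<^esub> x'"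
        using c by (simp add: X.m_assoc[symmetric])
      then have "u \<otimes>\<^bsub>X\<^esub> x \<otimes>\<^bsub>X\<^esub> (s \<otimes>\<^bsub>X\<^esub> x') = u \<otimes>\<^bsub>X\<^esub> s \<otimes>\<^bsub>X\<^esub> (inv\<^bsub>X\<^esub> s \<otimes>\<^bsub>X\<^esub> x \<otimes>\<^bsub>X\<^esub> s \<otimes>\<^bsub>X\<^esub> x')"
        using c by (simp add: X.m_assoc)
      moreover have "v \<otimes>\<^bsub>D\<^esub> e \<otimes>\<^bsub>D\<^esub> (t \<otimes>\<^bsub>D\<^esub> e') = v \<otimes>\<^bsub>D\<^esub> t \<otimes>\<^bsub>D\<^esub> (e \<otimes>\<^bsub>D\<^esub> e')"
        using c by (simp add: D.m_ac)
      ultimately show ?thesis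
        using memI[OF w, of _ "k + l"] pow by (simp add: a(1) b(1) u_def v_def s_def t_def)
    qed
  qed
  \<comment> \<open>A relation \<open>y^k x = 1\<close> places \<open>y^k = x^-1\<close> in the
    domain, where \<open>compat\<close> applies.\<close>
  moreover have "v = \<one>\<^bsub>D\<^esub>" if "(\<one>\<^bsub>X\<^esub>, v) \<in> adjoin y d" for v
  proof -
    obtain k x e where a: "\<one>\<^bsub>X\<^esub> = y [^]\<^bsub>X\<^esub> (k::int) \<otimes>\<^bsub>X\<^esub> x" "v = d [^]\<^bsub>D\<^esub> k \<otimes>\<^bsub>D\<^esub> e" "(x, e) \<in> W"
      using \<open>(\<one>\<^bsub>X\<^esub>, v) \<in> adjoin y d\<close> unfolding adjoin_def by blast
    have c: "x \<in> carrier X" "e \<in> carrier D" using a closed by auto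
    have "inv\<^bsub>X\<^esub> x = y [^]\<^bsub>X\<^esub> k" using a(1) c y by (metis X.int_pow_closed X.inv_equality)
    then have "inv\<^bsub>D\<^esub> e = d [^]\<^bsub>D\<^esub> k" using compat minv[OF a(3)] by metis
    then show ?thesis using a c by (metis D.l_inv)
  qed
  ultimately show "partial_hom X D (adjoin y d)"
    using sub commutator
    by (intro partial_hom.intro partial_hom_axioms.intro X.is_group D.comm_group_axioms) blast+
qed

text \<open>The exponents \<open>k\<close> with \<open>y^k\<close> in the domain are the multiples
  of some \<open>n\<close>. Any \<open>n\<close>-th root of the value at \<open>y^n\<close> is a
  consistent value for \<open>y\<close>, and divisibility provides such a root.\<close>

lemma adjoin_exists:
  assumes "divisible D" and y: "y \<in> carrier X"
  shows "\<exists>d. partial_hom X D (adjoin y d) \<and> W \<subseteq> adjoin y d \<and> (y, d) \<in> adjoin y d"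
proof -
  have "\<exists>d\<in>carrier D. \<forall>(k::int) e. (y [^]\<^bsub>X\<^esub> k, e) \<in> W \<longrightarrow> e = d [^]\<^bsub>D\<^esub> k"
  proof -
    define I where "I = {k::int. \<exists>e. (y [^]\<^bsub>X\<^esub> k, e) \<in> W}"
    have "\<exists>n::nat. int n \<in> I \<and> (\<forall>k\<in>I. int n dvd k)"
    proof (rule int_subgroup_generator)
      show "0 \<in> I" using one by (auto simp: I_def)
      show "k - l \<in> I" if "k \<in> I" "l \<in> I" for k l
        using that mult[OF _ minv] y by (fastforce simp: I_def X.int_pow_diff)
    qed
    then obtain n :: nat and e0 where e0: "(y [^]\<^bsub>X\<^esub> n, e0) \<in> W"
      and n: "\<And>k. k \<in> I \<Longrightarrow> int n dvd k"
      by (auto simp: I_def int_pow_int)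
    obtain d where d: "d \<in> carrier D" "d [^]\<^bsub>D\<^esub> n = e0"
    \<comment> \<open>For \<open>n = 0\<close> there is no root to take: \<open>e0\<close> is one by
      \<open>functional\<close>, and the default \<open>d = 1\<close> works.\<close>
    proof (cases "n = 0")
      case True
      then show thesis using e0 functional[of e0] that[of "\<one>\<^bsub>D\<^esub>"] by simp
    next
      case False
      then show thesis using assms(1) closed[OF e0] that unfolding divisible_def by blast
    qed
    have "e = d [^]\<^bsub>D\<^esub> k" if k: "(y [^]\<^bsub>X\<^esub> k, e) \<in> W" for k :: int and e
    proof -
      obtain q where q: "k = int n * q" using n k by (auto simp: I_def)
      have "(y [^]\<^bsub>X\<^esub> k, d [^]\<^bsub>D\<^esub> k) \<in> W"
        using ipow[OF e0, of q] y d
        by (simp add: q X.int_pow_pow[symmetric] D.int_pow_pow[symmetric] int_pow_int)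
      then show ?thesis using k unique by metis
    qed
    then show ?thesis using d by blast
  qed
  then show ?thesis using partial_hom_adjoin[OF y] by metis
qed

text \<open>Zorn's lemma; at a maximal graph the domain is everything because \<open>D\<close> is divisible.\<close>

lemma total_extension:
  assumes "divisible D"
  shows "\<exists>\<chi>\<in>hom X D. \<forall>(x, d)\<in>W. \<chi> x = d"
proof -
  define P where "P = {V. partial_hom X D V \<and> W \<subseteq> V}"
  have "\<exists>M\<in>P. \<forall>V\<in>P. M \<subseteq> V \<longrightarrow> V = M"
  proof (rule subset_Zorn_nonempty)
    show "P \<noteq> {}" using partial_hom_axioms by (auto simp: P_def)
    show "\<Union>C \<in> P" if C: "C \<noteq> {}" "subset.chain P C" for C
    proof -
      have CP: "V \<in> C \<Longrightarrow> partial_hom X D V" and WC: "V \<in> C \<Longrightarrow> W \<subseteq> V" for V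
        using C by (auto simp: subset_chain_def P_def)
      have sub: "V \<in> C \<Longrightarrow> subgroup V (X \<times>\<times> D)" for V using CP by (blast dest: partial_hom.W)
      have gr: "group (X \<times>\<times> D)" by (simp add: DirProd_group X.is_group D.is_group)
      have "subgroup (\<Union>C) (X \<times>\<times> D)"
      proof (rule group.subgroupI[OF gr])
        show "\<Union>C \<subseteq> carrier (X \<times>\<times> D)" using subgroup.subset[OF sub] by blast
        show "\<Union>C \<noteq> {}" using C(1) WC one by blast
        show "inv\<^bsub>X \<times>\<times> D\<^esub> a \<in> \<Union>C" if "a \<in> \<Union>C" for a
          using that subgroup.m_inv_closed[OF sub] by blast
        show "a \<otimes>\<^bsub>X \<times>\<times> D\<^esub> b \<in> \<Union>C" if "a \<in> \<Union>C" "b \<in> \<Union>C" for a b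
        proof -
          obtain U V where "U \<in> C" "a \<in> U" "V \<in> C" "b \<in> V" using \<open>a \<in> \<Union>C\<close> \<open>b \<in> \<Union>C\<close> by blast
          moreover from this have "U \<union> V \<in> C"
            using C(2) by (metis subset_chain_def sup.absorb1 sup.absorb2)
          ultimately show ?thesis
            using subgroup.m_closed[OF sub, of "U \<union> V" a b] by auto
        qed
      qed
      moreover have "d = \<one>\<^bsub>D\<^esub>" if "(\<one>\<^bsub>X\<^esub>, d) \<in> \<Union>C" for d
        using that partial_hom.functional[OF CP] by blast
      moreover have "W \<subseteq> \<Union>C" using C(1) WC by blast
      moreover have "(c, \<one>\<^bsub>D\<^esub>) \<in> \<Union>C" if "c \<in> commutators X" for c
        using C(1) WC commutator[OF that] by blast
      ultimately show ?thesis
        unfolding P_def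
        by (intro CollectI conjI partial_hom.intro partial_hom_axioms.intro X.is_group D.comm_group_axioms)
    qed
  qed
  then obtain M where M: "partial_hom X D M" "W \<subseteq> M" and max: "\<And>V. V \<in> P \<Longrightarrow> M \<subseteq> V \<Longrightarrow> V = M"
    by (auto simp: P_def)
  interpret M: partial_hom X D M by fact
  have tot: "\<exists>d. (y, d) \<in> M" if y: "y \<in> carrier X" for y
  proof -
    obtain d where d: "partial_hom X D (M.adjoin y d)" "M \<subseteq> M.adjoin y d" "(y, d) \<in> M.adjoin y d"
      using M.adjoin_exists[OF assms y] by blast
    then have "M.adjoin y d = M" using M(2) by (intro max) (auto simp: P_def)
    then show ?thesis using d by auto
  qed
  define \<chi> where "\<chi> = (\<lambda>y. THE d. (y, d) \<in> M)"
  have \<chi>_eq: "\<chi> y = d" if "(y, d) \<in> M" for y d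
    unfolding \<chi>_def using that M.unique by blast
  have "\<chi> \<in> hom X D"
  proof (rule homI)
    show "\<chi> x \<in> carrier D" if "x \<in> carrier X" for x using tot[OF that] \<chi>_eq M.closed by metis
    show "\<chi> (x \<otimes>\<^bsub>X\<^esub> y) = \<chi> x \<otimes>\<^bsub>D\<^esub> \<chi> y" if "x \<in> carrier X" "y \<in> carrier X" for x y
      using tot[OF that(1)] tot[OF that(2)] \<chi>_eq M.mult by metis
  qed
  then show ?thesis using \<chi>_eq M(2) by blast
qed

end

text \<open>Injectivity of \<open>D\<close>, phrased without forming the abelian quotient of
  \<open>X\<close> by \<open>C\<close>. Since \<open>g\<close> is trivial on the intersection of
  \<open>H\<close> and \<open>C\<close>, it glues with the trivial homomorphism on \<open>C\<close>;
  the graph of the result on the product \<open>H C\<close> is a partial homomorphism, which extends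
  to \<open>X\<close>.\<close>

lemma hom_extension:
  assumes D: "comm_group D" "divisible D" and X: "group X" and H: "subgroup H X"
    and g: "g \<in> hom (X\<lparr>carrier := H\<rparr>) D"
    and C: "C \<lhd> X" and CX: "commutators X \<subseteq> C"
    and gC: "\<And>x. x \<in> H \<Longrightarrow> x \<in> C \<Longrightarrow> g x = \<one>\<^bsub>D\<^esub>"
  shows "\<exists>\<chi>\<in>hom X D. (\<forall>x\<in>H. \<chi> x = g x) \<and> (\<forall>x\<in>C. \<chi> x = \<one>\<^bsub>D\<^esub>)"
proof -
  interpret X: group X by fact
  interpret D: comm_group D by fact
  interpret H: subgroup H X by fact
  interpret C: normal C X by fact
  have gc: "g x \<in> carrier D" if "x \<in> H" for x using g that by (auto simp: hom_def)
  have gm: "g (x \<otimes>\<^bsub>X\<^esub> y) = g x \<otimes>\<^bsub>D\<^esub> g y" if "x \<in> H" "y \<in> H" for x y using g that by (auto simp: hom_def)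
  have g1: "g \<one>\<^bsub>X\<^esub> = \<one>\<^bsub>D\<^esub>" by (rule gC) auto
  have gi: "g (inv\<^bsub>X\<^esub> x) = inv\<^bsub>D\<^esub> g x" if "x \<in> H" for x
    using gm[of "inv\<^bsub>X\<^esub> x" x] that g1 gc
      D.inv_equality[of "g (inv\<^bsub>X\<^esub> x)" "g x"] by simp
  define W where "W = {(x \<otimes>\<^bsub>X\<^esub> c, g x) | x c. x \<in> H \<and> c \<in> C}"
  have memI: "(u, v) \<in> W" if "x \<in> H" "c \<in> C" "u = x \<otimes>\<^bsub>X\<^esub> c" "v = g x" for u v x c
    using that unfolding W_def by blast
  have "subgroup W (X \<times>\<times> D)"
  proof (rule group.subgroupI)
    show "group (X \<times>\<times> D)" by (simp add: DirProd_group X.is_group D.is_group)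
    show "W \<subseteq> carrier (X \<times>\<times> D)" using gc by (auto simp: W_def)
    show "W \<noteq> {}" using memI[OF H.one_closed C.one_closed refl refl] by blast
    show "inv\<^bsub>X \<times>\<times> D\<^esub> a \<in> W" if "a \<in> W" for a
    proof -
      obtain x c where a: "a = (x \<otimes>\<^bsub>X\<^esub> c, g x)" "x \<in> H" "c \<in> C" using \<open>a \<in> W\<close> unfolding W_def by blast
      have "inv\<^bsub>X \<times>\<times> D\<^esub> a = (inv\<^bsub>X\<^esub> x \<otimes>\<^bsub>X\<^esub> (x \<otimes>\<^bsub>X\<^esub> inv\<^bsub>X\<^esub> c \<otimes>\<^bsub>X\<^esub> inv\<^bsub>X\<^esub> x), g (inv\<^bsub>X\<^esub> x))"
        using a gc gi by (simp add: inv_DirProd X.is_group D.is_group X.inv_mult_group X.m_assoc[symmetric])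
      then show ?thesis
        using a C.inv_op_closed2[of x "inv\<^bsub>X\<^esub> c"] memI[of "inv\<^bsub>X\<^esub> x" "x \<otimes>\<^bsub>X\<^esub> inv\<^bsub>X\<^esub> c \<otimes>\<^bsub>X\<^esub> inv\<^bsub>X\<^esub> x"] by simp
    qed
    show "a \<otimes>\<^bsub>X \<times>\<times> D\<^esub> b \<in> W" if ab: "a \<in> W" "b \<in> W" for a b
    proof -
      obtain x c where a: "a = (x \<otimes>\<^bsub>X\<^esub> c, g x)" "x \<in> H" "c \<in> C" using ab by (auto simp: W_def)
      obtain y e where b: "b = (y \<otimes>\<^bsub>X\<^esub> e, g y)" "y \<in> H" "e \<in> C" using ab by (auto simp: W_def)
      have "y \<otimes>\<^bsub>X\<^esub> (inv\<^bsub>X\<^esub> y \<otimes>\<^bsub>X\<^esub> c \<otimes>\<^bsub>X\<^esub> y \<otimes>\<^bsub>X\<^esub> e) = c \<otimes>\<^bsub>X\<^esub> (y \<otimes>\<^bsub>X\<^esub> e)"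
        using a b by (simp add: X.m_assoc[symmetric])
      then have "a \<otimes>\<^bsub>X \<times>\<times> D\<^esub> b = ((x \<otimes>\<^bsub>X\<^esub> y) \<otimes>\<^bsub>X\<^esub> (inv\<^bsub>X\<^esub> y \<otimes>\<^bsub>X\<^esub> c \<otimes>\<^bsub>X\<^esub> y \<otimes>\<^bsub>X\<^esub> e), g (x \<otimes>\<^bsub>X\<^esub> y))"
        using a b gm by (simp add: X.m_assoc)
      moreover have "inv\<^bsub>X\<^esub> y \<otimes>\<^bsub>X\<^esub> c \<otimes>\<^bsub>X\<^esub> y \<otimes>\<^bsub>X\<^esub> e \<in> C" using a b C.inv_op_closed1[of y c] by auto
      ultimately show ?thesis
        using a b memI[of "x \<otimes>\<^bsub>X\<^esub> y" "inv\<^bsub>X\<^esub> y \<otimes>\<^bsub>X\<^esub> c \<otimes>\<^bsub>X\<^esub> y \<otimes>\<^bsub>X\<^esub> e"] by simp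
    qed
  qed
  moreover have "d = \<one>\<^bsub>D\<^esub>" if "(\<one>\<^bsub>X\<^esub>, d) \<in> W" for d
  proof -
    obtain x c where a: "\<one>\<^bsub>X\<^esub> = x \<otimes>\<^bsub>X\<^esub> c" "d = g x" "x \<in> H" "c \<in> C"
      using \<open>(\<one>\<^bsub>X\<^esub>, d) \<in> W\<close> unfolding W_def by blast
    then have "x = inv\<^bsub>X\<^esub> c" using X.inv_equality[of x c] by simp
    then show ?thesis using a gC by auto
  qed
  moreover have CW: "(c, \<one>\<^bsub>D\<^esub>) \<in> W" if "c \<in> C" for c
    using that g1 memI[of "\<one>\<^bsub>X\<^esub>" c] by simp
  ultimately interpret W: partial_hom X D W
    using CX by (intro partial_hom.intro partial_hom_axioms.intro X.is_group D.comm_group_axioms) auto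
  obtain \<chi> where \<chi>: "\<chi> \<in> hom X D" "\<forall>(x, d)\<in>W. \<chi> x = d" using W.total_extension D(2) by blast
  have \<chi>_eq: "\<chi> x = d" if "(x, d) \<in> W" for x d using bspec[OF \<chi>(2) that] by simp
  have "(x, g x) \<in> W" if "x \<in> H" for x using that memI[of x "\<one>\<^bsub>X\<^esub>"] by simp
  then show ?thesis using CW \<chi>_eq by (intro bexI[OF _ \<chi>(1)]) simp
qed

text \<open>The cogenerator property. If \<open>n\<close> generates the exponents of the powers of
  \<open>x\<close> lying in \<open>C\<close>, then \<open>x\<close> may be sent to any
  \<open>d\<close> with \<open>d^n = 1\<close>, and \<open>tors\<close> offers a nontrivial one
  because \<open>n = 1\<close> would put \<open>x\<close> into \<open>C\<close>. The case
  \<open>n = 0\<close>, infinite order modulo \<open>C\<close>, is why \<open>tors\<close> also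
  speaks of 0.\<close>

lemma hom_separation:
  assumes D: "comm_group D" "divisible D" and tors: "\<And>n::nat. n \<noteq> 1 \<Longrightarrow> \<exists>d\<in>carrier D. d \<noteq> \<one>\<^bsub>D\<^esub> \<and> d [^]\<^bsub>D\<^esub> n = \<one>\<^bsub>D\<^esub>"
    and X: "group X" and C: "C \<lhd> X" and CX: "commutators X \<subseteq> C"
    and x: "x \<in> carrier X" "x \<notin> C"
  shows "\<exists>\<chi>\<in>hom X D. (\<forall>c\<in>C. \<chi> c = \<one>\<^bsub>D\<^esub>) \<and> \<chi> x \<noteq> \<one>\<^bsub>D\<^esub>"
proof -
  interpret X: group X by fact
  interpret D: comm_group D by fact
  interpret C: normal C X by fact
  define W where "W = C \<times> {\<one>\<^bsub>D\<^esub>}"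
  have "subgroup W (X \<times>\<times> D)"
    unfolding W_def by (rule DirProd_subgroups) (auto simp: X.is_group D.is_group C.subgroup_axioms D.triv_subgroup)
  then interpret W: partial_hom X D W
    using CX
    by (intro partial_hom.intro partial_hom_axioms.intro X.is_group D.comm_group_axioms)
      (auto simp: W_def)
  have "\<exists>n::nat. int n \<in> {k. x [^]\<^bsub>X\<^esub> k \<in> C} \<and> (\<forall>k\<in>{k. x [^]\<^bsub>X\<^esub> k \<in> C}. int n dvd k)"
    by (rule int_subgroup_generator) (use x in \<open>auto simp: X.int_pow_diff\<close>)
  then obtain n :: nat where n: "x [^]\<^bsub>X\<^esub> n \<in> C"
    and dvd: "\<And>k::int. x [^]\<^bsub>X\<^esub> k \<in> C \<Longrightarrow> int n dvd k"
    by (auto simp: int_pow_int)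
  have "n \<noteq> 1" using n x by auto
  then obtain d where d: "d \<in> carrier D" "d \<noteq> \<one>\<^bsub>D\<^esub>" "d [^]\<^bsub>D\<^esub> n = \<one>\<^bsub>D\<^esub>" using tors by blast
  have compat: "e = d [^]\<^bsub>D\<^esub> k" if "(x [^]\<^bsub>X\<^esub> k, e) \<in> W" for k :: int and e
  proof -
    have "e = \<one>\<^bsub>D\<^esub>" "int n dvd k" using that dvd by (auto simp: W_def)
    then show ?thesis using d by (auto simp: dvd_def D.int_pow_pow[symmetric] int_pow_int)
  qed
  note adj = W.partial_hom_adjoin[OF x(1) d(1) compat]
  obtain \<chi> where \<chi>: "\<chi> \<in> hom X D" "\<forall>(y, e)\<in>W.adjoin x d. \<chi> y = e"
    using partial_hom.total_extension[OF adj(1) D(2)] by blast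
  have \<chi>_eq: "\<chi> y = e" if "(y, e) \<in> W.adjoin x d" for y e using bspec[OF \<chi>(2) that] by simp
  have "\<chi> c = \<one>\<^bsub>D\<^esub>" if "c \<in> C" for c
    using that adj(2) by (intro \<chi>_eq) (auto simp: W_def)
  then show ?thesis using \<chi>_eq[OF adj(3)] d(2) by (intro bexI[OF _ \<chi>(1)]) simp
qed

subsection \<open>Second cohomology\<close>

lemma cocycles2_closed:
  "f \<in> carrier (cocycles2 G A) \<Longrightarrow> x \<in> carrier G \<Longrightarrow> y \<in> carrier G \<Longrightarrow> f (x, y) \<in> carrier A"
  by (auto simp: cocycles2_def PiE_def Pi_def)

lemma cocycles2_eq:
  "f \<in> carrier (cocycles2 G A) \<Longrightarrow> x \<in> carrier G \<Longrightarrow> y \<in> carrier G \<Longrightarrow> z \<in> carrier G \<Longrightarrow>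
    f (x, y) \<otimes>\<^bsub>A\<^esub> f (x \<otimes>\<^bsub>G\<^esub> y, z) = f (y, z) \<otimes>\<^bsub>A\<^esub> f (x, y \<otimes>\<^bsub>G\<^esub> z)"
  by (simp add: cocycles2_def)

lemma cocycles2_extensional:
  "f \<in> carrier (cocycles2 G A) \<Longrightarrow> f \<in> extensional (carrier G \<times> carrier G)"
  by (auto simp: cocycles2_def PiE_def)

lemma cocycles2_ext:
  assumes "f \<in> extensional (carrier G \<times> carrier G)" "g \<in> extensional (carrier G \<times> carrier G)"
    and "\<And>x y. x \<in> carrier G \<Longrightarrow> y \<in> carrier G \<Longrightarrow> f (x, y) = g (x, y)"
  shows "f = g"
  using assms by (intro extensionalityI) auto

lemma cocycles2I:
  assumes "f \<in> extensional (carrier G \<times> carrier G)"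
    and "\<And>x y. x \<in> carrier G \<Longrightarrow> y \<in> carrier G \<Longrightarrow> f (x, y) \<in> carrier A"
    and "\<And>x y z. x \<in> carrier G \<Longrightarrow> y \<in> carrier G \<Longrightarrow> z \<in> carrier G \<Longrightarrow>
      f (x, y) \<otimes>\<^bsub>A\<^esub> f (x \<otimes>\<^bsub>G\<^esub> y, z) = f (y, z) \<otimes>\<^bsub>A\<^esub> f (x, y \<otimes>\<^bsub>G\<^esub> z)"
  shows "f \<in> carrier (cocycles2 G A)"
  using assms by (auto simp: cocycles2_def PiE_def)

lemma cocycles2_mult:
  "f \<otimes>\<^bsub>cocycles2 G A\<^esub> g = (\<lambda>p\<in>carrier G \<times> carrier G. f p \<otimes>\<^bsub>A\<^esub> g p)"
  by (simp add: cocycles2_def)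

lemma cocycles2_one: "\<one>\<^bsub>cocycles2 G A\<^esub> = (\<lambda>p\<in>carrier G \<times> carrier G. \<one>\<^bsub>A\<^esub>)"
  by (simp add: cocycles2_def)

locale cohomology2 = G: group G + A: comm_group A
  for G :: "('g, 'u) monoid_scheme" and A :: "('c, 'v) monoid_scheme"
begin

lemma cocycles2_comm_group: "comm_group (cocycles2 G A)"
proof (rule comm_groupI)
  fix f g assume fg: "f \<in> carrier (cocycles2 G A)" "g \<in> carrier (cocycles2 G A)"
  show "f \<otimes>\<^bsub>cocycles2 G A\<^esub> g \<in> carrier (cocycles2 G A)"
  proof (rule cocycles2I)
    fix x y z assume xyz: "x \<in> carrier G" "y \<in> carrier G" "z \<in> carrier G"
    have "f (x, y) \<otimes>\<^bsub>A\<^esub> g (x, y) \<otimes>\<^bsub>A\<^esub> (f (x \<otimes>\<^bsub>G\<^esub> y, z) \<otimes>\<^bsub>A\<^esub> g (x \<otimes>\<^bsub>G\<^esub> y, z)) =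
        f (x, y) \<otimes>\<^bsub>A\<^esub> f (x \<otimes>\<^bsub>G\<^esub> y, z) \<otimes>\<^bsub>A\<^esub> (g (x, y) \<otimes>\<^bsub>A\<^esub> g (x \<otimes>\<^bsub>G\<^esub> y, z))"
      using fg xyz by (simp add: cocycles2_closed A.m_ac)
    also have "\<dots> = f (y, z) \<otimes>\<^bsub>A\<^esub> f (x, y \<otimes>\<^bsub>G\<^esub> z) \<otimes>\<^bsub>A\<^esub> (g (y, z) \<otimes>\<^bsub>A\<^esub> g (x, y \<otimes>\<^bsub>G\<^esub> z))"
      using fg xyz by (simp add: cocycles2_eq)
    also have "\<dots> = f (y, z) \<otimes>\<^bsub>A\<^esub> g (y, z) \<otimes>\<^bsub>A\<^esub> (f (x, y \<otimes>\<^bsub>G\<^esub> z) \<otimes>\<^bsub>A\<^esub> g (x, y \<otimes>\<^bsub>G\<^esub> z))"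
      using fg xyz by (simp add: cocycles2_closed A.m_ac)
    finally show "(f \<otimes>\<^bsub>cocycles2 G A\<^esub> g) (x, y) \<otimes>\<^bsub>A\<^esub> (f \<otimes>\<^bsub>cocycles2 G A\<^esub> g) (x \<otimes>\<^bsub>G\<^esub> y, z) =
        (f \<otimes>\<^bsub>cocycles2 G A\<^esub> g) (y, z) \<otimes>\<^bsub>A\<^esub> (f \<otimes>\<^bsub>cocycles2 G A\<^esub> g) (x, y \<otimes>\<^bsub>G\<^esub> z)"
      using xyz by (simp add: cocycles2_mult)
  qed (use fg in \<open>auto simp: cocycles2_mult cocycles2_closed\<close>)
next
  show "\<one>\<^bsub>cocycles2 G A\<^esub> \<in> carrier (cocycles2 G A)"
    by (rule cocycles2I) (auto simp: cocycles2_one)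
next
  fix f g k assume "f \<in> carrier (cocycles2 G A)" "g \<in> carrier (cocycles2 G A)" "k \<in> carrier (cocycles2 G A)"
  then show "f \<otimes>\<^bsub>cocycles2 G A\<^esub> g \<otimes>\<^bsub>cocycles2 G A\<^esub> k = f \<otimes>\<^bsub>cocycles2 G A\<^esub> (g \<otimes>\<^bsub>cocycles2 G A\<^esub> k)"
    by (intro cocycles2_ext[where G = G]) (auto simp: cocycles2_mult cocycles2_closed A.m_assoc)
next
  fix f g assume "f \<in> carrier (cocycles2 G A)" "g \<in> carrier (cocycles2 G A)"
  then show "f \<otimes>\<^bsub>cocycles2 G A\<^esub> g = g \<otimes>\<^bsub>cocycles2 G A\<^esub> f"
    by (intro cocycles2_ext[where G = G]) (auto simp: cocycles2_mult cocycles2_closed A.m_comm)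
next
  fix f assume "f \<in> carrier (cocycles2 G A)"
  then show "\<one>\<^bsub>cocycles2 G A\<^esub> \<otimes>\<^bsub>cocycles2 G A\<^esub> f = f"
    by (intro cocycles2_ext[where G = G])
      (auto simp: cocycles2_mult cocycles2_one cocycles2_closed cocycles2_extensional)
next
  fix f assume f: "f \<in> carrier (cocycles2 G A)"
  define g where "g = (\<lambda>p\<in>carrier G \<times> carrier G. inv\<^bsub>A\<^esub> f p)"
  have "g \<in> carrier (cocycles2 G A)"
  proof (rule cocycles2I)
    fix x y z assume "x \<in> carrier G" "y \<in> carrier G" "z \<in> carrier G"
    then show "g (x, y) \<otimes>\<^bsub>A\<^esub> g (x \<otimes>\<^bsub>G\<^esub> y, z) = g (y, z) \<otimes>\<^bsub>A\<^esub> g (x, y \<otimes>\<^bsub>G\<^esub> z)"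
      using f by (simp add: g_def cocycles2_closed A.inv_mult[symmetric] cocycles2_eq)
  qed (use f in \<open>auto simp: g_def cocycles2_closed\<close>)
  moreover have "g \<otimes>\<^bsub>cocycles2 G A\<^esub> f = \<one>\<^bsub>cocycles2 G A\<^esub>"
    using f by (intro cocycles2_ext[where G = G]) (auto simp: g_def cocycles2_mult cocycles2_one cocycles2_closed)
  ultimately show "\<exists>g\<in>carrier (cocycles2 G A). g \<otimes>\<^bsub>cocycles2 G A\<^esub> f = \<one>\<^bsub>cocycles2 G A\<^esub>" by blast
qed

sublocale Z: comm_group "cocycles2 G A" by (rule cocycles2_comm_group)

lemma cocycles2_inv:
  assumes f: "f \<in> carrier (cocycles2 G A)" and "x \<in> carrier G" "y \<in> carrier G"
  shows "(inv\<^bsub>cocycles2 G A\<^esub> f) (x, y) = inv\<^bsub>A\<^esub> f (x, y)"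
proof -
  let ?g = "inv\<^bsub>cocycles2 G A\<^esub> f"
  have "(?g \<otimes>\<^bsub>cocycles2 G A\<^esub> f) (x, y) = \<one>\<^bsub>A\<^esub>" using assms by (simp add: Z.l_inv) (simp add: cocycles2_one)
  then have "?g (x, y) \<otimes>\<^bsub>A\<^esub> f (x, y) = \<one>\<^bsub>A\<^esub>" using assms by (simp add: cocycles2_mult)
  then show ?thesis
    using assms cocycles2_closed[OF f] cocycles2_closed[OF Z.inv_closed[OF f]] A.inv_equality by metis
qed

lemma coboundary2_cocycle:
  assumes h: "h \<in> carrier G \<rightarrow> carrier A"
  shows "coboundary2 G A h \<in> carrier (cocycles2 G A)"
proof (rule cocycles2I)
  have c: "h x \<in> carrier A" if "x \<in> carrier G" for x using h that by auto
  fix x y z assume xyz: "x \<in> carrier G" "y \<in> carrier G" "z \<in> carrier G"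
  have "h x \<otimes>\<^bsub>A\<^esub> h y \<otimes>\<^bsub>A\<^esub> inv\<^bsub>A\<^esub> h (x \<otimes>\<^bsub>G\<^esub> y) \<otimes>\<^bsub>A\<^esub> (h (x \<otimes>\<^bsub>G\<^esub> y) \<otimes>\<^bsub>A\<^esub> h z \<otimes>\<^bsub>A\<^esub> inv\<^bsub>A\<^esub> h (x \<otimes>\<^bsub>G\<^esub> y \<otimes>\<^bsub>G\<^esub> z))
      = (inv\<^bsub>A\<^esub> h (x \<otimes>\<^bsub>G\<^esub> y) \<otimes>\<^bsub>A\<^esub> h (x \<otimes>\<^bsub>G\<^esub> y)) \<otimes>\<^bsub>A\<^esub> (h x \<otimes>\<^bsub>A\<^esub> h y \<otimes>\<^bsub>A\<^esub> h z \<otimes>\<^bsub>A\<^esub> inv\<^bsub>A\<^esub> h (x \<otimes>\<^bsub>G\<^esub> y \<otimes>\<^bsub>G\<^esub> z))"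
    using xyz c by (simp only: A.m_ac A.inv_closed A.m_closed G.m_closed)
  \<comment> \<open>The cancelling pair at \<open>x y\<close> is exchanged for the one at
    \<open>y z\<close>, both being one; the other factors agree by associativity in
    \<open>G\<close>.\<close>
  also have "\<dots> = (inv\<^bsub>A\<^esub> h (y \<otimes>\<^bsub>G\<^esub> z) \<otimes>\<^bsub>A\<^esub> h (y \<otimes>\<^bsub>G\<^esub> z)) \<otimes>\<^bsub>A\<^esub> (h x \<otimes>\<^bsub>A\<^esub> h y \<otimes>\<^bsub>A\<^esub> h z \<otimes>\<^bsub>A\<^esub> inv\<^bsub>A\<^esub> h (x \<otimes>\<^bsub>G\<^esub> (y \<otimes>\<^bsub>G\<^esub> z)))"
    using xyz c by (simp add: G.m_assoc)
  also have "\<dots> = h y \<otimes>\<^bsub>A\<^esub> h z \<otimes>\<^bsub>A\<^esub> inv\<^bsub>A\<^esub> h (y \<otimes>\<^bsub>G\<^esub> z) \<otimes>\<^bsub>A\<^esub> (h x \<otimes>\<^bsub>A\<^esub> h (y \<otimes>\<^bsub>G\<^esub> z) \<otimes>\<^bsub>A\<^esub> inv\<^bsub>A\<^esub> h (x \<otimes>\<^bsub>G\<^esub> (y \<otimes>\<^bsub>G\<^esub> z)))"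
    using xyz c by (simp only: A.m_ac A.inv_closed A.m_closed G.m_closed)
  finally show "coboundary2 G A h (x, y) \<otimes>\<^bsub>A\<^esub> coboundary2 G A h (x \<otimes>\<^bsub>G\<^esub> y, z) =
      coboundary2 G A h (y, z) \<otimes>\<^bsub>A\<^esub> coboundary2 G A h (x, y \<otimes>\<^bsub>G\<^esub> z)"
    using xyz by (simp add: coboundary2_def)
qed (use h in \<open>auto simp: coboundary2_def\<close>)

text \<open>Clearing the inverse gives the coboundary condition the shape of the lifting equation
  used below for functions on \<open>F\<close>, so the two can be compared directly.\<close>

lemma coboundaries2_iff:
  assumes f: "f \<in> carrier (cocycles2 G A)"
  shows "f \<in> coboundaries2 G A \<longleftrightarrow> (\<exists>h\<in>carrier G \<rightarrow> carrier A. \<forall>x\<in>carrier G. \<forall>y\<in>carrier G.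
    h x \<otimes>\<^bsub>A\<^esub> h y = f (x, y) \<otimes>\<^bsub>A\<^esub> h (x \<otimes>\<^bsub>G\<^esub> y))"
proof -
  have "f = coboundary2 G A h \<longleftrightarrow> (\<forall>x\<in>carrier G. \<forall>y\<in>carrier G. h x \<otimes>\<^bsub>A\<^esub> h y = f (x, y) \<otimes>\<^bsub>A\<^esub> h (x \<otimes>\<^bsub>G\<^esub> y))"
    if h: "h \<in> carrier G \<rightarrow> carrier A" for h
  proof -
    have c: "h x \<in> carrier A" if "x \<in> carrier G" for x using h that by auto
    have "f = coboundary2 G A h \<longleftrightarrow> (\<forall>x\<in>carrier G. \<forall>y\<in>carrier G. f (x, y) = coboundary2 G A h (x, y))"
      using cocycles2_ext[OF cocycles2_extensional[OF f] cocycles2_extensional[OF coboundary2_cocycle[OF h]]]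
      by auto
    moreover have "f (x, y) = coboundary2 G A h (x, y) \<longleftrightarrow> h x \<otimes>\<^bsub>A\<^esub> h y = f (x, y) \<otimes>\<^bsub>A\<^esub> h (x \<otimes>\<^bsub>G\<^esub> y)"
      if "x \<in> carrier G" "y \<in> carrier G" for x y
      using that c cocycles2_closed[OF f that] A.inv_solve_right'[of "f (x, y)" "h x \<otimes>\<^bsub>A\<^esub> h y" "h (x \<otimes>\<^bsub>G\<^esub> y)"]
      by (auto simp: coboundary2_def A.inv_solve_right)
    ultimately show ?thesis by blast
  qed
  then show ?thesis by (auto simp: coboundaries2_def)
qed

lemma coboundaries2_subgroup: "subgroup (coboundaries2 G A) (cocycles2 G A)"
proof (rule Z.subgroupI)
  show sub: "coboundaries2 G A \<subseteq> carrier (cocycles2 G A)"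
    using coboundary2_cocycle by (auto simp: coboundaries2_def)
  have "(\<lambda>_. \<one>\<^bsub>A\<^esub>) \<in> carrier G \<rightarrow> carrier A" by simp
  then show "coboundaries2 G A \<noteq> {}" unfolding coboundaries2_def by blast
  fix f assume f: "f \<in> coboundaries2 G A"
  then have fc: "f \<in> carrier (cocycles2 G A)" using sub by blast
  obtain h where h: "h \<in> carrier G \<rightarrow> carrier A" and
    hf: "\<And>x y. x \<in> carrier G \<Longrightarrow> y \<in> carrier G \<Longrightarrow> h x \<otimes>\<^bsub>A\<^esub> h y = f (x, y) \<otimes>\<^bsub>A\<^esub> h (x \<otimes>\<^bsub>G\<^esub> y)"
    using f coboundaries2_iff[OF fc] by blast
  have hc: "h x \<in> carrier A" if "x \<in> carrier G" for x using h that by auto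
  have "inv\<^bsub>A\<^esub> h x \<otimes>\<^bsub>A\<^esub> inv\<^bsub>A\<^esub> h y = (inv\<^bsub>cocycles2 G A\<^esub> f) (x, y) \<otimes>\<^bsub>A\<^esub> inv\<^bsub>A\<^esub> h (x \<otimes>\<^bsub>G\<^esub> y)"
    if "x \<in> carrier G" "y \<in> carrier G" for x y
    using that hf[OF that] hc cocycles2_closed[OF fc that]
    by (simp add: cocycles2_inv[OF fc] A.inv_mult[symmetric])
  then show "inv\<^bsub>cocycles2 G A\<^esub> f \<in> coboundaries2 G A"
    unfolding coboundaries2_iff[OF Z.inv_closed[OF fc]] using hc by (intro bexI[of _ "\<lambda>x. inv\<^bsub>A\<^esub> h x"]) auto
  fix g assume g: "g \<in> coboundaries2 G A"
  then have gc: "g \<in> carrier (cocycles2 G A)" using sub by blast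
  obtain k where k: "k \<in> carrier G \<rightarrow> carrier A" and
    kg: "\<And>x y. x \<in> carrier G \<Longrightarrow> y \<in> carrier G \<Longrightarrow> k x \<otimes>\<^bsub>A\<^esub> k y = g (x, y) \<otimes>\<^bsub>A\<^esub> k (x \<otimes>\<^bsub>G\<^esub> y)"
    using g coboundaries2_iff[OF gc] by blast
  have kc: "k x \<in> carrier A" if "x \<in> carrier G" for x using k that by auto
  have "h x \<otimes>\<^bsub>A\<^esub> k x \<otimes>\<^bsub>A\<^esub> (h y \<otimes>\<^bsub>A\<^esub> k y) = f (x, y) \<otimes>\<^bsub>A\<^esub> g (x, y) \<otimes>\<^bsub>A\<^esub> (h (x \<otimes>\<^bsub>G\<^esub> y) \<otimes>\<^bsub>A\<^esub> k (x \<otimes>\<^bsub>G\<^esub> y))"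
    if xy: "x \<in> carrier G" "y \<in> carrier G" for x y
  proof -
    note cl = xy hc kc cocycles2_closed[OF fc xy] cocycles2_closed[OF gc xy]
    have "h x \<otimes>\<^bsub>A\<^esub> k x \<otimes>\<^bsub>A\<^esub> (h y \<otimes>\<^bsub>A\<^esub> k y) = h x \<otimes>\<^bsub>A\<^esub> h y \<otimes>\<^bsub>A\<^esub> (k x \<otimes>\<^bsub>A\<^esub> k y)"
      using cl by (simp add: A.m_ac)
    also have "\<dots> = f (x, y) \<otimes>\<^bsub>A\<^esub> h (x \<otimes>\<^bsub>G\<^esub> y) \<otimes>\<^bsub>A\<^esub> (g (x, y) \<otimes>\<^bsub>A\<^esub> k (x \<otimes>\<^bsub>G\<^esub> y))"
      using xy by (simp add: hf kg)
    also have "\<dots> = f (x, y) \<otimes>\<^bsub>A\<^esub> g (x, y) \<otimes>\<^bsub>A\<^esub> (h (x \<otimes>\<^bsub>G\<^esub> y) \<otimes>\<^bsub>A\<^esub> k (x \<otimes>\<^bsub>G\<^esub> y))"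
      using cl by (simp add: A.m_ac)
    finally show ?thesis .
  qed
  then show "f \<otimes>\<^bsub>cocycles2 G A\<^esub> g \<in> coboundaries2 G A"
    unfolding coboundaries2_iff[OF Z.m_closed[OF fc gc]] using hc kc
    by (intro bexI[of _ "\<lambda>x. h x \<otimes>\<^bsub>A\<^esub> k x"]) (auto simp: cocycles2_mult)
qed

sublocale B: normal "coboundaries2 G A" "cocycles2 G A"
  by (rule Z.subgroup_imp_normal[OF coboundaries2_subgroup])

definition class2 :: "('g \<times> 'g \<Rightarrow> 'c) \<Rightarrow> ('g \<times> 'g \<Rightarrow> 'c) set" where
  "class2 f = coboundaries2 G A #>\<^bsub>cocycles2 G A\<^esub> f"

lemma H2_comm_group: "comm_group (H2 G A)"
  unfolding H2_def by (rule Z.abelian_FactGroup[OF coboundaries2_subgroup])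

lemma H2_carrier: "carrier (H2 G A) = class2 ` carrier (cocycles2 G A)"
  by (auto simp: H2_def FactGroup_def RCOSETS_def class2_def)

lemma H2_mult:
  assumes "f \<in> carrier (cocycles2 G A)" "g \<in> carrier (cocycles2 G A)"
  shows "class2 f \<otimes>\<^bsub>H2 G A\<^esub> class2 g = class2 (f \<otimes>\<^bsub>cocycles2 G A\<^esub> g)"
  using assms by (simp add: H2_def FactGroup_def class2_def B.rcos_sum)

lemma H2_one: "\<one>\<^bsub>H2 G A\<^esub> = coboundaries2 G A"
  by (simp add: H2_def FactGroup_def)

lemma class2_eq_one_iff:
  assumes "f \<in> carrier (cocycles2 G A)"
  shows "class2 f = \<one>\<^bsub>H2 G A\<^esub> \<longleftrightarrow> f \<in> coboundaries2 G A"
  using assms coboundaries2_subgroup unfolding H2_one class2_def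
  by (metis Z.coset_join1 Z.coset_join2)

lemma class2_eq_iff:
  assumes "f \<in> carrier (cocycles2 G A)" "g \<in> carrier (cocycles2 G A)"
  shows "class2 f = class2 g \<longleftrightarrow> f \<otimes>\<^bsub>cocycles2 G A\<^esub> inv\<^bsub>cocycles2 G A\<^esub> g \<in> coboundaries2 G A"
proof -
  interpret H: comm_group "H2 G A" by (rule H2_comm_group)
  let ?d = "f \<otimes>\<^bsub>cocycles2 G A\<^esub> inv\<^bsub>cocycles2 G A\<^esub> g"
  have d: "?d \<in> carrier (cocycles2 G A)" using assms by simp
  have gc: "class2 g \<in> carrier (H2 G A)" using assms by (simp add: H2_carrier)
  have "class2 f = class2 (?d \<otimes>\<^bsub>cocycles2 G A\<^esub> g)" using assms by (simp add: Z.m_assoc)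
  also have "\<dots> = class2 ?d \<otimes>\<^bsub>H2 G A\<^esub> class2 g" using H2_mult[OF d assms(2)] by simp
  finally have "class2 f = class2 ?d \<otimes>\<^bsub>H2 G A\<^esub> class2 g" .
  moreover have "class2 ?d \<in> carrier (H2 G A)" using d by (simp add: H2_carrier)
  ultimately have "class2 f = class2 g \<longleftrightarrow> class2 ?d = \<one>\<^bsub>H2 G A\<^esub>" using gc by simp
  then show ?thesis using class2_eq_one_iff[OF d] by simp
qed

end

section \<open>Functoriality of second cohomology\<close>

lemma pullback2_cocycle:
  assumes "cohomology2 G A" "cohomology2 H A" and \<phi>: "\<phi> \<in> hom H G" and f: "f \<in> carrier (cocycles2 G A)"
  shows "pullback2 H \<phi> f \<in> carrier (cocycles2 H A)"
proof (rule cocycles2I)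
  interpret H: cohomology2 H A by fact
  have c: "x \<in> carrier H \<Longrightarrow> \<phi> x \<in> carrier G" and
    m: "x \<in> carrier H \<Longrightarrow> y \<in> carrier H \<Longrightarrow> \<phi> (x \<otimes>\<^bsub>H\<^esub> y) = \<phi> x \<otimes>\<^bsub>G\<^esub> \<phi> y" for x y
    using \<phi> by (auto simp: hom_def)
  show "pullback2 H \<phi> f \<in> extensional (carrier H \<times> carrier H)" by (simp add: pullback2_def)
  show "pullback2 H \<phi> f (x, y) \<in> carrier A" if "x \<in> carrier H" "y \<in> carrier H" for x y
    using that c cocycles2_closed[OF f] by (simp add: pullback2_def)
  show "pullback2 H \<phi> f (x, y) \<otimes>\<^bsub>A\<^esub> pullback2 H \<phi> f (x \<otimes>\<^bsub>H\<^esub> y, z) =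
      pullback2 H \<phi> f (y, z) \<otimes>\<^bsub>A\<^esub> pullback2 H \<phi> f (x, y \<otimes>\<^bsub>H\<^esub> z)"
    if "x \<in> carrier H" "y \<in> carrier H" "z \<in> carrier H" for x y z
    using that c m cocycles2_eq[OF f] by (simp add: pullback2_def)
qed

lemma pullback2_mult:
  assumes "\<phi> \<in> hom H G"
  shows "pullback2 H \<phi> (f \<otimes>\<^bsub>cocycles2 G A\<^esub> g) = pullback2 H \<phi> f \<otimes>\<^bsub>cocycles2 H A\<^esub> pullback2 H \<phi> g"
  using assms by (auto simp: pullback2_def cocycles2_mult hom_def fun_eq_iff)

lemma pullback2_coboundary:
  assumes "cohomology2 G A" "cohomology2 H A" and \<phi>: "\<phi> \<in> hom H G" and f: "f \<in> coboundaries2 G A"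
  shows "pullback2 H \<phi> f \<in> coboundaries2 H A"
proof -
  interpret H: cohomology2 H A by fact
  have c: "x \<in> carrier H \<Longrightarrow> \<phi> x \<in> carrier G" and
    m: "x \<in> carrier H \<Longrightarrow> y \<in> carrier H \<Longrightarrow> \<phi> (x \<otimes>\<^bsub>H\<^esub> y) = \<phi> x \<otimes>\<^bsub>G\<^esub> \<phi> y" for x y
    using \<phi> by (auto simp: hom_def)
  obtain h where h: "h \<in> carrier G \<rightarrow> carrier A" "f = coboundary2 G A h" using f by (auto simp: coboundaries2_def)
  then have "pullback2 H \<phi> f = coboundary2 H A (h \<circ> \<phi>)"
    using c m by (auto simp: pullback2_def coboundary2_def fun_eq_iff)
  moreover have "h \<circ> \<phi> \<in> carrier H \<rightarrow> carrier A" using h c by auto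
  ultimately show ?thesis by (simp add: coboundaries2_def)
qed

text \<open>Pullback sends coboundaries to coboundaries, so all representatives yield one class and
  \<open>the_elem\<close> is applied to a singleton.\<close>

lemma H2_map_class2:
  assumes "cohomology2 G A" "cohomology2 H A" and \<phi>: "\<phi> \<in> hom H G" and f: "f \<in> carrier (cocycles2 G A)"
  shows "H2_map H A \<phi> (cohomology2.class2 G A f) = cohomology2.class2 H A (pullback2 H \<phi> f)"
proof -
  interpret G: cohomology2 G A by fact
  interpret H: cohomology2 H A by fact
  have "H.class2 (pullback2 H \<phi> g) = H.class2 (pullback2 H \<phi> f)" if "g \<in> G.class2 f" for g
  proof -
    obtain b where b: "b \<in> coboundaries2 G A" "g = b \<otimes>\<^bsub>cocycles2 G A\<^esub> f"
      using \<open>g \<in> G.class2 f\<close> unfolding G.class2_def r_coset_def by blast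
    have pb: "pullback2 H \<phi> b \<in> coboundaries2 H A" by (rule pullback2_coboundary[OF assms(1-3) b(1)])
    have pf: "pullback2 H \<phi> f \<in> carrier (cocycles2 H A)" by (rule pullback2_cocycle[OF assms])
    have "H.class2 (pullback2 H \<phi> g) = H.class2 (pullback2 H \<phi> b \<otimes>\<^bsub>cocycles2 H A\<^esub> pullback2 H \<phi> f)"
      using b pullback2_mult[OF \<phi>] by metis
    also have "\<dots> = H.class2 (pullback2 H \<phi> f)"
      using pb pf by (simp add: H.class2_def H.Z.coset_mult_assoc[symmetric] H.B.subset H.B.mem_carrier
          H.Z.coset_join2 H.coboundaries2_subgroup)
    finally show ?thesis .
  qed
  moreover have "f \<in> G.class2 f" unfolding G.class2_def by (rule G.Z.rcos_self[OF f G.coboundaries2_subgroup])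
  ultimately have "(\<lambda>g. H.class2 (pullback2 H \<phi> g)) ` G.class2 f = {H.class2 (pullback2 H \<phi> f)}" by blast
  then show ?thesis by (simp add: H2_map_def H.class2_def)
qed

subsection \<open>Lifts of cocycles\<close>

lemma (in group) commutator_eq:
  assumes "x \<in> carrier G" "y \<in> carrier G"
  shows "x \<otimes> y = y \<otimes> x \<otimes> (inv x \<otimes> inv y \<otimes> x \<otimes> y)"
  using assms by (simp add: m_assoc[symmetric]) (simp add: m_assoc)

lemma (in group) commutators_closed: "commutators G \<subseteq> carrier G"
  by (auto simp: commutators_def)

lemma (in group) derived_eq_generate_commutators:
  "derived G (carrier G) = generate G (commutators G)"
proof -
  have "commutators G = derived_set G (carrier G)"
  proof
    show "commutators G \<subseteq> derived_set G (carrier G)"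
    proof
      fix c assume "c \<in> commutators G"
      then obtain x y where "x \<in> carrier G" "y \<in> carrier G" "c = inv x \<otimes> inv y \<otimes> x \<otimes> y"
        unfolding commutators_def by blast
      then have "inv x \<in> carrier G" "inv y \<in> carrier G" "c = inv x \<otimes> inv y \<otimes> inv (inv x) \<otimes> inv (inv y)" by auto
      then show "c \<in> derived_set G (carrier G)" by blast
    qed
    show "derived_set G (carrier G) \<subseteq> commutators G"
    proof
      fix c assume "c \<in> derived_set G (carrier G)"
      then obtain x y where "x \<in> carrier G" "y \<in> carrier G" "c = x \<otimes> y \<otimes> inv x \<otimes> inv y" by blast
      then have "inv x \<in> carrier G" "inv y \<in> carrier G" "c = inv (inv x) \<otimes> inv (inv y) \<otimes> inv x \<otimes> inv y" by auto
      then show "c \<in> commutators G" unfolding commutators_def by blast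
    qed
  qed
  then show ?thesis by (simp add: derived_def)
qed

lemma (in group) commutators_subset_derived: "commutators G \<subseteq> derived G (carrier G)"
  unfolding derived_eq_generate_commutators by (auto intro: generate.incl)

lemma hom_trivial_on_derived:
  assumes "group G" "comm_group D" "\<chi> \<in> hom G D" "x \<in> derived G (carrier G)"
  shows "\<chi> x = \<one>\<^bsub>D\<^esub>"
proof -
  interpret D: comm_group D by fact
  interpret G: group G by fact
  interpret \<chi>: group_hom G D \<chi> using assms by (simp add: group_hom_def group_hom_axioms_def D.is_group)
  have c: "\<chi> x \<in> carrier D" if "x \<in> carrier G" for x using that by simp
  have "commutators G \<subseteq> kernel G D \<chi>"
  proof
    fix c assume "c \<in> commutators G"
    then obtain x y where xy: "x \<in> carrier G" "y \<in> carrier G" "c = inv\<^bsub>G\<^esub> x \<otimes>\<^bsub>G\<^esub> inv\<^bsub>G\<^esub> y \<otimes>\<^bsub>G\<^esub> x \<otimes>\<^bsub>G\<^esub> y"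
      unfolding commutators_def by blast
    then have "\<chi> c = inv\<^bsub>D\<^esub> \<chi> x \<otimes>\<^bsub>D\<^esub> inv\<^bsub>D\<^esub> \<chi> y \<otimes>\<^bsub>D\<^esub> \<chi> x \<otimes>\<^bsub>D\<^esub> \<chi> y" by simp
    also have "\<dots> = (inv\<^bsub>D\<^esub> \<chi> x \<otimes>\<^bsub>D\<^esub> \<chi> x) \<otimes>\<^bsub>D\<^esub> (inv\<^bsub>D\<^esub> \<chi> y \<otimes>\<^bsub>D\<^esub> \<chi> y)"
      using c xy by (simp only: D.m_ac D.inv_closed D.m_closed)
    finally show "c \<in> kernel G D \<chi>" using xy by (simp add: kernel_def)
  qed
  then have "derived G (carrier G) \<subseteq> kernel G D \<chi>"
    unfolding G.derived_eq_generate_commutators using \<chi>.subgroup_kernel by (rule G.generate_subgroup_incl)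
  then show ?thesis using assms(4) by (auto simp: kernel_def)
qed

text \<open>
  The equation \<open>lift\<close> says that the pullback of \<open>\<alpha>\<close> to \<open>F\<close> is the coboundary of \<open>h\<close>. Restricted to
  the kernel of \<open>\<psi>\<close>, the normalised function \<open>\<mu>\<close> is a homomorphism, which determines the class of \<open>\<alpha>\<close>.
\<close>

locale cocycle_lift = F: group F + P: group P + D: comm_group D
  for F :: "('a, 'b) monoid_scheme" and P :: "('p, 'q) monoid_scheme" and D :: "('c, 'v) monoid_scheme"
    and \<psi> :: "'a \<Rightarrow> 'p" and \<alpha> :: "'p \<times> 'p \<Rightarrow> 'c" and h :: "'a \<Rightarrow> 'c" +
  assumes psi: "\<psi> \<in> hom F P"
    and cocycle: "\<alpha> \<in> carrier (cocycles2 P D)"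
    and h: "h \<in> carrier F \<rightarrow> carrier D"
    and lift: "\<And>x y. x \<in> carrier F \<Longrightarrow> y \<in> carrier F \<Longrightarrow> h x \<otimes>\<^bsub>D\<^esub> h y = \<alpha> (\<psi> x, \<psi> y) \<otimes>\<^bsub>D\<^esub> h (x \<otimes>\<^bsub>F\<^esub> y)"
begin

sublocale psi: group_hom F P \<psi>
  by (simp add: group_hom_def group_hom_axioms_def F.is_group P.is_group psi)

lemma cohomology2: "cohomology2 P D"
  by (simp add: cohomology2_def P.is_group D.comm_group_axioms)

lemma h_closed [simp]: "x \<in> carrier F \<Longrightarrow> h x \<in> carrier D"
  using h by auto

lemma psi_closed: "x \<in> carrier F \<Longrightarrow> \<psi> x \<in> carrier P"
  by simp

lemma alpha_closed: "x \<in> carrier F \<Longrightarrow> y \<in> carrier F \<Longrightarrow> \<alpha> (\<psi> x, \<psi> y) \<in> carrier D"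
  using cocycles2_closed[OF cocycle] by simp

text \<open>Cochains are not normalised: by \<open>lift\<close> at the identity, \<open>h(1)\<close>
  is \<alpha>(1, 1), which may be nontrivial. Dividing by it makes \<mu> multiplicative on the
  kernel.\<close>

definition \<mu> :: "'a \<Rightarrow> 'c" where
  "\<mu> x = h x \<otimes>\<^bsub>D\<^esub> inv\<^bsub>D\<^esub> h \<one>\<^bsub>F\<^esub>"

lemma mu_closed [simp]: "x \<in> carrier F \<Longrightarrow> \<mu> x \<in> carrier D"
  by (simp add: \<mu>_def)

lemma alpha_one_right: "x \<in> carrier F \<Longrightarrow> \<alpha> (\<psi> x, \<one>\<^bsub>P\<^esub>) = h \<one>\<^bsub>F\<^esub>"
  using lift[of x "\<one>\<^bsub>F\<^esub>"] alpha_closed[of x "\<one>\<^bsub>F\<^esub>"] by (simp add: D.m_comm[of "h x"])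

lemma alpha_one_left: "x \<in> carrier F \<Longrightarrow> \<alpha> (\<one>\<^bsub>P\<^esub>, \<psi> x) = h \<one>\<^bsub>F\<^esub>"
  using lift[of "\<one>\<^bsub>F\<^esub>" x] alpha_closed[of "\<one>\<^bsub>F\<^esub>" x] by simp

lemma kernelD: "s \<in> kernel F P \<psi> \<Longrightarrow> s \<in> carrier F" "s \<in> kernel F P \<psi> \<Longrightarrow> \<psi> s = \<one>\<^bsub>P\<^esub>"
  by (auto simp: kernel_def)

text \<open>An element of the kernel puts the identity of \<open>P\<close> into one argument of
  \<alpha>, where \<alpha> is constantly \<open>h(1)\<close> on the image of \<psi>. The two
  versions together make \<mu> invariant under conjugation by \<open>F\<close>.\<close>

lemma h_mult_kernel:
  assumes x: "x \<in> carrier F" and s: "s \<in> kernel F P \<psi>"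
  shows "h (x \<otimes>\<^bsub>F\<^esub> s) = h x \<otimes>\<^bsub>D\<^esub> \<mu> s" "h (s \<otimes>\<^bsub>F\<^esub> x) = \<mu> s \<otimes>\<^bsub>D\<^esub> h x"
proof -
  note sF = kernelD[OF s]
  have "h x \<otimes>\<^bsub>D\<^esub> h s = h \<one>\<^bsub>F\<^esub> \<otimes>\<^bsub>D\<^esub> h (x \<otimes>\<^bsub>F\<^esub> s)" using lift[OF x sF(1)] alpha_one_right[OF x] sF by simp
  then have "h (x \<otimes>\<^bsub>F\<^esub> s) = inv\<^bsub>D\<^esub> h \<one>\<^bsub>F\<^esub> \<otimes>\<^bsub>D\<^esub> (h x \<otimes>\<^bsub>D\<^esub> h s)"
    using x sF by (simp add: D.m_assoc[symmetric])
  then show "h (x \<otimes>\<^bsub>F\<^esub> s) = h x \<otimes>\<^bsub>D\<^esub> \<mu> s" using x sF by (simp add: \<mu>_def D.m_ac)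
  have "h s \<otimes>\<^bsub>D\<^esub> h x = h \<one>\<^bsub>F\<^esub> \<otimes>\<^bsub>D\<^esub> h (s \<otimes>\<^bsub>F\<^esub> x)" using lift[OF sF(1) x] alpha_one_left[OF x] sF by simp
  then have "h (s \<otimes>\<^bsub>F\<^esub> x) = inv\<^bsub>D\<^esub> h \<one>\<^bsub>F\<^esub> \<otimes>\<^bsub>D\<^esub> (h s \<otimes>\<^bsub>D\<^esub> h x)"
    using x sF by (simp add: D.m_assoc[symmetric])
  then show "h (s \<otimes>\<^bsub>F\<^esub> x) = \<mu> s \<otimes>\<^bsub>D\<^esub> h x" using x sF by (simp add: \<mu>_def D.m_ac)
qed

lemma mu_mult:
  assumes "s \<in> kernel F P \<psi>" "t \<in> kernel F P \<psi>"
  shows "\<mu> (s \<otimes>\<^bsub>F\<^esub> t) = \<mu> s \<otimes>\<^bsub>D\<^esub> \<mu> t"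
  using h_mult_kernel(1)[OF kernelD(1)[OF assms(1)] assms(2)] kernelD[OF assms(1)] kernelD[OF assms(2)]
  by (simp add: \<mu>_def D.m_ac)

lemma mu_hom: "\<mu> \<in> hom (F\<lparr>carrier := kernel F P \<psi>\<rparr>) D"
  using kernelD by (auto intro!: homI mu_mult)

lemma mu_trivial_on_generate:
  assumes "T \<subseteq> kernel F P \<psi>" "\<And>x. x \<in> T \<Longrightarrow> \<mu> x = \<one>\<^bsub>D\<^esub>" "x \<in> generate F T"
  shows "\<mu> x = \<one>\<^bsub>D\<^esub>"
proof -
  let ?K = "F\<lparr>carrier := kernel F P \<psi>\<rparr>"
  have K: "subgroup (kernel F P \<psi>) F" by (rule psi.subgroup_kernel)
  interpret m: group_hom ?K D \<mu>
    using F.subgroup_imp_group[OF K] mu_hom by (simp add: group_hom_def group_hom_axioms_def D.is_group)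
  have "generate ?K T = generate F T" using F.generate_consistent[OF assms(1) K] by simp
  moreover have "T \<subseteq> kernel ?K D \<mu>" using assms by (auto simp: kernel_def)
  then have "generate ?K T \<subseteq> kernel ?K D \<mu>"
    by (rule group.generate_subgroup_incl[OF F.subgroup_imp_group[OF K] _ m.subgroup_kernel])
  ultimately show ?thesis using assms(3) by (auto simp: kernel_def)
qed

text \<open>From \<open>xy = yx [x, y]\<close>. Compared with \<open>lift\<close> at
  \<open>(x, y)\<close> and \<open>(y, x)\<close>, this shows that \<mu> at a commutator in the
  kernel measures how far \<alpha> is from being symmetric on a commuting pair.\<close>

lemma mu_commutator:
  assumes "x \<in> carrier F" "y \<in> carrier F" "inv\<^bsub>F\<^esub> x \<otimes>\<^bsub>F\<^esub> inv\<^bsub>F\<^esub> y \<otimes>\<^bsub>F\<^esub> x \<otimes>\<^bsub>F\<^esub> y \<in> kernel F P \<psi>"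
  shows "h (x \<otimes>\<^bsub>F\<^esub> y) = h (y \<otimes>\<^bsub>F\<^esub> x) \<otimes>\<^bsub>D\<^esub> \<mu> (inv\<^bsub>F\<^esub> x \<otimes>\<^bsub>F\<^esub> inv\<^bsub>F\<^esub> y \<otimes>\<^bsub>F\<^esub> x \<otimes>\<^bsub>F\<^esub> y)"
  using h_mult_kernel(1)[OF _ assms(3), of "y \<otimes>\<^bsub>F\<^esub> x"] F.commutator_eq[of x y] assms by simp

text \<open>If \<alpha> is the coboundary of \<open>k\<close>, then \<open>h\<close> and
  \<open>k\<close> composed with \<psi> have the same coboundary on \<open>F\<close>. Their quotient
  \<chi> is therefore a homomorphism to an abelian group and kills the derived subgroup.\<close>

lemma mu_trivial_if_coboundary:
  assumes cob: "\<alpha> \<in> coboundaries2 P D" and x: "x \<in> kernel F P \<psi>" "x \<in> derived F (carrier F)"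
  shows "\<mu> x = \<one>\<^bsub>D\<^esub>"
proof -
  obtain k where k: "k \<in> carrier P \<rightarrow> carrier D" and
    ka: "\<And>x y. x \<in> carrier P \<Longrightarrow> y \<in> carrier P \<Longrightarrow> k x \<otimes>\<^bsub>D\<^esub> k y = \<alpha> (x, y) \<otimes>\<^bsub>D\<^esub> k (x \<otimes>\<^bsub>P\<^esub> y)"
    using cob cohomology2.coboundaries2_iff[OF cohomology2 cocycle] by blast
  have kc: "k x \<in> carrier D" if "x \<in> carrier P" for x using k that by auto
  define \<chi> where "\<chi> = (\<lambda>x. h x \<otimes>\<^bsub>D\<^esub> inv\<^bsub>D\<^esub> k (\<psi> x))"
  have "\<chi> \<in> hom F D"
  proof (rule homI)
    show "\<chi> x \<in> carrier D" if "x \<in> carrier F" for x using that kc by (simp add: \<chi>_def)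
    show "\<chi> (x \<otimes>\<^bsub>F\<^esub> y) = \<chi> x \<otimes>\<^bsub>D\<^esub> \<chi> y" if xy: "x \<in> carrier F" "y \<in> carrier F" for x y
    proof -
      let ?a = "\<alpha> (\<psi> x, \<psi> y)"
      note cl = xy kc alpha_closed[OF xy]
      have "\<chi> x \<otimes>\<^bsub>D\<^esub> \<chi> y = (h x \<otimes>\<^bsub>D\<^esub> h y) \<otimes>\<^bsub>D\<^esub> inv\<^bsub>D\<^esub> (k (\<psi> x) \<otimes>\<^bsub>D\<^esub> k (\<psi> y))"
        using cl by (simp add: \<chi>_def D.inv_mult D.m_ac)
      also have "\<dots> = (?a \<otimes>\<^bsub>D\<^esub> h (x \<otimes>\<^bsub>F\<^esub> y)) \<otimes>\<^bsub>D\<^esub> inv\<^bsub>D\<^esub> (?a \<otimes>\<^bsub>D\<^esub> k (\<psi> (x \<otimes>\<^bsub>F\<^esub> y)))"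
        using cl lift[OF xy] ka[of "\<psi> x" "\<psi> y"] by simp
      also have "\<dots> = (?a \<otimes>\<^bsub>D\<^esub> inv\<^bsub>D\<^esub> ?a) \<otimes>\<^bsub>D\<^esub> \<chi> (x \<otimes>\<^bsub>F\<^esub> y)"
      proof -
        have "k (\<psi> (x \<otimes>\<^bsub>F\<^esub> y)) \<in> carrier D" using xy by (intro kc) simp
        then show ?thesis
        using cl by (simp only: \<chi>_def D.inv_mult D.m_ac D.inv_closed D.m_closed h_closed F.m_closed)
      qed
      also have "\<dots> = \<chi> (x \<otimes>\<^bsub>F\<^esub> y)"
      proof -
        have "\<chi> (x \<otimes>\<^bsub>F\<^esub> y) \<in> carrier D" unfolding \<chi>_def using xy by (intro D.m_closed D.inv_closed kc) simp_all
        then show ?thesis using cl by simp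
      qed
      finally show ?thesis by simp
    qed
  qed
  then have "\<chi> x = \<one>\<^bsub>D\<^esub>" using hom_trivial_on_derived[OF F.is_group D.comm_group_axioms _ x(2)] by blast
  \<comment> \<open>On the kernel, \<open>k\<close> composed with \<psi> is constantly
    \<open>k(1) = h(1)\<close>, so \<chi> and \<mu> agree there.\<close>
  moreover have "k \<one>\<^bsub>P\<^esub> = h \<one>\<^bsub>F\<^esub>"
    using ka[of "\<one>\<^bsub>P\<^esub>" "\<one>\<^bsub>P\<^esub>"] alpha_one_left[of "\<one>\<^bsub>F\<^esub>"] kc[of "\<one>\<^bsub>P\<^esub>"] by simp
  ultimately show ?thesis using kernelD[OF x(1)] by (simp add: \<chi>_def \<mu>_def)
qed

text \<open>Triviality on the intersection with the derived subgroup is what allows \<mu> to extend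
  to a homomorphism \<chi> on all of \<open>F\<close>. The quotient of \<open>h\<close> by \<chi> is
  then constant on cosets of the kernel and descends to a function \<open>k\<close> on
  \<open>P\<close> whose coboundary is \<alpha>.\<close>

lemma coboundary_if_mu_trivial:
  assumes D: "divisible D" and surj: "\<psi> ` carrier F = carrier P"
    and triv: "\<And>x. x \<in> kernel F P \<psi> \<Longrightarrow> x \<in> derived F (carrier F) \<Longrightarrow> \<mu> x = \<one>\<^bsub>D\<^esub>"
  shows "\<alpha> \<in> coboundaries2 P D"
proof -
  have K: "subgroup (kernel F P \<psi>) F" by (rule psi.subgroup_kernel)
  have N: "derived F (carrier F) \<lhd> F" by (rule F.derived_self_is_normal)
  obtain \<chi> where \<chi>: "\<chi> \<in> hom F D" "\<forall>x\<in>kernel F P \<psi>. \<chi> x = \<mu> x"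
    using hom_extension[OF D.comm_group_axioms D F.is_group K mu_hom N F.commutators_subset_derived triv]
    by blast
  interpret \<chi>: group_hom F D \<chi>
    using \<chi> by (simp add: group_hom_def group_hom_axioms_def F.is_group D.is_group)
  have \<chi>c: "\<chi> x \<in> carrier D" if "x \<in> carrier F" for x using that by simp
  have \<chi>m: "\<chi> (x \<otimes>\<^bsub>F\<^esub> y) = \<chi> x \<otimes>\<^bsub>D\<^esub> \<chi> y" if "x \<in> carrier F" "y \<in> carrier F" for x y using that by simp
  define t where "t = inv_into (carrier F) \<psi>"
  have t: "t p \<in> carrier F" "\<psi> (t p) = p" if "p \<in> carrier P" for p
    using that surj by (auto simp: t_def inv_into_into f_inv_into_f)
  define k where "k = (\<lambda>p. h (t p) \<otimes>\<^bsub>D\<^esub> inv\<^bsub>D\<^esub> \<chi> (t p))"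
  have k: "h x = k (\<psi> x) \<otimes>\<^bsub>D\<^esub> \<chi> x" if x: "x \<in> carrier F" for x
  proof -
    let ?y = "t (\<psi> x)"
    have y: "?y \<in> carrier F" "\<psi> ?y = \<psi> x" using t x by auto
    define s where "s = inv\<^bsub>F\<^esub> ?y \<otimes>\<^bsub>F\<^esub> x"
    have s: "s \<in> kernel F P \<psi>" using x y by (simp add: s_def kernel_def)
    note sF = kernelD[OF s]
    have xs: "x = ?y \<otimes>\<^bsub>F\<^esub> s" using x y by (simp add: s_def F.m_assoc[symmetric])
    have "h x = h ?y \<otimes>\<^bsub>D\<^esub> \<mu> s" "\<chi> x = \<chi> ?y \<otimes>\<^bsub>D\<^esub> \<mu> s"
      using h_mult_kernel(1)[OF y(1) s] \<chi>m[OF y(1) sF(1)] xs \<chi>(2) s by simp_all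
    moreover have "h ?y \<otimes>\<^bsub>D\<^esub> inv\<^bsub>D\<^esub> \<chi> ?y \<otimes>\<^bsub>D\<^esub> (\<chi> ?y \<otimes>\<^bsub>D\<^esub> \<mu> s) = h ?y \<otimes>\<^bsub>D\<^esub> (inv\<^bsub>D\<^esub> \<chi> ?y \<otimes>\<^bsub>D\<^esub> \<chi> ?y) \<otimes>\<^bsub>D\<^esub> \<mu> s"
      using y sF \<chi>c by (simp only: D.m_assoc h_closed D.inv_closed D.m_closed mu_closed)
    ultimately show ?thesis using y sF by (simp add: k_def)
  qed
  have kc: "k p \<in> carrier D" if "p \<in> carrier P" for p using t[OF that] by (simp add: k_def)
  have "k p \<otimes>\<^bsub>D\<^esub> k q = \<alpha> (p, q) \<otimes>\<^bsub>D\<^esub> k (p \<otimes>\<^bsub>P\<^esub> q)" if pq: "p \<in> carrier P" "q \<in> carrier P" for p q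
  proof -
    note tp = t[OF pq(1)] and tq = t[OF pq(2)]
    have tpq: "t p \<otimes>\<^bsub>F\<^esub> t q \<in> carrier F" "\<psi> (t p \<otimes>\<^bsub>F\<^esub> t q) = p \<otimes>\<^bsub>P\<^esub> q" using tp tq by auto
    note cl = kc[OF pq(1)] kc[OF pq(2)] kc[of "p \<otimes>\<^bsub>P\<^esub> q"] \<chi>c[OF tp(1)] \<chi>c[OF tq(1)] cocycles2_closed[OF cocycle pq]
    \<comment> \<open>Multiplying by the values of \<chi> returns from \<open>k\<close> to
      \<open>h\<close>, where \<open>lift\<close> applies; afterwards they cancel.\<close>
    have "k p \<otimes>\<^bsub>D\<^esub> k q \<otimes>\<^bsub>D\<^esub> (\<chi> (t p) \<otimes>\<^bsub>D\<^esub> \<chi> (t q)) = k p \<otimes>\<^bsub>D\<^esub> \<chi> (t p) \<otimes>\<^bsub>D\<^esub> (k q \<otimes>\<^bsub>D\<^esub> \<chi> (t q))"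
      using cl by (simp only: D.m_ac D.m_closed)
    also have "\<dots> = \<alpha> (p, q) \<otimes>\<^bsub>D\<^esub> (k (p \<otimes>\<^bsub>P\<^esub> q) \<otimes>\<^bsub>D\<^esub> (\<chi> (t p) \<otimes>\<^bsub>D\<^esub> \<chi> (t q)))"
      using k[OF tp(1)] k[OF tq(1)] k[OF tpq(1)] lift[OF tp(1) tq(1)] tp tq tpq \<chi>m[OF tp(1) tq(1)] by simp
    also have "\<dots> = \<alpha> (p, q) \<otimes>\<^bsub>D\<^esub> k (p \<otimes>\<^bsub>P\<^esub> q) \<otimes>\<^bsub>D\<^esub> (\<chi> (t p) \<otimes>\<^bsub>D\<^esub> \<chi> (t q))"
      using cl pq by (simp add: D.m_assoc)
    finally show ?thesis using cl pq D.right_cancel by simp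
  qed
  then show ?thesis
    unfolding cohomology2.coboundaries2_iff[OF cohomology2 cocycle] using kc by blast
qed

end

text \<open>The cocycle identity is forced by \<open>lift\<close>: both bracketings of
  \<open>h x\<close>, \<open>h y\<close>, \<open>h z\<close> give the same product,
  \<open>h(xyz)\<close> cancels, and surjectivity of \<psi> transports the identity to all of
  \<open>P\<close>.\<close>

lemma cocycle_liftI_surj:
  assumes "group F" "group P" "comm_group D" and psi: "\<psi> \<in> epi F P"
    and h: "h \<in> carrier F \<rightarrow> carrier D"
    and ext: "\<alpha> \<in> extensional (carrier P \<times> carrier P)"
    and cl: "\<And>x y. x \<in> carrier P \<Longrightarrow> y \<in> carrier P \<Longrightarrow> \<alpha> (x, y) \<in> carrier D"
    and lift: "\<And>x y. x \<in> carrier F \<Longrightarrow> y \<in> carrier F \<Longrightarrow> h x \<otimes>\<^bsub>D\<^esub> h y = \<alpha> (\<psi> x, \<psi> y) \<otimes>\<^bsub>D\<^esub> h (x \<otimes>\<^bsub>F\<^esub> y)"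
  shows "cocycle_lift F P D \<psi> \<alpha> h"
proof -
  interpret F: group F by fact
  interpret P: group P by fact
  interpret D: comm_group D by fact
  have hom: "\<psi> \<in> hom F P" and surj: "\<psi> ` carrier F = carrier P" using psi by (auto simp: epi_def)
  have m: "\<psi> (x \<otimes>\<^bsub>F\<^esub> y) = \<psi> x \<otimes>\<^bsub>P\<^esub> \<psi> y" "\<psi> x \<in> carrier P" if "x \<in> carrier F" "y \<in> carrier F" for x y
    using hom that by (auto simp: hom_def)
  have hc: "h x \<in> carrier D" if "x \<in> carrier F" for x using h that by auto
  have "\<alpha> \<in> carrier (cocycles2 P D)"
  proof (rule cocycles2I[OF ext cl])
    fix p q r assume "p \<in> carrier P" "q \<in> carrier P" "r \<in> carrier P"
    then have "p \<in> \<psi> ` carrier F" "q \<in> \<psi> ` carrier F" "r \<in> \<psi> ` carrier F" using surj by simp_all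
    then obtain x y z where xyz: "x \<in> carrier F" "y \<in> carrier F" "z \<in> carrier F"
      and pqr: "p = \<psi> x" "q = \<psi> y" "r = \<psi> z"
      by blast
    have al: "\<alpha> (\<psi> u, \<psi> v) \<in> carrier D" if "u \<in> carrier F" "v \<in> carrier F" for u v
      using cl m that by blast
    note cs = xyz hc al[OF xyz(1,2)] al[OF xyz(2,3)] al[of "x \<otimes>\<^bsub>F\<^esub> y" z] al[of x "y \<otimes>\<^bsub>F\<^esub> z"]
    have "\<alpha> (\<psi> x, \<psi> y) \<otimes>\<^bsub>D\<^esub> \<alpha> (\<psi> (x \<otimes>\<^bsub>F\<^esub> y), \<psi> z) \<otimes>\<^bsub>D\<^esub> h (x \<otimes>\<^bsub>F\<^esub> y \<otimes>\<^bsub>F\<^esub> z) =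
        \<alpha> (\<psi> x, \<psi> y) \<otimes>\<^bsub>D\<^esub> (h (x \<otimes>\<^bsub>F\<^esub> y) \<otimes>\<^bsub>D\<^esub> h z)"
      using cs lift[of "x \<otimes>\<^bsub>F\<^esub> y" z] by (simp add: D.m_assoc)
    also have "\<dots> = h x \<otimes>\<^bsub>D\<^esub> h y \<otimes>\<^bsub>D\<^esub> h z"
      using cs lift[of x y] by (simp add: D.m_assoc)
    also have "\<dots> = h x \<otimes>\<^bsub>D\<^esub> (\<alpha> (\<psi> y, \<psi> z) \<otimes>\<^bsub>D\<^esub> h (y \<otimes>\<^bsub>F\<^esub> z))"
      using cs lift[of y z] by (simp add: D.m_assoc)
    also have "\<dots> = \<alpha> (\<psi> y, \<psi> z) \<otimes>\<^bsub>D\<^esub> (h x \<otimes>\<^bsub>D\<^esub> h (y \<otimes>\<^bsub>F\<^esub> z))"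
      using cs by (simp only: D.m_ac F.m_closed)
    also have "\<dots> = \<alpha> (\<psi> y, \<psi> z) \<otimes>\<^bsub>D\<^esub> \<alpha> (\<psi> x, \<psi> (y \<otimes>\<^bsub>F\<^esub> z)) \<otimes>\<^bsub>D\<^esub> h (x \<otimes>\<^bsub>F\<^esub> y \<otimes>\<^bsub>F\<^esub> z)"
      using cs lift[of x "y \<otimes>\<^bsub>F\<^esub> z"] by (simp add: D.m_assoc F.m_assoc)
    finally have "\<alpha> (\<psi> x, \<psi> y) \<otimes>\<^bsub>D\<^esub> \<alpha> (\<psi> (x \<otimes>\<^bsub>F\<^esub> y), \<psi> z) = \<alpha> (\<psi> y, \<psi> z) \<otimes>\<^bsub>D\<^esub> \<alpha> (\<psi> x, \<psi> (y \<otimes>\<^bsub>F\<^esub> z))"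
      using cs D.right_cancel[of "h (x \<otimes>\<^bsub>F\<^esub> y \<otimes>\<^bsub>F\<^esub> z)"] by simp
    then show "\<alpha> (p, q) \<otimes>\<^bsub>D\<^esub> \<alpha> (p \<otimes>\<^bsub>P\<^esub> q, r) = \<alpha> (q, r) \<otimes>\<^bsub>D\<^esub> \<alpha> (p, q \<otimes>\<^bsub>P\<^esub> r)"
      using m xyz by (simp add: pqr)
  qed
  then show ?thesis
    using assms hom by (intro cocycle_lift.intro cocycle_lift_axioms.intro) auto
qed

text \<open>The central extension of \<open>F\<close> by \<open>D\<close> with factor set \<beta>.
  As \<beta> is not normalised, the unit carries the inverse of \<beta>(1, 1).\<close>

definition cocycle_extension ::
    "('a, 'b) monoid_scheme \<Rightarrow> ('c, 'v) monoid_scheme \<Rightarrow> ('a \<times> 'a \<Rightarrow> 'c) \<Rightarrow> ('c \<times> 'a) monoid" where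
  "cocycle_extension F D \<beta> = \<lparr>carrier = carrier D \<times> carrier F,
      mult = (\<lambda>(a, x) (b, y). (a \<otimes>\<^bsub>D\<^esub> b \<otimes>\<^bsub>D\<^esub> \<beta> (x, y), x \<otimes>\<^bsub>F\<^esub> y)),
      one = (inv\<^bsub>D\<^esub> \<beta> (\<one>\<^bsub>F\<^esub>, \<one>\<^bsub>F\<^esub>), \<one>\<^bsub>F\<^esub>)\<rparr>"

text \<open>Associativity is the cocycle identity. The left unit law needs that \<beta>(1, x) does
  not depend on \<open>x\<close>, which is that identity at (1, 1, x).\<close>

lemma cocycle_extension_group:
  assumes "group F" "comm_group D" and \<beta>: "\<beta> \<in> carrier (cocycles2 F D)"
  shows "group (cocycle_extension F D \<beta>)" "snd \<in> epi (cocycle_extension F D \<beta>) F"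
proof -
  define E where "E = cocycle_extension F D \<beta>"
  note E_def = E_def[unfolded cocycle_extension_def]
  interpret F: group F by fact
  interpret D: comm_group D by fact
  note c = cocycles2_closed[OF \<beta>] and e = cocycles2_eq[OF \<beta>]
  have one: "\<beta> (\<one>\<^bsub>F\<^esub>, x) = \<beta> (\<one>\<^bsub>F\<^esub>, \<one>\<^bsub>F\<^esub>)" if "x \<in> carrier F" for x
    using e[of "\<one>\<^bsub>F\<^esub>" "\<one>\<^bsub>F\<^esub>" x] that c[of "\<one>\<^bsub>F\<^esub>" x] c[of "\<one>\<^bsub>F\<^esub>" "\<one>\<^bsub>F\<^esub>"] by simp
  have "group E"
  proof (rule groupI)
    show "u \<otimes>\<^bsub>E\<^esub> v \<in> carrier E" if "u \<in> carrier E" "v \<in> carrier E" for u v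
      using that c by (auto simp: E_def)
    show "\<one>\<^bsub>E\<^esub> \<in> carrier E" using c by (auto simp: E_def)
    show "u \<otimes>\<^bsub>E\<^esub> v \<otimes>\<^bsub>E\<^esub> w = u \<otimes>\<^bsub>E\<^esub> (v \<otimes>\<^bsub>E\<^esub> w)"
      if uvw: "u \<in> carrier E" "v \<in> carrier E" "w \<in> carrier E" for u v w
    proof -
      obtain a x b y d z where *: "u = (a, x)" "v = (b, y)" "w = (d, z)"
        "a \<in> carrier D" "b \<in> carrier D" "d \<in> carrier D" "x \<in> carrier F" "y \<in> carrier F" "z \<in> carrier F"
        using uvw by (auto simp: E_def)
      note cs = * c[of x y] c[of "x \<otimes>\<^bsub>F\<^esub> y" z] c[of y z] c[of x "y \<otimes>\<^bsub>F\<^esub> z"]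
      have "a \<otimes>\<^bsub>D\<^esub> b \<otimes>\<^bsub>D\<^esub> \<beta> (x, y) \<otimes>\<^bsub>D\<^esub> d \<otimes>\<^bsub>D\<^esub> \<beta> (x \<otimes>\<^bsub>F\<^esub> y, z) = a \<otimes>\<^bsub>D\<^esub> b \<otimes>\<^bsub>D\<^esub> d \<otimes>\<^bsub>D\<^esub> (\<beta> (x, y) \<otimes>\<^bsub>D\<^esub> \<beta> (x \<otimes>\<^bsub>F\<^esub> y, z))"
        using cs by (simp add: D.m_ac)
      also have "\<dots> = a \<otimes>\<^bsub>D\<^esub> b \<otimes>\<^bsub>D\<^esub> d \<otimes>\<^bsub>D\<^esub> (\<beta> (y, z) \<otimes>\<^bsub>D\<^esub> \<beta> (x, y \<otimes>\<^bsub>F\<^esub> z))"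
        using e[OF *(7,8,9)] by simp
      also have "\<dots> = a \<otimes>\<^bsub>D\<^esub> (b \<otimes>\<^bsub>D\<^esub> d \<otimes>\<^bsub>D\<^esub> \<beta> (y, z)) \<otimes>\<^bsub>D\<^esub> \<beta> (x, y \<otimes>\<^bsub>F\<^esub> z)"
        using cs by (simp add: D.m_ac)
      finally show ?thesis using * by (simp add: E_def F.m_assoc)
    qed
    show "\<one>\<^bsub>E\<^esub> \<otimes>\<^bsub>E\<^esub> u = u" if u: "u \<in> carrier E" for u
    proof -
      obtain a x where *: "u = (a, x)" "a \<in> carrier D" "x \<in> carrier F" using u by (auto simp: E_def)
      have "inv\<^bsub>D\<^esub> \<beta> (\<one>\<^bsub>F\<^esub>, \<one>\<^bsub>F\<^esub>) \<otimes>\<^bsub>D\<^esub> a \<otimes>\<^bsub>D\<^esub> \<beta> (\<one>\<^bsub>F\<^esub>, x) = (inv\<^bsub>D\<^esub> \<beta> (\<one>\<^bsub>F\<^esub>, \<one>\<^bsub>F\<^esub>) \<otimes>\<^bsub>D\<^esub> \<beta> (\<one>\<^bsub>F\<^esub>, \<one>\<^bsub>F\<^esub>)) \<otimes>\<^bsub>D\<^esub> a"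
        using * c[of "\<one>\<^bsub>F\<^esub>" "\<one>\<^bsub>F\<^esub>"] by (simp only: one[OF *(3)] D.m_ac D.inv_closed D.m_closed F.one_closed)
      then show ?thesis using * c[of "\<one>\<^bsub>F\<^esub>" "\<one>\<^bsub>F\<^esub>"] by (simp add: E_def one[OF *(3)])
    qed
    show "\<exists>v\<in>carrier E. v \<otimes>\<^bsub>E\<^esub> u = \<one>\<^bsub>E\<^esub>" if u: "u \<in> carrier E" for u
    proof -
      obtain a x where *: "u = (a, x)" "a \<in> carrier D" "x \<in> carrier F" using u by (auto simp: E_def)
      let ?b = "\<beta> (inv\<^bsub>F\<^esub> x, x)"
      let ?o = "inv\<^bsub>D\<^esub> \<beta> (\<one>\<^bsub>F\<^esub>, \<one>\<^bsub>F\<^esub>)"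
      have cs: "?b \<in> carrier D" "?o \<in> carrier D" using * c by auto
      \<comment> \<open>The first component of the inverse is found by solving: multiplied by
        \<open>a\<close> and \<open>?b\<close> it must give \<open>?o\<close>, the first component
        of the unit.\<close>
      have "inv\<^bsub>D\<^esub> a \<otimes>\<^bsub>D\<^esub> inv\<^bsub>D\<^esub> ?b \<otimes>\<^bsub>D\<^esub> ?o \<otimes>\<^bsub>D\<^esub> a \<otimes>\<^bsub>D\<^esub> ?b = (inv\<^bsub>D\<^esub> a \<otimes>\<^bsub>D\<^esub> a) \<otimes>\<^bsub>D\<^esub> (inv\<^bsub>D\<^esub> ?b \<otimes>\<^bsub>D\<^esub> ?b) \<otimes>\<^bsub>D\<^esub> ?o"
        using * cs by (simp only: D.m_ac D.inv_closed D.m_closed)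
      then show ?thesis
        using * cs by (intro bexI[of _ "(inv\<^bsub>D\<^esub> a \<otimes>\<^bsub>D\<^esub> inv\<^bsub>D\<^esub> ?b \<otimes>\<^bsub>D\<^esub> ?o, inv\<^bsub>F\<^esub> x)"]) (simp_all add: E_def)
    qed
  qed
  then show "group (cocycle_extension F D \<beta>)" by (simp add: E_def cocycle_extension_def)
  have "carrier D \<noteq> {}" using D.one_closed by blast
  then have "snd ` (carrier D \<times> carrier F) = carrier F" by simp
  moreover have "snd \<in> hom (cocycle_extension F D \<beta>) F"
    by (rule homI) (auto simp: cocycle_extension_def)
  ultimately show "snd \<in> epi (cocycle_extension F D \<beta>) F" by (simp add: epi_def cocycle_extension_def)
qed

text \<open>Second cohomology of a free group vanishes: the extension of \<open>F\<close> by the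
  pulled back cocycle splits, a section sends \<open>x\<close> to \<open>(k x, x)\<close>, and its
  multiplicativity says that the pointwise inverse of \<open>k\<close> has the pulled back cocycle
  as its coboundary.\<close>

lemma free_group_lift_exists:
  assumes F: "free_group F" and "group P" "comm_group D" and psi: "\<psi> \<in> hom F P"
    and \<alpha>: "\<alpha> \<in> carrier (cocycles2 P D)"
  shows "\<exists>h. cocycle_lift F P D \<psi> \<alpha> h"
proof -
  have gF: "group F" using F by (simp add: free_group_def)
  interpret F: group F by fact
  interpret D: comm_group D by fact
  have \<beta>: "pullback2 F \<psi> \<alpha> \<in> carrier (cocycles2 F D)"
    using assms gF by (intro pullback2_cocycle[where G = P]) (auto simp: cohomology2_def)
  note E = cocycle_extension_group[OF gF D.comm_group_axioms \<beta>]
  obtain s where s: "s \<in> hom F (cocycle_extension F D (pullback2 F \<psi> \<alpha>))" "\<And>x. x \<in> carrier F \<Longrightarrow> snd (s x) = x"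
    using free_group_section[OF F E] by blast
  have psic: "\<psi> x \<in> carrier P" if "x \<in> carrier F" for x using psi that by (auto simp: hom_def)
  define k where "k = (\<lambda>x. fst (s x))"
  have s_eq: "s x = (k x, x)" if "x \<in> carrier F" for x using s(2)[OF that] by (simp add: k_def prod_eq_iff)
  have kc: "k x \<in> carrier D" if "x \<in> carrier F" for x
    using hom_in_carrier[OF s(1) that] s_eq[OF that] by (simp add: cocycle_extension_def)
  have km: "k (x \<otimes>\<^bsub>F\<^esub> y) = k x \<otimes>\<^bsub>D\<^esub> k y \<otimes>\<^bsub>D\<^esub> \<alpha> (\<psi> x, \<psi> y)" if xy: "x \<in> carrier F" "y \<in> carrier F" for x y
    using s(1) s_eq xy by (auto simp: hom_def pullback2_def cocycle_extension_def)
  have "inv\<^bsub>D\<^esub> k x \<otimes>\<^bsub>D\<^esub> inv\<^bsub>D\<^esub> k y = \<alpha> (\<psi> x, \<psi> y) \<otimes>\<^bsub>D\<^esub> inv\<^bsub>D\<^esub> k (x \<otimes>\<^bsub>F\<^esub> y)"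
    if xy: "x \<in> carrier F" "y \<in> carrier F" for x y
  proof -
    let ?a = "\<alpha> (\<psi> x, \<psi> y)"
    have cs: "k x \<in> carrier D" "k y \<in> carrier D" "?a \<in> carrier D"
      using xy kc psic cocycles2_closed[OF \<alpha>] by auto
    have "?a \<otimes>\<^bsub>D\<^esub> inv\<^bsub>D\<^esub> k (x \<otimes>\<^bsub>F\<^esub> y) = (?a \<otimes>\<^bsub>D\<^esub> inv\<^bsub>D\<^esub> ?a) \<otimes>\<^bsub>D\<^esub> (inv\<^bsub>D\<^esub> k x \<otimes>\<^bsub>D\<^esub> inv\<^bsub>D\<^esub> k y)"
      using cs by (simp only: km[OF xy] D.inv_mult D.m_ac D.inv_closed D.m_closed)
    then show ?thesis using cs by simp
  qed
  then have "cocycle_lift F P D \<psi> \<alpha> (\<lambda>x. inv\<^bsub>D\<^esub> k x)"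
    using assms gF kc by (intro cocycle_lift.intro cocycle_lift_axioms.intro) auto
  then show ?thesis by blast
qed

text \<open>A set-theoretic section \<open>t\<close> of \<psi> writes each \<open>x\<close> as
  \<open>t(\<psi> x)\<close> times an element of the kernel, and \<open>h(x)\<close> is
  \<open>m\<close> of that element. Invariance of \<open>m\<close> makes
  \<open>h(x) h(y) / h(xy)\<close> depend only on the images of \<open>x\<close> and
  \<open>y\<close>, which gives \<alpha>.\<close>

lemma cocycle_lift_of_hom:
  fixes F :: "('a, 'b) monoid_scheme" and P :: "('p, 'q) monoid_scheme" and D :: "('c, 'v) monoid_scheme"
  assumes "group F" "group P" "comm_group D" and psi: "\<psi> \<in> epi F P"
    and m: "m \<in> hom (F\<lparr>carrier := kernel F P \<psi>\<rparr>) D"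
    and inv: "\<And>s x. s \<in> kernel F P \<psi> \<Longrightarrow> x \<in> carrier F \<Longrightarrow> m (inv\<^bsub>F\<^esub> x \<otimes>\<^bsub>F\<^esub> s \<otimes>\<^bsub>F\<^esub> x) = m s"
  shows "\<exists>\<alpha> h. cocycle_lift F P D \<psi> \<alpha> h \<and> (\<forall>s\<in>kernel F P \<psi>. cocycle_lift.\<mu> F D h s = m s)"
proof -
  interpret F: group F by fact
  interpret P: group P by fact
  interpret D: comm_group D by fact
  have hom: "\<psi> \<in> hom F P" and surj: "\<psi> ` carrier F = carrier P" using psi by (auto simp: epi_def)
  interpret psi: group_hom F P \<psi>
    using hom by (simp add: group_hom_def group_hom_axioms_def F.is_group P.is_group)
  define K where "K = kernel F P \<psi>"
  have K: "subgroup K F" "K \<lhd> F" unfolding K_def by (rule psi.subgroup_kernel, rule psi.normal_kernel)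
  interpret K: normal K F by (rule K)
  have mc: "m s \<in> carrier D" if "s \<in> K" for s using m that by (auto simp: hom_def K_def)
  have mm: "m (s \<otimes>\<^bsub>F\<^esub> r) = m s \<otimes>\<^bsub>D\<^esub> m r" if "s \<in> K" "r \<in> K" for s r using m that by (auto simp: hom_def K_def)
  define t where "t = inv_into (carrier F) \<psi>"
  have t: "t p \<in> carrier F" "\<psi> (t p) = p" if "p \<in> carrier P" for p
    using that surj by (auto simp: t_def inv_into_into f_inv_into_f)
  define h where "h = (\<lambda>x. m (inv\<^bsub>F\<^esub> t (\<psi> x) \<otimes>\<^bsub>F\<^esub> x))"
  have tK: "inv\<^bsub>F\<^esub> t (\<psi> x) \<otimes>\<^bsub>F\<^esub> x \<in> K" if "x \<in> carrier F" for x
    using that t[of "\<psi> x"] unfolding K_def kernel_def by simp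
  have hc: "h x \<in> carrier D" if "x \<in> carrier F" for x using mc[OF tK[OF that]] by (simp add: h_def)
  have hs: "h (x \<otimes>\<^bsub>F\<^esub> s) = h x \<otimes>\<^bsub>D\<^esub> m s" if x: "x \<in> carrier F" and s: "s \<in> K" for x s
  proof -
    have sF: "s \<in> carrier F" "\<psi> s = \<one>\<^bsub>P\<^esub>" using s unfolding K_def kernel_def by simp_all
    then have "inv\<^bsub>F\<^esub> t (\<psi> (x \<otimes>\<^bsub>F\<^esub> s)) \<otimes>\<^bsub>F\<^esub> (x \<otimes>\<^bsub>F\<^esub> s) = inv\<^bsub>F\<^esub> t (\<psi> x) \<otimes>\<^bsub>F\<^esub> x \<otimes>\<^bsub>F\<^esub> s"
      using x t[of "\<psi> x"] by (simp add: F.m_assoc)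
    then show ?thesis using mm[OF tK[OF x] s] by (simp add: h_def)
  qed
  define \<alpha> where "\<alpha> = (\<lambda>(p, q)\<in>carrier P \<times> carrier P. h (t p) \<otimes>\<^bsub>D\<^esub> h (t q) \<otimes>\<^bsub>D\<^esub> inv\<^bsub>D\<^esub> h (t p \<otimes>\<^bsub>F\<^esub> t q))"
  have lift: "h x \<otimes>\<^bsub>D\<^esub> h y = \<alpha> (\<psi> x, \<psi> y) \<otimes>\<^bsub>D\<^esub> h (x \<otimes>\<^bsub>F\<^esub> y)" if xy: "x \<in> carrier F" "y \<in> carrier F" for x y
  proof -
    define u where "u = t (\<psi> x)"
    define v where "v = t (\<psi> y)"
    define s where "s = inv\<^bsub>F\<^esub> u \<otimes>\<^bsub>F\<^esub> x"
    define r where "r = inv\<^bsub>F\<^esub> v \<otimes>\<^bsub>F\<^esub> y"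
    have uv: "u \<in> carrier F" "v \<in> carrier F" using xy t by (auto simp: u_def v_def)
    have sr: "s \<in> K" "r \<in> K" using tK xy by (auto simp: s_def r_def u_def v_def)
    have srF: "s \<in> carrier F" "r \<in> carrier F" using sr by auto
    have x: "x = u \<otimes>\<^bsub>F\<^esub> s" and y: "y = v \<otimes>\<^bsub>F\<^esub> r"
      using xy uv by (simp_all add: s_def r_def F.m_assoc[symmetric])
    \<comment> \<open>Moving \<open>s\<close> to the right past \<open>v\<close> replaces it by the
      conjugate \<open>s'\<close>, at which \<open>m\<close> has the same value by
      \<open>inv\<close>.\<close>
    define s' where "s' = inv\<^bsub>F\<^esub> v \<otimes>\<^bsub>F\<^esub> s \<otimes>\<^bsub>F\<^esub> v"
    have s': "s' \<in> K" "m s' = m s" "s' \<in> carrier F"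
      using K.inv_op_closed1[OF uv(2) sr(1)] inv[of s v, folded K_def] sr uv srF
      by (simp_all add: s'_def)
    have "v \<otimes>\<^bsub>F\<^esub> s' = s \<otimes>\<^bsub>F\<^esub> v" using uv srF by (simp add: s'_def F.m_assoc[symmetric])
    then have "v \<otimes>\<^bsub>F\<^esub> (s' \<otimes>\<^bsub>F\<^esub> r) = s \<otimes>\<^bsub>F\<^esub> (v \<otimes>\<^bsub>F\<^esub> r)" using uv srF s' by (simp add: F.m_assoc[symmetric])
    then have "x \<otimes>\<^bsub>F\<^esub> y = u \<otimes>\<^bsub>F\<^esub> v \<otimes>\<^bsub>F\<^esub> (s' \<otimes>\<^bsub>F\<^esub> r)" using uv srF s' by (simp add: x y F.m_assoc)
    then have "h (x \<otimes>\<^bsub>F\<^esub> y) = h (u \<otimes>\<^bsub>F\<^esub> v) \<otimes>\<^bsub>D\<^esub> (m s \<otimes>\<^bsub>D\<^esub> m r)"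
      using hs[of "u \<otimes>\<^bsub>F\<^esub> v" "s' \<otimes>\<^bsub>F\<^esub> r"] mm s' sr uv by simp
    moreover have "h x = h u \<otimes>\<^bsub>D\<^esub> m s" "h y = h v \<otimes>\<^bsub>D\<^esub> m r" using hs x y uv sr by auto
    moreover have "\<alpha> (\<psi> x, \<psi> y) = h u \<otimes>\<^bsub>D\<^esub> h v \<otimes>\<^bsub>D\<^esub> inv\<^bsub>D\<^esub> h (u \<otimes>\<^bsub>F\<^esub> v)"
      using xy by (simp add: \<alpha>_def u_def v_def)
    moreover have "h u \<otimes>\<^bsub>D\<^esub> h v \<otimes>\<^bsub>D\<^esub> inv\<^bsub>D\<^esub> h (u \<otimes>\<^bsub>F\<^esub> v) \<otimes>\<^bsub>D\<^esub> (h (u \<otimes>\<^bsub>F\<^esub> v) \<otimes>\<^bsub>D\<^esub> (m s \<otimes>\<^bsub>D\<^esub> m r)) =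
        (inv\<^bsub>D\<^esub> h (u \<otimes>\<^bsub>F\<^esub> v) \<otimes>\<^bsub>D\<^esub> h (u \<otimes>\<^bsub>F\<^esub> v)) \<otimes>\<^bsub>D\<^esub> (h u \<otimes>\<^bsub>D\<^esub> m s \<otimes>\<^bsub>D\<^esub> (h v \<otimes>\<^bsub>D\<^esub> m r))"
      using uv sr hc mc by (simp only: D.m_ac D.inv_closed D.m_closed F.m_closed)
    ultimately show ?thesis using uv sr hc mc by simp
  qed
  have lf: "cocycle_lift F P D \<psi> \<alpha> h"
  proof (rule cocycle_liftI_surj[OF F.is_group P.is_group D.comm_group_axioms psi _ _ _ lift])
    show "h \<in> carrier F \<rightarrow> carrier D" using hc by blast
    show "\<alpha> \<in> extensional (carrier P \<times> carrier P)" by (simp add: \<alpha>_def)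
    show "\<alpha> (x, y) \<in> carrier D" if "x \<in> carrier P" "y \<in> carrier P" for x y
      using that t hc by (simp add: \<alpha>_def)
  qed
  \<comment> \<open>The section may have \<open>t(1) \<noteq> 1\<close>, so \<open>h(1)\<close> can
    be nontrivial; the normalisation in \<mu> removes it.\<close>
  moreover have "cocycle_lift.\<mu> F D h s = m s" if "s \<in> K" for s
    using cocycle_lift.\<mu>_def[OF lf, of s] hs[of "\<one>\<^bsub>F\<^esub>" s] that hc[of "\<one>\<^bsub>F\<^esub>"] mc[OF that]
    by (simp add: D.m_ac D.m_assoc[symmetric])
  ultimately show ?thesis unfolding K_def by blast
qed

subsection \<open>Restriction to abelian subgroups\<close>

text \<open>The double centraliser of two commuting elements is abelian.\<close>

lemma (in group) commuting_pair_subgroup: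
  assumes a: "a \<in> carrier G" and b: "b \<in> carrier G" and ab: "a \<otimes> b = b \<otimes> a"
  shows "\<exists>A. subgroup A G \<and> comm_group (G\<lparr>carrier := A\<rparr>) \<and> a \<in> A \<and> b \<in> A"
proof -
  define C where "C = {w \<in> carrier G. w \<otimes> a = a \<otimes> w \<and> w \<otimes> b = b \<otimes> w}"
  define A where "A = {z \<in> carrier G. \<forall>w\<in>C. z \<otimes> w = w \<otimes> z}"
  have Cc: "w \<in> carrier G" if "w \<in> C" for w using that by (simp add: C_def)
  have abC: "a \<in> C" "b \<in> C" using a b ab by (simp_all add: C_def)
  have aA: "a \<in> A" "b \<in> A" using a b by (auto simp: A_def C_def)
  \<comment> \<open>As \<open>a\<close> and \<open>b\<close> belong to \<open>C\<close>, whatever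
    commutes with \<open>C\<close> commutes with them and so lies in \<open>C\<close> itself; this
    makes \<open>A\<close> abelian.\<close>
  have AC: "z \<in> C" if "z \<in> A" for z using that abC by (simp add: A_def C_def)
  have A: "subgroup A G"
  proof (rule subgroupI)
    show "A \<subseteq> carrier G" by (auto simp: A_def)
    show "A \<noteq> {}" using aA by blast
    show "inv z \<in> A" if z: "z \<in> A" for z
    proof -
      have zc: "z \<in> carrier G" using z by (simp add: A_def)
      have "inv z \<otimes> w = w \<otimes> inv z" if w: "w \<in> C" for w
      proof -
        have e: "z \<otimes> w = w \<otimes> z" using z w by (simp add: A_def)
        have "inv z \<otimes> w = inv z \<otimes> (w \<otimes> z) \<otimes> inv z" using zc Cc[OF w] by (simp add: m_assoc)
        also have "\<dots> = w \<otimes> inv z" using zc Cc[OF w] by (simp add: e[symmetric] m_assoc[symmetric])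
        finally show ?thesis .
      qed
      then show ?thesis using zc by (simp add: A_def)
    qed
    show "y \<otimes> z \<in> A" if yz: "y \<in> A" "z \<in> A" for y z
    proof -
      have yzc: "y \<in> carrier G" "z \<in> carrier G" using yz by (simp_all add: A_def)
      have "y \<otimes> z \<otimes> w = w \<otimes> (y \<otimes> z)" if w: "w \<in> C" for w
      proof -
        have e: "y \<otimes> w = w \<otimes> y" "z \<otimes> w = w \<otimes> z" using yz w by (simp_all add: A_def)
        have "y \<otimes> z \<otimes> w = y \<otimes> w \<otimes> z" using yzc Cc[OF w] e(2) by (simp add: m_assoc)
        also have "\<dots> = w \<otimes> (y \<otimes> z)" using yzc Cc[OF w] e(1) by (simp add: m_assoc)
        finally show ?thesis .
      qed
      then show ?thesis using yzc by (simp add: A_def)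
    qed
  qed
  have "comm_group (G\<lparr>carrier := A\<rparr>)"
  proof (rule group.group_comm_groupI[OF subgroup_imp_group[OF A]])
    fix x y assume "x \<in> carrier (G\<lparr>carrier := A\<rparr>)" "y \<in> carrier (G\<lparr>carrier := A\<rparr>)"
    then have "x \<in> A" "y \<in> C" using AC by simp_all
    then show "x \<otimes>\<^bsub>G\<lparr>carrier := A\<rparr>\<^esub> y = y \<otimes>\<^bsub>G\<lparr>carrier := A\<rparr>\<^esub> x" by (simp add: A_def)
  qed
  then show ?thesis using A aA by blast
qed

text \<open>The conjugate \<open>x h x^-1\<close> is the product of the commutator
  \<open>[x^-1, h^-1]\<close> and \<open>h\<close>.\<close>

lemma (in group) subgroup_containing_commutators_normal:
  assumes C: "subgroup C G" and sub: "commutators G \<subseteq> C"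
  shows "C \<lhd> G"
proof -
  have "x \<otimes> h \<otimes> inv x \<in> C" if x: "x \<in> carrier G" and h: "h \<in> C" for x h
  proof -
    have hc: "h \<in> carrier G" by (rule subgroup.mem_carrier[OF C h])
    have "inv (inv x) \<otimes> inv (inv h) \<otimes> inv x \<otimes> inv h \<in> commutators G"
      unfolding commutators_def using inv_closed[OF x] inv_closed[OF hc] by blast
    then have "inv (inv x) \<otimes> inv (inv h) \<otimes> inv x \<otimes> inv h \<otimes> h \<in> C"
      using subgroup.m_closed[OF C _ h] sub by blast
    then show ?thesis using x hc by (simp add: m_assoc)
  qed
  then show ?thesis using C by (simp add: normal_inv_iff)
qed

lemma (in group) commutators_subgroup:
  assumes H: "subgroup H G"
  shows "commutators (G\<lparr>carrier := H\<rparr>) \<subseteq> commutators G \<inter> H"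
proof
  fix c assume "c \<in> commutators (G\<lparr>carrier := H\<rparr>)"
  then obtain x y where xy: "x \<in> H" "y \<in> H"
    and c: "c = inv\<^bsub>G\<lparr>carrier := H\<rparr>\<^esub> x \<otimes> inv\<^bsub>G\<lparr>carrier := H\<rparr>\<^esub> y \<otimes> x \<otimes> y"
    by (auto simp: commutators_def)
  have c': "c = inv x \<otimes> inv y \<otimes> x \<otimes> y" using c xy m_inv_consistent[OF H] by simp
  have "c \<in> H" using xy H by (simp add: c' subgroup.m_closed subgroup.m_inv_closed)
  moreover have "c \<in> commutators G"
    using c' xy subgroup.mem_carrier[OF H] unfolding commutators_def by blast
  ultimately show "c \<in> commutators G \<inter> H" by blast
qed

context cocycle_lift
begin

lemma preimage_subgroup:
  assumes A: "subgroup A P"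
  shows "subgroup {x \<in> carrier F. \<psi> x \<in> A} F"
proof (rule F.subgroupI)
  show "{x \<in> carrier F. \<psi> x \<in> A} \<noteq> {}" using subgroup.one_closed[OF A] by (auto intro!: exI[of _ "\<one>\<^bsub>F\<^esub>"])
qed (use A in \<open>auto simp: subgroup.m_closed subgroup.m_inv_closed\<close>)

text \<open>Neither \<open>h\<close> nor its lifting equation changes on the preimage of
  \<open>A\<close>, so the coboundary criterion becomes available for the restriction of \<alpha> to
  \<open>A\<close>.\<close>

lemma restrict:
  assumes A: "subgroup A P"
  shows "cocycle_lift (F\<lparr>carrier := {x \<in> carrier F. \<psi> x \<in> A}\<rparr>) (P\<lparr>carrier := A\<rparr>) D \<psi>
    (pullback2 (P\<lparr>carrier := A\<rparr>) (\<lambda>x. x) \<alpha>) h"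
proof -
  have PA: "group (P\<lparr>carrier := A\<rparr>)" by (rule P.subgroup_imp_group[OF A])
  have "(\<lambda>x. x) \<in> hom (P\<lparr>carrier := A\<rparr>) P" using subgroup.mem_carrier[OF A] by (auto simp: hom_def)
  then have "pullback2 (P\<lparr>carrier := A\<rparr>) (\<lambda>x. x) \<alpha> \<in> carrier (cocycles2 (P\<lparr>carrier := A\<rparr>) D)"
    using cohomology2 cocycle PA D.comm_group_axioms
    by (intro pullback2_cocycle) (auto simp: cohomology2_def)
  then show ?thesis
    using PA F.subgroup_imp_group[OF preimage_subgroup[OF A]] D.comm_group_axioms lift
    by (intro cocycle_lift.intro cocycle_lift_axioms.intro) (auto simp: hom_def pullback2_def)
qed

text \<open>If the commutator of \<open>x\<close> and \<open>y\<close> lies in the kernel, their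
  images commute and lie in a common abelian subgroup. A coboundary on an abelian group is
  symmetric, so \<alpha> is symmetric at this pair and \<open>h(xy) = h(yx)\<close>.\<close>

lemma mu_commutator_trivial_if_res_trivial:
  assumes res: "\<And>A. subgroup A P \<Longrightarrow> comm_group (P\<lparr>carrier := A\<rparr>) \<Longrightarrow>
      pullback2 (P\<lparr>carrier := A\<rparr>) (\<lambda>x. x) \<alpha> \<in> coboundaries2 (P\<lparr>carrier := A\<rparr>) D"
    and c: "c \<in> commutators F" "c \<in> kernel F P \<psi>"
  shows "\<mu> c = \<one>\<^bsub>D\<^esub>"
proof -
  obtain x y where xy: "x \<in> carrier F" "y \<in> carrier F"
    and c_eq: "c = inv\<^bsub>F\<^esub> x \<otimes>\<^bsub>F\<^esub> inv\<^bsub>F\<^esub> y \<otimes>\<^bsub>F\<^esub> x \<otimes>\<^bsub>F\<^esub> y"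
    using c(1) unfolding commutators_def by blast
  have cF: "c \<in> carrier F" "\<psi> c = \<one>\<^bsub>P\<^esub>" using kernelD[OF c(2)] by auto
  have "x \<otimes>\<^bsub>F\<^esub> y = y \<otimes>\<^bsub>F\<^esub> x \<otimes>\<^bsub>F\<^esub> c" using F.commutator_eq[OF xy] c_eq by simp
  then have "\<psi> (x \<otimes>\<^bsub>F\<^esub> y) = \<psi> (y \<otimes>\<^bsub>F\<^esub> x \<otimes>\<^bsub>F\<^esub> c)" by simp
  then have comm: "\<psi> x \<otimes>\<^bsub>P\<^esub> \<psi> y = \<psi> y \<otimes>\<^bsub>P\<^esub> \<psi> x" using xy cF by simp
  obtain A where A: "subgroup A P" "comm_group (P\<lparr>carrier := A\<rparr>)" "\<psi> x \<in> A" "\<psi> y \<in> A"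
    using P.commuting_pair_subgroup[OF psi_closed[OF xy(1)] psi_closed[OF xy(2)] comm] by blast
  obtain k where k: "k \<in> A \<rightarrow> carrier D"
    and "pullback2 (P\<lparr>carrier := A\<rparr>) (\<lambda>x. x) \<alpha> = coboundary2 (P\<lparr>carrier := A\<rparr>) D k"
    using res[OF A(1,2)] by (auto simp: coboundaries2_def)
  then have k_eq: "pullback2 (P\<lparr>carrier := A\<rparr>) (\<lambda>x. x) \<alpha> (p, q) = coboundary2 (P\<lparr>carrier := A\<rparr>) D k (p, q)"
    for p q by simp
  have kc: "k (\<psi> x) \<in> carrier D" "k (\<psi> y) \<in> carrier D" using k A by auto
  have sym: "\<alpha> (\<psi> x, \<psi> y) = \<alpha> (\<psi> y, \<psi> x)"
    using k_eq[of "\<psi> x" "\<psi> y"] k_eq[of "\<psi> y" "\<psi> x"] A comm kc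
    by (simp add: pullback2_def coboundary2_def D.m_comm[of "k (\<psi> x)"])
  have "\<alpha> (\<psi> x, \<psi> y) \<otimes>\<^bsub>D\<^esub> h (x \<otimes>\<^bsub>F\<^esub> y) = \<alpha> (\<psi> x, \<psi> y) \<otimes>\<^bsub>D\<^esub> h (y \<otimes>\<^bsub>F\<^esub> x)"
    using lift[OF xy] lift[OF xy(2,1)] sym xy by (simp add: D.m_comm[of "h x"])
  then have "h (x \<otimes>\<^bsub>F\<^esub> y) = h (y \<otimes>\<^bsub>F\<^esub> x)" using xy alpha_closed[OF xy] by simp
  moreover have "h (x \<otimes>\<^bsub>F\<^esub> y) = h (y \<otimes>\<^bsub>F\<^esub> x) \<otimes>\<^bsub>D\<^esub> \<mu> c"
    using mu_commutator[OF xy] c(2) by (simp add: c_eq)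
  ultimately show ?thesis using xy cF by simp
qed

text \<open>Let \<open>B\<close> be the preimage of \<open>A\<close>. Since \<open>A\<close> is
  abelian, the commutators of \<open>B\<close> lie in the kernel, so \<mu> is trivial on them and
  hence on the derived subgroup of \<open>B\<close>. The coboundary criterion for the lift
  restricted to \<open>B\<close> then applies.\<close>

lemma res_trivial_if_mu_commutator_trivial:
  assumes D: "divisible D" and surj: "\<psi> ` carrier F = carrier P"
    and triv: "\<And>c. c \<in> commutators F \<Longrightarrow> c \<in> kernel F P \<psi> \<Longrightarrow> \<mu> c = \<one>\<^bsub>D\<^esub>"
    and A: "subgroup A P" "comm_group (P\<lparr>carrier := A\<rparr>)"
  shows "pullback2 (P\<lparr>carrier := A\<rparr>) (\<lambda>x. x) \<alpha> \<in> coboundaries2 (P\<lparr>carrier := A\<rparr>) D"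
proof -
  define B where "B = {x \<in> carrier F. \<psi> x \<in> A}"
  have B: "subgroup B F" unfolding B_def by (rule preimage_subgroup[OF A(1)])
  interpret res: cocycle_lift "F\<lparr>carrier := B\<rparr>" "P\<lparr>carrier := A\<rparr>" D \<psi>
      "pullback2 (P\<lparr>carrier := A\<rparr>) (\<lambda>x. x) \<alpha>" h
    unfolding B_def by (rule restrict[OF A(1)])
  have mu: "res.\<mu> = \<mu>" by (simp add: fun_eq_iff res.\<mu>_def \<mu>_def)
  \<comment> \<open>The preimage of a subgroup contains the whole kernel of \<psi>, so restricting
    to \<open>B\<close> leaves the domain of \<mu> unchanged.\<close>
  have ker: "kernel (F\<lparr>carrier := B\<rparr>) (P\<lparr>carrier := A\<rparr>) \<psi> = kernel F P \<psi>"
    using subgroup.one_closed[OF A(1)] by (auto simp: kernel_def B_def)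
  have com: "commutators (F\<lparr>carrier := B\<rparr>) \<subseteq> kernel F P \<psi>"
  proof
    fix c assume c: "c \<in> commutators (F\<lparr>carrier := B\<rparr>)"
    then have "c \<in> derived (F\<lparr>carrier := B\<rparr>) (carrier (F\<lparr>carrier := B\<rparr>))"
      using res.F.commutators_subset_derived by blast
    then have "\<psi> c = \<one>\<^bsub>P\<^esub>"
      using hom_trivial_on_derived[OF res.F.is_group A(2) res.psi] by simp
    then show "c \<in> kernel F P \<psi>" using c F.commutators_subgroup[OF B] F.commutators_closed by (auto simp: kernel_def)
  qed
  show ?thesis
  proof (rule res.coboundary_if_mu_trivial[OF D])
    show "\<psi> ` carrier (F\<lparr>carrier := B\<rparr>) = carrier (P\<lparr>carrier := A\<rparr>)"
    proof
      show "carrier (P\<lparr>carrier := A\<rparr>) \<subseteq> \<psi> ` carrier (F\<lparr>carrier := B\<rparr>)"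
      proof
        fix a assume "a \<in> carrier (P\<lparr>carrier := A\<rparr>)"
        then have "a \<in> A" "a \<in> \<psi> ` carrier F" using subgroup.mem_carrier[OF A(1)] surj by auto
        then show "a \<in> \<psi> ` carrier (F\<lparr>carrier := B\<rparr>)" by (auto simp: B_def)
      qed
    qed (auto simp: B_def)
    fix x assume "x \<in> derived (F\<lparr>carrier := B\<rparr>) (carrier (F\<lparr>carrier := B\<rparr>))"
    then have "x \<in> generate (F\<lparr>carrier := B\<rparr>) (commutators (F\<lparr>carrier := B\<rparr>))"
      unfolding res.F.derived_eq_generate_commutators .
    then show "res.\<mu> x = \<one>\<^bsub>D\<^esub>"
    proof (rule res.mu_trivial_on_generate[rotated 2])
      show "commutators (F\<lparr>carrier := B\<rparr>) \<subseteq> kernel (F\<lparr>carrier := B\<rparr>) (P\<lparr>carrier := A\<rparr>) \<psi>"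
        using com ker by simp
      show "res.\<mu> c = \<one>\<^bsub>D\<^esub>" if "c \<in> commutators (F\<lparr>carrier := B\<rparr>)" for c
        using that com F.commutators_subgroup[OF B] triv mu by auto
    qed
  qed
qed

end

subsection \<open>The group \<open>\<rat>/\<int>\<close>\<close>

lemma rat_group_comm_group: "comm_group rat_group"
  by (rule comm_groupI) (auto simp: rat_group_def intro: exI[of _ "- x" for x])

lemma Ints_normal_rat_group: "\<int> \<lhd> rat_group"
proof -
  interpret comm_group rat_group by (rule rat_group_comm_group)
  have inv: "inv\<^bsub>rat_group\<^esub> x = - x" for x by (rule inv_equality) (auto simp: rat_group_def)
  have "subgroup \<int> rat_group"
    by (rule subgroupI) (auto simp: inv, auto simp: rat_group_def)
  then show ?thesis by (rule subgroup_imp_normal)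
qed

lemma QmodZ_comm_group: "comm_group QmodZ"
  unfolding QmodZ_def
  by (rule comm_group.abelian_FactGroup[OF rat_group_comm_group normal.axioms(1)[OF Ints_normal_rat_group]])

lemma QmodZ_carrier: "carrier QmodZ = range (\<lambda>q. \<int> #>\<^bsub>rat_group\<^esub> q)"
  by (auto simp: QmodZ_def FactGroup_def RCOSETS_def rat_group_def)

lemma QmodZ_pow: "(\<int> #>\<^bsub>rat_group\<^esub> q) [^]\<^bsub>QmodZ\<^esub> (n::nat) = \<int> #>\<^bsub>rat_group\<^esub> (of_nat n * q)"
proof (induction n)
  case 0
  interpret comm_group rat_group by (rule rat_group_comm_group)
  interpret normal \<int> rat_group by (rule Ints_normal_rat_group)
  have "\<one>\<^bsub>QmodZ\<^esub> = \<int> #>\<^bsub>rat_group\<^esub> \<one>\<^bsub>rat_group\<^esub>" using coset_mult_one[OF subset] by (simp add: QmodZ_def FactGroup_def)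
  then show ?case by (simp add: rat_group_def nat_pow_def)
next
  case (Suc n)
  interpret normal \<int> rat_group by (rule Ints_normal_rat_group)
  have "(\<int> #>\<^bsub>rat_group\<^esub> (of_nat n * q)) \<otimes>\<^bsub>QmodZ\<^esub> (\<int> #>\<^bsub>rat_group\<^esub> q) =
      \<int> #>\<^bsub>rat_group\<^esub> (of_nat n * q \<otimes>\<^bsub>rat_group\<^esub> q)"
    using rcos_sum[of "of_nat n * q" q] by (simp add: QmodZ_def FactGroup_def rat_group_def)
  then show ?case using Suc by (simp add: nat_pow_def rat_group_def algebra_simps)
qed

lemma QmodZ_eq_one_iff: "\<int> #>\<^bsub>rat_group\<^esub> q = \<one>\<^bsub>QmodZ\<^esub> \<longleftrightarrow> q \<in> \<int>"
proof -
  interpret comm_group rat_group by (rule rat_group_comm_group)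
  interpret normal \<int> rat_group by (rule Ints_normal_rat_group)
  have "q \<in> carrier rat_group" by (simp add: rat_group_def)
  then show ?thesis
    using coset_join1[OF _ _ subgroup_axioms, of q] coset_join2[OF _ subgroup_axioms, of q]
    by (auto simp: QmodZ_def FactGroup_def)
qed

lemma QmodZ_divisible: "divisible QmodZ"
  unfolding divisible_def
proof (intro ballI allI impI)
  fix a and n :: nat assume "a \<in> carrier QmodZ" and n: "0 < n"
  then obtain q where "a = \<int> #>\<^bsub>rat_group\<^esub> q" by (auto simp: QmodZ_carrier)
  then have "(\<int> #>\<^bsub>rat_group\<^esub> (q / of_nat n)) [^]\<^bsub>QmodZ\<^esub> n = a" using n by (simp add: QmodZ_pow)
  then show "\<exists>b\<in>carrier QmodZ. b [^]\<^bsub>QmodZ\<^esub> n = a" unfolding QmodZ_carrier by blast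
qed

lemma QmodZ_torsion:
  assumes "n \<noteq> (1::nat)"
  shows "\<exists>d\<in>carrier QmodZ. d \<noteq> \<one>\<^bsub>QmodZ\<^esub> \<and> d [^]\<^bsub>QmodZ\<^esub> n = \<one>\<^bsub>QmodZ\<^esub>"
proof -
  have "\<exists>q::rat. q \<notin> \<int> \<and> of_nat n * q \<in> \<int>"
  proof -
    \<comment> \<open>The class of 1/n has order \<open>n\<close>. For \<open>n = 0\<close> every
      element satisfies the condition on powers, and 1/2 serves as a noninteger.\<close>
    define k where "k = (if n = 0 then 2 else n)"
    have k: "k \<ge> 2" using assms by (simp add: k_def)
    have "1 / rat_of_nat k \<notin> \<int>"
    proof
      assume "1 / rat_of_nat k \<in> \<int>"
      then obtain i :: int where "1 / rat_of_nat k = of_int i" by (auto elim: Ints_cases)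
      moreover have "0 < 1 / rat_of_nat k" "1 / rat_of_nat k < 1" using k by auto
      ultimately show False by simp
    qed
    moreover have "of_nat n * (1 / rat_of_nat k) \<in> \<int>" using assms by (simp add: k_def)
    ultimately show ?thesis by blast
  qed
  then obtain q :: rat where "q \<notin> \<int>" "of_nat n * q \<in> \<int>" by blast
  then show ?thesis
    by (intro bexI[of _ "\<int> #>\<^bsub>rat_group\<^esub> q"]) (auto simp: QmodZ_eq_one_iff QmodZ_pow QmodZ_carrier)
qed

subsection \<open>Bogomolov multipliers and inflation\<close>

lemma cohomology2_QmodZ: "group G \<Longrightarrow> cohomology2 G QmodZ"
  by (simp add: cohomology2_def QmodZ_comm_group)

lemma B0_simps:
  "mult (B0 G) = mult (H2 G QmodZ)" "one (B0 G) = one (H2 G QmodZ)"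
  by (simp_all add: B0_def)

lemma class2_in_B0_iff:
  assumes G: "group G" and f: "f \<in> carrier (cocycles2 G QmodZ)"
  shows "cohomology2.class2 G QmodZ f \<in> carrier (B0 G) \<longleftrightarrow>
    (\<forall>A. subgroup A G \<longrightarrow> comm_group (G\<lparr>carrier := A\<rparr>) \<longrightarrow>
      pullback2 (G\<lparr>carrier := A\<rparr>) (\<lambda>x. x) f \<in> coboundaries2 (G\<lparr>carrier := A\<rparr>) QmodZ)"
proof -
  interpret G: cohomology2 G QmodZ by (rule cohomology2_QmodZ[OF G])
  have "G.class2 f \<in> kernel (H2 G QmodZ) (H2 (G\<lparr>carrier := A\<rparr>) QmodZ) (res2 G QmodZ A) \<longleftrightarrow>
      pullback2 (G\<lparr>carrier := A\<rparr>) (\<lambda>x. x) f \<in> coboundaries2 (G\<lparr>carrier := A\<rparr>) QmodZ"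
    if A: "subgroup A G" for A
  proof -
    interpret A: cohomology2 "G\<lparr>carrier := A\<rparr>" QmodZ
      by (rule cohomology2_QmodZ[OF G.G.subgroup_imp_group[OF A]])
    have hom: "(\<lambda>x. x) \<in> hom (G\<lparr>carrier := A\<rparr>) G" using subgroup.mem_carrier[OF A] by (auto simp: hom_def)
    note pf = pullback2_cocycle[OF G.cohomology2_axioms A.cohomology2_axioms hom f]
    show ?thesis
      using f A.class2_eq_one_iff[OF pf]
      by (simp add: kernel_def res2_def G.H2_carrier
          H2_map_class2[OF G.cohomology2_axioms A.cohomology2_axioms hom f])
  qed
  then show ?thesis by (auto simp: B0_def)
qed

text \<open>The carrier of \<open>B0\<close> is an intersection of kernels, so membership in second
  cohomology has to be read off from one of them; the trivial subgroup is always available.\<close>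

lemma B0_class2:
  assumes G: "group G" and c: "c \<in> carrier (B0 G)"
  shows "\<exists>f\<in>carrier (cocycles2 G QmodZ). c = cohomology2.class2 G QmodZ f"
proof -
  interpret G: cohomology2 G QmodZ by (rule cohomology2_QmodZ[OF G])
  have A: "subgroup {\<one>\<^bsub>G\<^esub>} G" by (rule G.G.triv_subgroup)
  have "comm_group (G\<lparr>carrier := {\<one>\<^bsub>G\<^esub>}\<rparr>)"
    by (rule group.group_comm_groupI[OF G.G.subgroup_imp_group[OF A]]) simp
  then have "c \<in> carrier (H2 G QmodZ)" using c A by (auto simp: B0_def kernel_def)
  then show ?thesis by (auto simp: G.H2_carrier)
qed

lemma B0_lift:
  assumes F: "free_group F" and P: "group P" and psi: "\<psi> \<in> hom F P" and c: "c \<in> carrier (B0 P)"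
  shows "\<exists>\<alpha> h. cocycle_lift F P QmodZ \<psi> \<alpha> h \<and> c = cohomology2.class2 P QmodZ \<alpha> \<and>
    (\<forall>x\<in>commutators F \<inter> kernel F P \<psi>. cocycle_lift.\<mu> F QmodZ h x = \<one>\<^bsub>QmodZ\<^esub>)"
proof -
  obtain \<alpha> where \<alpha>: "\<alpha> \<in> carrier (cocycles2 P QmodZ)" "c = cohomology2.class2 P QmodZ \<alpha>"
    using B0_class2[OF P c] by blast
  obtain h where lf: "cocycle_lift F P QmodZ \<psi> \<alpha> h"
    using free_group_lift_exists[OF F P QmodZ_comm_group psi \<alpha>(1)] by blast
  interpret cocycle_lift F P QmodZ \<psi> \<alpha> h by (rule lf)
  have "\<mu> x = \<one>\<^bsub>QmodZ\<^esub>" if "x \<in> commutators F" "x \<in> kernel F P \<psi>" for x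
    using c that unfolding \<alpha>(2) class2_in_B0_iff[OF P \<alpha>(1)]
    by (intro mu_commutator_trivial_if_res_trivial) blast+
  then show ?thesis using lf \<alpha>(2) by blast
qed

lemma lift_class2_in_B0:
  assumes lf: "cocycle_lift F P QmodZ \<psi> \<alpha> h" and surj: "\<psi> ` carrier F = carrier P"
    and triv: "\<And>x. x \<in> commutators F \<Longrightarrow> x \<in> kernel F P \<psi> \<Longrightarrow> cocycle_lift.\<mu> F QmodZ h x = \<one>\<^bsub>QmodZ\<^esub>"
  shows "cohomology2.class2 P QmodZ \<alpha> \<in> carrier (B0 P)"
proof -
  interpret cocycle_lift F P QmodZ \<psi> \<alpha> h by (rule lf)
  show ?thesis
    unfolding class2_in_B0_iff[OF P.is_group cocycle]
    using res_trivial_if_mu_commutator_trivial[OF QmodZ_divisible surj triv] by blast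
qed

text \<open>Invariance of \<open>m\<close> under conjugation comes for free:
  \<open>x^-1 s x = s [s, x]\<close>, the commutator lies in the kernel along with \<open>s\<close>,
  and \<open>m\<close> is trivial on it.\<close>

lemma B0_of_hom:
  assumes F: "group F" and P: "group P" and psi: "\<psi> \<in> epi F P"
    and m: "m \<in> hom (F\<lparr>carrier := kernel F P \<psi>\<rparr>) QmodZ"
    and triv: "\<And>x. x \<in> commutators F \<Longrightarrow> x \<in> kernel F P \<psi> \<Longrightarrow> m x = \<one>\<^bsub>QmodZ\<^esub>"
  shows "\<exists>\<alpha> h. cocycle_lift F P QmodZ \<psi> \<alpha> h \<and> cohomology2.class2 P QmodZ \<alpha> \<in> carrier (B0 P) \<and>
    (\<forall>x\<in>kernel F P \<psi>. cocycle_lift.\<mu> F QmodZ h x = m x)"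
proof -
  interpret F: group F by (rule F)
  interpret D: comm_group QmodZ by (rule QmodZ_comm_group)
  have hom: "\<psi> \<in> hom F P" and surj: "\<psi> ` carrier F = carrier P" using psi by (auto simp: epi_def)
  interpret psi: group_hom F P \<psi> using hom F P by (simp add: group_hom_def group_hom_axioms_def)
  have mc: "m x \<in> carrier QmodZ" if "x \<in> kernel F P \<psi>" for x using m that by (auto simp: hom_def)
  have inv: "m (inv\<^bsub>F\<^esub> x \<otimes>\<^bsub>F\<^esub> s \<otimes>\<^bsub>F\<^esub> x) = m s" if s: "s \<in> kernel F P \<psi>" and x: "x \<in> carrier F" for s x
  proof -
    define c where "c = inv\<^bsub>F\<^esub> s \<otimes>\<^bsub>F\<^esub> inv\<^bsub>F\<^esub> x \<otimes>\<^bsub>F\<^esub> s \<otimes>\<^bsub>F\<^esub> x"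
    have sF: "s \<in> carrier F" "\<psi> s = \<one>\<^bsub>P\<^esub>" using s by (auto simp: kernel_def)
    have cK: "c \<in> kernel F P \<psi>" using sF x by (simp add: c_def kernel_def)
    have "c \<in> commutators F" unfolding commutators_def c_def using sF x by blast
    then have "m c = \<one>\<^bsub>QmodZ\<^esub>" using triv cK by blast
    moreover have "inv\<^bsub>F\<^esub> x \<otimes>\<^bsub>F\<^esub> s \<otimes>\<^bsub>F\<^esub> x = s \<otimes>\<^bsub>F\<^esub> c" using sF x by (simp add: c_def F.m_assoc[symmetric])
    moreover have "m (s \<otimes>\<^bsub>F\<^esub> c) = m s \<otimes>\<^bsub>QmodZ\<^esub> m c" using m s cK by (auto simp: hom_def)
    ultimately show ?thesis using mc[OF s] by simp
  qed
  obtain \<alpha> h where lf: "cocycle_lift F P QmodZ \<psi> \<alpha> h"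
    and mu: "\<And>s. s \<in> kernel F P \<psi> \<Longrightarrow> cocycle_lift.\<mu> F QmodZ h s = m s"
    using cocycle_lift_of_hom[OF F P QmodZ_comm_group psi m inv] by blast
  have "cohomology2.class2 P QmodZ \<alpha> \<in> carrier (B0 P)"
    using lift_class2_in_B0[OF lf surj] mu triv by simp
  then show ?thesis using lf mu by blast
qed

lemma lift_class2_eq_one_iff:
  assumes lf: "cocycle_lift F P QmodZ \<psi> \<alpha> h" and surj: "\<psi> ` carrier F = carrier P"
  shows "cohomology2.class2 P QmodZ \<alpha> = \<one>\<^bsub>H2 P QmodZ\<^esub> \<longleftrightarrow>
    (\<forall>x\<in>kernel F P \<psi> \<inter> derived F (carrier F). cocycle_lift.\<mu> F QmodZ h x = \<one>\<^bsub>QmodZ\<^esub>)"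
proof -
  interpret cocycle_lift F P QmodZ \<psi> \<alpha> h by (rule lf)
  show ?thesis
    unfolding cohomology2.class2_eq_one_iff[OF cohomology2 cocycle]
    using mu_trivial_if_coboundary coboundary_if_mu_trivial[OF QmodZ_divisible surj] by blast
qed

text \<open>The quotient of \<open>h\<close> by \<open>k\<close> lifts the quotient of \<alpha> by
  \<beta>, and its normalised function is the quotient of the two given ones. This reduces the
  comparison to the criterion for the trivial class.\<close>

lemma lift_class2_eq_iff:
  assumes lf: "cocycle_lift F P QmodZ \<psi> \<alpha> h" and lf': "cocycle_lift F P QmodZ \<psi> \<beta> k"
    and surj: "\<psi> ` carrier F = carrier P"
  shows "cohomology2.class2 P QmodZ \<alpha> = cohomology2.class2 P QmodZ \<beta> \<longleftrightarrow>
    (\<forall>x\<in>kernel F P \<psi> \<inter> derived F (carrier F).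
      cocycle_lift.\<mu> F QmodZ h x = cocycle_lift.\<mu> F QmodZ k x)"
proof -
  interpret a: cocycle_lift F P QmodZ \<psi> \<alpha> h by (rule lf)
  interpret b: cocycle_lift F P QmodZ \<psi> \<beta> k by (rule lf')
  interpret P: cohomology2 P QmodZ by (rule a.cohomology2)
  let ?g = "\<alpha> \<otimes>\<^bsub>cocycles2 P QmodZ\<^esub> inv\<^bsub>cocycles2 P QmodZ\<^esub> \<beta>"
  let ?l = "\<lambda>x. h x \<otimes>\<^bsub>QmodZ\<^esub> inv\<^bsub>QmodZ\<^esub> k x"
  have g: "?g \<in> carrier (cocycles2 P QmodZ)" using a.cocycle b.cocycle by simp
  have lfg: "cocycle_lift F P QmodZ \<psi> ?g ?l"
  proof (intro cocycle_lift.intro cocycle_lift_axioms.intro a.F.is_group a.P.is_group QmodZ_comm_group a.psi g)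
    show "?l \<in> carrier F \<rightarrow> carrier QmodZ" by simp
    fix x y assume xy: "x \<in> carrier F" "y \<in> carrier F"
    note al = a.alpha_closed[OF xy] b.alpha_closed[OF xy]
    have "?l x \<otimes>\<^bsub>QmodZ\<^esub> ?l y = (h x \<otimes>\<^bsub>QmodZ\<^esub> h y) \<otimes>\<^bsub>QmodZ\<^esub> inv\<^bsub>QmodZ\<^esub> (k x \<otimes>\<^bsub>QmodZ\<^esub> k y)"
      using xy by (simp add: a.D.inv_mult a.D.m_ac)
    also have "\<dots> = \<alpha> (\<psi> x, \<psi> y) \<otimes>\<^bsub>QmodZ\<^esub> inv\<^bsub>QmodZ\<^esub> \<beta> (\<psi> x, \<psi> y) \<otimes>\<^bsub>QmodZ\<^esub> ?l (x \<otimes>\<^bsub>F\<^esub> y)"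
      using xy al by (simp add: a.lift b.lift a.D.inv_mult a.D.m_ac)
    also have "\<alpha> (\<psi> x, \<psi> y) \<otimes>\<^bsub>QmodZ\<^esub> inv\<^bsub>QmodZ\<^esub> \<beta> (\<psi> x, \<psi> y) = ?g (\<psi> x, \<psi> y)"
      using xy a.psi_closed P.cocycles2_inv[OF b.cocycle] by (simp add: cocycles2_mult)
    finally show "?l x \<otimes>\<^bsub>QmodZ\<^esub> ?l y = ?g (\<psi> x, \<psi> y) \<otimes>\<^bsub>QmodZ\<^esub> ?l (x \<otimes>\<^bsub>F\<^esub> y)" .
  qed
  have mu: "cocycle_lift.\<mu> F QmodZ ?l x = \<one>\<^bsub>QmodZ\<^esub> \<longleftrightarrow> a.\<mu> x = b.\<mu> x" if x: "x \<in> carrier F" for x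
  proof -
    have "cocycle_lift.\<mu> F QmodZ ?l x = a.\<mu> x \<otimes>\<^bsub>QmodZ\<^esub> inv\<^bsub>QmodZ\<^esub> b.\<mu> x"
      using x by (simp add: cocycle_lift.\<mu>_def[OF lfg] a.\<mu>_def b.\<mu>_def a.D.inv_mult a.D.m_ac)
    moreover have "a.\<mu> x \<otimes>\<^bsub>QmodZ\<^esub> inv\<^bsub>QmodZ\<^esub> b.\<mu> x = \<one>\<^bsub>QmodZ\<^esub> \<longleftrightarrow> a.\<mu> x = b.\<mu> x"
      using a.D.inv_solve_right'[of "\<one>\<^bsub>QmodZ\<^esub>" "a.\<mu> x" "b.\<mu> x"] x by auto
    ultimately show ?thesis by simp
  qed
  have "P.class2 \<alpha> = P.class2 \<beta> \<longleftrightarrow> P.class2 ?g = \<one>\<^bsub>H2 P QmodZ\<^esub>"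
    using P.class2_eq_iff[OF a.cocycle b.cocycle] P.class2_eq_one_iff[OF g] by simp
  also have "\<dots> \<longleftrightarrow> (\<forall>x\<in>kernel F P \<psi> \<inter> derived F (carrier F). a.\<mu> x = b.\<mu> x)"
    unfolding lift_class2_eq_one_iff[OF lfg surj] using mu by (auto simp: kernel_def)
  finally show ?thesis .
qed

section \<open>Inflation along surjections F -> G -> Q with F free\<close>

locale inflation = F: group F + G: group G + Q: group Q
  for F :: "('a, 'b) monoid_scheme" and G :: "('g, 'u) monoid_scheme" and Q :: "('q, 'v) monoid_scheme"
    and \<pi> :: "'a \<Rightarrow> 'g" and \<phi> :: "'g \<Rightarrow> 'q" +
  assumes free: "free_group F"
    and pi: "\<pi> \<in> epi F G"
    and phi: "\<phi> \<in> epi G Q"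
begin

text \<open>Both \<open>G\<close> and \<open>Q\<close> are presented by the same free group, so
  their classes are described by characters of \<open>R\<close> and of \<open>S\<close> that can be
  compared by restriction.\<close>

definition R :: "'a set" where "R = kernel F G \<pi>"
definition S :: "'a set" where "S = kernel F Q (\<phi> \<circ> \<pi>)"

abbreviation KS :: "'a set" where "KS \<equiv> generate F (commutators F \<inter> S)"
abbreviation KR :: "'a set" where "KR \<equiv> generate F (commutators F \<inter> R)"
abbreviation infl :: "('q \<times> 'q \<Rightarrow> rat set) set \<Rightarrow> ('g \<times> 'g \<Rightarrow> rat set) set" where
  "infl \<equiv> H2_map G QmodZ \<phi>"
abbreviation class_G :: "('g \<times> 'g \<Rightarrow> rat set) \<Rightarrow> ('g \<times> 'g \<Rightarrow> rat set) set" where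
  "class_G \<equiv> cohomology2.class2 G QmodZ"
abbreviation class_Q :: "('q \<times> 'q \<Rightarrow> rat set) \<Rightarrow> ('q \<times> 'q \<Rightarrow> rat set) set" where
  "class_Q \<equiv> cohomology2.class2 Q QmodZ"
abbreviation mu :: "('a \<Rightarrow> rat set) \<Rightarrow> 'a \<Rightarrow> rat set" where
  "mu \<equiv> cocycle_lift.\<mu> F QmodZ"

sublocale D: comm_group QmodZ by (rule QmodZ_comm_group)
sublocale pi: group_hom F G \<pi>
  using pi by (simp add: epi_def group_hom_def group_hom_axioms_def F.is_group G.is_group)
sublocale phi: group_hom G Q \<phi>
  using phi by (simp add: epi_def group_hom_def group_hom_axioms_def G.is_group Q.is_group)

lemma pi_surj: "\<pi> ` carrier F = carrier G"
  using pi by (simp add: epi_def)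

lemma phi_hom: "\<phi> \<in> hom G Q"
  using phi by (simp add: epi_def)

lemma psi_epi: "\<phi> \<circ> \<pi> \<in> epi F Q"
proof -
  have "(\<phi> \<circ> \<pi>) ` carrier F = carrier Q"
    using pi phi unfolding epi_def image_comp[symmetric] by simp
  then show ?thesis using hom_compose[OF pi.homh phi.homh] by (simp add: epi_def)
qed

lemma R_normal: "R \<lhd> F"
  unfolding R_def by (rule pi.normal_kernel)

lemma S_normal: "S \<lhd> F"
proof -
  have "group_hom F Q (\<phi> \<circ> \<pi>)"
    using psi_epi by (simp add: epi_def group_hom_def group_hom_axioms_def F.is_group Q.is_group)
  then show ?thesis unfolding S_def by (rule group_hom.normal_kernel)
qed

lemma R_subgroup: "subgroup R F" and S_subgroup: "subgroup S F"
  using R_normal S_normal normal_imp_subgroup by blast+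

lemma R_subset_S: "R \<subseteq> S"
  by (auto simp: R_def S_def kernel_def)

lemma commutator_in_KS: "x \<in> commutators F \<Longrightarrow> x \<in> S \<Longrightarrow> x \<in> KS"
  and commutator_in_KR: "x \<in> commutators F \<Longrightarrow> x \<in> R \<Longrightarrow> x \<in> KR"
  by (auto intro: generate.incl)

lemma KR_subset_R: "KR \<subseteq> R"
  by (rule F.generate_subgroup_incl[OF _ R_subgroup]) auto

lemma KR_subset_KS: "KR \<subseteq> KS"
  using R_subset_S by (intro F.mono_generate) auto

lemma KS_subset_derived: "KS \<subseteq> derived F (carrier F)"
  unfolding F.derived_eq_generate_commutators by (intro F.mono_generate) auto

text \<open>The commutators of \<open>T\<close> are among the commutators of \<open>F\<close> lying
  in \<open>T\<close>, so \<open>T\<close> modulo the subgroup generated by the latter is abelian.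
  This supplies the hypotheses of \<open>hom_extension\<close> and \<open>hom_separation\<close>
  inside \<open>S\<close> and \<open>R\<close>.\<close>

lemma normal_in_subgroup:
  assumes "subgroup T F"
  shows "generate F (commutators F \<inter> T) \<lhd> F\<lparr>carrier := T\<rparr>"
    "commutators (F\<lparr>carrier := T\<rparr>) \<subseteq> generate F (commutators F \<inter> T)"
proof -
  interpret T: group "F\<lparr>carrier := T\<rparr>" by (rule F.subgroup_imp_group[OF assms])
  show com: "commutators (F\<lparr>carrier := T\<rparr>) \<subseteq> generate F (commutators F \<inter> T)"
    using F.commutators_subgroup[OF assms] generate.incl[of _ "commutators F \<inter> T" F] by blast
  have gen: "subgroup (generate F (commutators F \<inter> T)) F"
    using F.commutators_closed by (auto intro!: F.generate_is_subgroup)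
  have "generate F (commutators F \<inter> T) \<subseteq> T"
    by (rule F.generate_subgroup_incl[OF _ assms]) auto
  then have "subgroup (generate F (commutators F \<inter> T)) (F\<lparr>carrier := T\<rparr>)"
    using gen F.subgroup_incl[OF gen assms] by blast
  then show "generate F (commutators F \<inter> T) \<lhd> F\<lparr>carrier := T\<rparr>"
    by (rule T.subgroup_containing_commutators_normal[OF _ com])
qed

lemma infl_class:
  "\<alpha> \<in> carrier (cocycles2 Q QmodZ) \<Longrightarrow> infl (class_Q \<alpha>) = class_G (pullback2 G \<phi> \<alpha>)"
  by (rule H2_map_class2[OF cohomology2_QmodZ[OF Q.is_group] cohomology2_QmodZ[OF G.is_group] phi_hom])

text \<open>The same function \<open>h\<close> lifts a cocycle of \<open>Q\<close> and its inflation: inflation restricts \<open>\<mu>\<close> from \<open>S\<close> to \<open>R\<close>.\<close>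

lemma lift_pullback:
  assumes "cocycle_lift F Q QmodZ (\<phi> \<circ> \<pi>) \<alpha> h"
  shows "cocycle_lift F G QmodZ \<pi> (pullback2 G \<phi> \<alpha>) h"
proof -
  interpret cocycle_lift F Q QmodZ "\<phi> \<circ> \<pi>" \<alpha> h by (rule assms)
  have "pullback2 G \<phi> \<alpha> \<in> carrier (cocycles2 G QmodZ)"
    by (rule pullback2_cocycle[OF cohomology2 cohomology2_QmodZ[OF G.is_group] phi_hom cocycle])
  then show ?thesis
    using h lift pi.homh
    by (intro cocycle_lift.intro cocycle_lift_axioms.intro F.is_group G.is_group QmodZ_comm_group)
      (auto simp: pullback2_def)
qed

lemma B0_Q_lift:
  assumes "c \<in> carrier (B0 Q)"
  shows "\<exists>\<alpha> h. cocycle_lift F Q QmodZ (\<phi> \<circ> \<pi>) \<alpha> h \<and> (\<forall>x\<in>KS. mu h x = \<one>\<^bsub>QmodZ\<^esub>) \<and>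
    infl c = class_G (pullback2 G \<phi> \<alpha>)"
proof -
  have hom: "\<phi> \<circ> \<pi> \<in> hom F Q" using psi_epi by (simp add: epi_def)
  obtain \<alpha> h where lf: "cocycle_lift F Q QmodZ (\<phi> \<circ> \<pi>) \<alpha> h" and c: "c = class_Q \<alpha>"
    and triv: "\<And>x. x \<in> commutators F \<inter> S \<Longrightarrow> mu h x = \<one>\<^bsub>QmodZ\<^esub>"
    using B0_lift[OF free Q.is_group hom assms] unfolding S_def by blast
  interpret cocycle_lift F Q QmodZ "\<phi> \<circ> \<pi>" \<alpha> h by (rule lf)
  have "mu h x = \<one>\<^bsub>QmodZ\<^esub>" if "x \<in> KS" for x
    using mu_trivial_on_generate[OF _ triv that] by (simp add: S_def)
  then show ?thesis using lf c infl_class[OF cocycle] by blast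
qed

lemma B0_G_lift:
  assumes "c \<in> carrier (B0 G)"
  shows "\<exists>\<beta> k. cocycle_lift F G QmodZ \<pi> \<beta> k \<and> c = class_G \<beta> \<and> (\<forall>x\<in>KR. mu k x = \<one>\<^bsub>QmodZ\<^esub>)"
proof -
  obtain \<beta> k where lf: "cocycle_lift F G QmodZ \<pi> \<beta> k" and c: "c = class_G \<beta>"
    and triv: "\<And>x. x \<in> commutators F \<inter> R \<Longrightarrow> mu k x = \<one>\<^bsub>QmodZ\<^esub>"
    using B0_lift[OF free G.is_group pi.homh assms] unfolding R_def by blast
  interpret cocycle_lift F G QmodZ \<pi> \<beta> k by (rule lf)
  have "mu k x = \<one>\<^bsub>QmodZ\<^esub>" if "x \<in> KR" for x
    using mu_trivial_on_generate[OF _ triv that] by (simp add: R_def)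
  then show ?thesis using lf c by blast
qed

text \<open>A class in \<open>B0 Q\<close> has \<mu> trivial on the commutators in \<open>S\<close>,
  hence on those in \<open>R\<close>, so its inflation lands in \<open>B0 G\<close>.\<close>

lemma infl_hom: "infl \<in> hom (B0 Q) (B0 G)"
proof (rule homI)
  fix c assume c: "c \<in> carrier (B0 Q)"
  obtain \<alpha> h where lf: "cocycle_lift F Q QmodZ (\<phi> \<circ> \<pi>) \<alpha> h"
    and triv: "\<And>x. x \<in> KS \<Longrightarrow> mu h x = \<one>\<^bsub>QmodZ\<^esub>" and inf: "infl c = class_G (pullback2 G \<phi> \<alpha>)"
    using B0_Q_lift[OF c] by blast
  show "infl c \<in> carrier (B0 G)"
    unfolding inf
  proof (rule lift_class2_in_B0[OF lift_pullback[OF lf] pi_surj])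
    fix x assume "x \<in> commutators F" "x \<in> kernel F G \<pi>"
    then have "x \<in> commutators F \<inter> S" using R_subset_S by (auto simp: R_def)
    then show "mu h x = \<one>\<^bsub>QmodZ\<^esub>" by (intro triv generate.incl)
  qed
next
  fix c d assume c: "c \<in> carrier (B0 Q)" and d: "d \<in> carrier (B0 Q)"
  obtain \<alpha> where \<alpha>: "\<alpha> \<in> carrier (cocycles2 Q QmodZ)" "c = class_Q \<alpha>" using B0_class2[OF Q.is_group c] by blast
  obtain \<beta> where \<beta>: "\<beta> \<in> carrier (cocycles2 Q QmodZ)" "d = class_Q \<beta>" using B0_class2[OF Q.is_group d] by blast
  interpret Q': cohomology2 Q QmodZ by (rule cohomology2_QmodZ[OF Q.is_group])
  interpret G': cohomology2 G QmodZ by (rule cohomology2_QmodZ[OF G.is_group])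
  have pb: "pullback2 G \<phi> \<alpha> \<in> carrier (cocycles2 G QmodZ)" "pullback2 G \<phi> \<beta> \<in> carrier (cocycles2 G QmodZ)"
    by (rule pullback2_cocycle[OF Q'.cohomology2_axioms G'.cohomology2_axioms phi_hom], fact)+
  have "infl (c \<otimes>\<^bsub>B0 Q\<^esub> d) = class_G (pullback2 G \<phi> (\<alpha> \<otimes>\<^bsub>cocycles2 Q QmodZ\<^esub> \<beta>))"
    using \<alpha> \<beta> by (simp add: B0_simps Q'.H2_mult infl_class)
  also have "\<dots> = infl c \<otimes>\<^bsub>B0 G\<^esub> infl d"
    using \<alpha> \<beta> pb by (simp add: B0_simps G'.H2_mult infl_class pullback2_mult[OF phi_hom])
  finally show "infl (c \<otimes>\<^bsub>B0 Q\<^esub> d) = infl c \<otimes>\<^bsub>B0 G\<^esub> infl d" .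
qed

text \<open>Classes of \<open>B0 Q\<close> come from characters of \<open>S\<close> trivial on
  \<open>KS\<close>, and such a class dies in \<open>G\<close> exactly when its character is trivial
  on the part of \<open>R\<close> inside the derived subgroup. An element of that part outside
  \<open>KS\<close> is detected by some character of \<open>S\<close>, and this character is
  realised by a class.\<close>

lemma infl_trivial_iff:
  "trivial_homomorphism (B0 Q) (B0 G) infl \<longleftrightarrow> R \<inter> KS = derived F (carrier F) \<inter> R"
proof
  assume eq: "R \<inter> KS = derived F (carrier F) \<inter> R"
  have "infl c = \<one>\<^bsub>B0 G\<^esub>" if c: "c \<in> carrier (B0 Q)" for c
  proof -
    obtain \<alpha> h where lf: "cocycle_lift F Q QmodZ (\<phi> \<circ> \<pi>) \<alpha> h"
      and triv: "\<And>x. x \<in> KS \<Longrightarrow> mu h x = \<one>\<^bsub>QmodZ\<^esub>" and inf: "infl c = class_G (pullback2 G \<phi> \<alpha>)"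
      using B0_Q_lift[OF c] by blast
    have "mu h x = \<one>\<^bsub>QmodZ\<^esub>" if "x \<in> kernel F G \<pi> \<inter> derived F (carrier F)" for x
      using that eq triv by (auto simp: R_def)
    then show ?thesis
      unfolding inf B0_simps lift_class2_eq_one_iff[OF lift_pullback[OF lf] pi_surj] by blast
  qed
  then show "trivial_homomorphism (B0 Q) (B0 G) infl" using infl_hom by (simp add: trivial_homomorphism_def)
next
  assume triv: "trivial_homomorphism (B0 Q) (B0 G) infl"
  show "R \<inter> KS = derived F (carrier F) \<inter> R"
  proof
    show "R \<inter> KS \<subseteq> derived F (carrier F) \<inter> R" using KS_subset_derived by auto
    show "derived F (carrier F) \<inter> R \<subseteq> R \<inter> KS"
    proof
      fix x assume x: "x \<in> derived F (carrier F) \<inter> R"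
      have "x \<in> KS"
      proof (rule ccontr)
        assume xn: "x \<notin> KS"
        have xS: "x \<in> carrier (F\<lparr>carrier := S\<rparr>)" using x R_subset_S by auto
        obtain m where m: "m \<in> hom (F\<lparr>carrier := S\<rparr>) QmodZ" "\<And>c. c \<in> KS \<Longrightarrow> m c = \<one>\<^bsub>QmodZ\<^esub>" "m x \<noteq> \<one>\<^bsub>QmodZ\<^esub>"
          using hom_separation[OF QmodZ_comm_group QmodZ_divisible QmodZ_torsion
              F.subgroup_imp_group[OF S_subgroup] normal_in_subgroup[OF S_subgroup] xS xn]
          by blast
        obtain \<alpha> h where lf: "cocycle_lift F Q QmodZ (\<phi> \<circ> \<pi>) \<alpha> h" and b: "class_Q \<alpha> \<in> carrier (B0 Q)"
          and mu: "\<And>s. s \<in> S \<Longrightarrow> mu h s = m s"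
          using B0_of_hom[OF F.is_group Q.is_group psi_epi, folded S_def, OF m(1) m(2)[OF commutator_in_KS]]
          by blast
        have "infl (class_Q \<alpha>) = \<one>\<^bsub>H2 G QmodZ\<^esub>"
          using triv b by (simp add: trivial_homomorphism_def B0_simps)
        then have "mu h x = \<one>\<^bsub>QmodZ\<^esub>"
          unfolding infl_class[OF cocycle_lift.cocycle[OF lf]]
            lift_class2_eq_one_iff[OF lift_pullback[OF lf] pi_surj]
          using x by (simp add: R_def)
        then show False using mu[of x] m(3) xS by simp
      qed
      then show "x \<in> R \<inter> KS" using x by blast
    qed
  qed
qed

text \<open>If \<open>R \<inter> KS = KR\<close>, a character of \<open>R\<close> trivial on
  \<open>KR\<close> extends to one of \<open>S\<close> trivial on \<open>KS\<close>, which gives a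
  preimage. If some \<open>x\<close> in \<open>R \<inter> KS\<close> lies outside \<open>KR\<close>,
  a character of \<open>R\<close> trivial on \<open>KR\<close> but not at \<open>x\<close> gives a
  class of \<open>B0 G\<close> that is never reached, since all characters coming from
  \<open>B0 Q\<close> vanish at \<open>x\<close>.\<close>

lemma infl_epi_iff: "infl \<in> epi (B0 Q) (B0 G) \<longleftrightarrow> R \<inter> KS = KR"
proof
  assume eq: "R \<inter> KS = KR"
  have "c \<in> infl ` carrier (B0 Q)" if c: "c \<in> carrier (B0 G)" for c
  proof -
    obtain \<beta> k where lf: "cocycle_lift F G QmodZ \<pi> \<beta> k" and c_eq: "c = class_G \<beta>"
      and triv: "\<And>x. x \<in> KR \<Longrightarrow> mu k x = \<one>\<^bsub>QmodZ\<^esub>"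
      using B0_G_lift[OF c] by blast
    have RS: "subgroup R (F\<lparr>carrier := S\<rparr>)" by (rule F.subgroup_incl[OF R_subgroup S_subgroup R_subset_S])
    have hom: "mu k \<in> hom (F\<lparr>carrier := S, carrier := R\<rparr>) QmodZ"
      using cocycle_lift.mu_hom[OF lf] by (simp add: R_def)
    have "mu k x = \<one>\<^bsub>QmodZ\<^esub>" if "x \<in> R" "x \<in> KS" for x
      using that eq triv by blast
    then obtain m where m: "m \<in> hom (F\<lparr>carrier := S\<rparr>) QmodZ" "\<And>x. x \<in> R \<Longrightarrow> m x = mu k x"
      "\<And>x. x \<in> KS \<Longrightarrow> m x = \<one>\<^bsub>QmodZ\<^esub>"
      using hom_extension[OF QmodZ_comm_group QmodZ_divisible F.subgroup_imp_group[OF S_subgroup] RS hom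
          normal_in_subgroup[OF S_subgroup]] by blast
    obtain \<alpha> h where lf': "cocycle_lift F Q QmodZ (\<phi> \<circ> \<pi>) \<alpha> h" and b: "class_Q \<alpha> \<in> carrier (B0 Q)"
      and mu: "\<And>s. s \<in> S \<Longrightarrow> mu h s = m s"
      using B0_of_hom[OF F.is_group Q.is_group psi_epi, folded S_def, OF m(1) m(3)[OF commutator_in_KS]]
      by blast
    have "infl (class_Q \<alpha>) = class_G \<beta>"
      unfolding infl_class[OF cocycle_lift.cocycle[OF lf']] lift_class2_eq_iff[OF lift_pullback[OF lf'] lf pi_surj]
      using mu m(2) R_subset_S by (auto simp: R_def)
    then show ?thesis using b c_eq by blast
  qed
  then show "infl \<in> epi (B0 Q) (B0 G)"
    using infl_hom hom_in_carrier[OF infl_hom] unfolding epi_def by blast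
next
  assume epi: "infl \<in> epi (B0 Q) (B0 G)"
  show "R \<inter> KS = KR"
  proof
    show "KR \<subseteq> R \<inter> KS" using KR_subset_R KR_subset_KS by blast
    show "R \<inter> KS \<subseteq> KR"
    proof
      fix x assume x: "x \<in> R \<inter> KS"
      show "x \<in> KR"
      proof (rule ccontr)
        assume xn: "x \<notin> KR"
        have xR: "x \<in> carrier (F\<lparr>carrier := R\<rparr>)" using x by simp
        obtain m where m: "m \<in> hom (F\<lparr>carrier := R\<rparr>) QmodZ" "\<And>c. c \<in> KR \<Longrightarrow> m c = \<one>\<^bsub>QmodZ\<^esub>" "m x \<noteq> \<one>\<^bsub>QmodZ\<^esub>"
          using hom_separation[OF QmodZ_comm_group QmodZ_divisible QmodZ_torsion
              F.subgroup_imp_group[OF R_subgroup] normal_in_subgroup[OF R_subgroup] xR xn]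
          by blast
        obtain \<beta> k where lf: "cocycle_lift F G QmodZ \<pi> \<beta> k" and b: "class_G \<beta> \<in> carrier (B0 G)"
          and mu: "\<And>s. s \<in> R \<Longrightarrow> mu k s = m s"
          using B0_of_hom[OF F.is_group G.is_group pi, folded R_def, OF m(1) m(2)[OF commutator_in_KR]]
          by blast
        have "class_G \<beta> \<in> infl ` carrier (B0 Q)" using epi b by (simp add: epi_def)
        then obtain c where c: "c \<in> carrier (B0 Q)" "infl c = class_G \<beta>" by auto
        obtain \<alpha> h where lf': "cocycle_lift F Q QmodZ (\<phi> \<circ> \<pi>) \<alpha> h"
          and triv: "\<And>x. x \<in> KS \<Longrightarrow> mu h x = \<one>\<^bsub>QmodZ\<^esub>" and inf: "infl c = class_G (pullback2 G \<phi> \<alpha>)"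
          using B0_Q_lift[OF c(1)] by blast
        \<comment> \<open>Equal classes force equal \<mu> only on the part of \<open>R\<close>
          inside the derived subgroup; \<open>x\<close> belongs to it because \<open>KS\<close> is
          contained in the derived subgroup.\<close>
        have "mu h x = mu k x"
          using c(2) x KS_subset_derived
          unfolding inf lift_class2_eq_iff[OF lift_pullback[OF lf'] lf pi_surj] by (auto simp: R_def)
        then show False using triv[of x] mu[of x] m(3) x by simp
      qed
    qed
  qed
qed

end

section \<open>From abstract surjections to the coset maps of R and N\<close>

theorem theorem1p3:
  fixes F :: "'a monoid" and R S :: "'a set"
    and G :: "'a set monoid" and N :: "'a set set"
  assumes "free_group F"
    and "R \<lhd> F"
    and "G = F Mod R"
    and "finite (carrier G)"
    and "S \<lhd> F"
    and "R \<subseteq> S"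
    and "N = carrier (F\<lparr>carrier := S\<rparr> Mod R)"
  shows "(inf_B0 G N \<in> epi (B0 (G Mod N)) (B0 G) \<longleftrightarrow>
            R \<inter> generate F (commutators F \<inter> S) = generate F (commutators F \<inter> R))
       \<and> (trivial_homomorphism (B0 (G Mod N)) (B0 G) (inf_B0 G N) \<longleftrightarrow>
            R \<inter> generate F (commutators F \<inter> S) = derived F (carrier F) \<inter> R)"
proof -
  interpret F: group F using assms(1) by (simp add: free_group_def)
  interpret R: normal R F by fact
  interpret S: normal S F by fact
  let ?\<pi> = "\<lambda>x. R #>\<^bsub>F\<^esub> x"
  interpret G: group G unfolding assms(3) by (rule R.factorgroup_is_group)
  have pi_hom: "?\<pi> \<in> hom F G" unfolding assms(3) by (rule R.r_coset_hom_Mod)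
  have pi_surj: "?\<pi> ` carrier F = carrier G" unfolding assms(3) FactGroup_def RCOSETS_def by auto
  \<comment> \<open>As the image of \<open>S\<close> under a surjection, \<open>N\<close> inherits
    normality, and membership in \<open>N\<close> can be tested on representatives in
    \<open>F\<close>.\<close>
  have N_img: "N = ?\<pi> ` S"
    unfolding assms(7) FactGroup_def RCOSETS_def by (auto simp: r_coset_def)
  have "group_hom F G ?\<pi>" using pi_hom by (simp add: group_hom_def group_hom_axioms_def F.is_group G.is_group)
  then interpret N: normal N G unfolding N_img by (rule S.surj_hom_normal_subgroup[OF _ pi_surj])
  let ?\<phi> = "\<lambda>x. N #>\<^bsub>G\<^esub> x"
  have phi_hom: "?\<phi> \<in> hom G (G Mod N)" by (rule N.r_coset_hom_Mod)
  have phi_surj: "?\<phi> ` carrier G = carrier (G Mod N)" unfolding FactGroup_def RCOSETS_def by auto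
  interpret I: inflation F G "G Mod N" ?\<pi> ?\<phi>
    using assms(1) pi_hom pi_surj phi_hom phi_surj
    by (intro inflation.intro inflation_axioms.intro F.is_group G.is_group N.factorgroup_is_group) (simp_all add: epi_def)
  have "I.R = R"
  proof -
    have "R #>\<^bsub>F\<^esub> x = R \<longleftrightarrow> x \<in> R" if "x \<in> carrier F" for x
      using that F.coset_join1[OF _ that R.subgroup_axioms] F.coset_join2[OF that R.subgroup_axioms] R.subset by blast
    moreover have "\<one>\<^bsub>G\<^esub> = R" by (simp add: assms(3) FactGroup_def)
    ultimately show ?thesis using R.subset unfolding I.R_def kernel_def by auto
  qed
  moreover have "I.S = S"
  proof -
    have "N #>\<^bsub>G\<^esub> (R #>\<^bsub>F\<^esub> x) = N \<longleftrightarrow> x \<in> S" if x: "x \<in> carrier F" for x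
    proof -
      have px: "?\<pi> x \<in> carrier G" using pi_surj x by blast
      have "N #>\<^bsub>G\<^esub> ?\<pi> x = N \<longleftrightarrow> ?\<pi> x \<in> N"
        using G.coset_join1[OF _ px N.subgroup_axioms] G.coset_join2[OF px N.subgroup_axioms] by blast
      also have "\<dots> \<longleftrightarrow> x \<in> S"
      proof
        assume "?\<pi> x \<in> N"
        then obtain s where s: "s \<in> S" "R #>\<^bsub>F\<^esub> x = R #>\<^bsub>F\<^esub> s" unfolding N_img by blast
        \<comment> \<open>Equality of cosets only gives \<open>x = r s\<close> with \<open>r\<close>
          in \<open>R\<close>; the inclusion of \<open>R\<close> in \<open>S\<close> then yields
          \<open>x\<close> in \<open>S\<close>.\<close>
        have "x \<in> R #>\<^bsub>F\<^esub> s" using F.rcos_self[OF x R.subgroup_axioms] s(2) by simp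
        then obtain r where "r \<in> R" "x = r \<otimes>\<^bsub>F\<^esub> s" unfolding r_coset_def by blast
        then show "x \<in> S" using assms(6) s(1) by auto
      qed (simp add: N_img)
      finally show ?thesis .
    qed
    then show ?thesis using S.subset unfolding I.S_def kernel_def by (auto simp: FactGroup_def)
  qed
  ultimately show ?thesis
    using I.infl_epi_iff I.infl_trivial_iff by (simp add: inf_B0_def)
qed

end
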